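(* Let $C$ be a small category and let $\mathcal{D}=\{D_a\}_{a\in A}$ be an ideal cover or a filter cover of $C$. Then the natural functor $\rho:\mathrm{Gr}(\check{C}(\mathcal{D}))\to C$ from the Grothendieck construction of the Čech nerve of $\mathcal{D}$ to $C$ induces a homotopy equivalence between the classifying spaces $B\,\mathrm{Gr}(\check{C}(\mathcal{D}))$ and $BC$.
   Context: The classifying space $BC$ of a small category $C$ is the geometric realization of its nerve. Covers. For subcategories $\{D_a\}_{a\in A}$ of a small category $C$ indexed by a set $A$, the union $\bigcup_{a} D_a$ is the subcategory of $C$ with object set $\bigcup_a \mathrm{ob}(D_a)$ whose morphisms are all finite compositions $f_n\cdots f_0$ of composable morphisms $f_i$ of $C$, each $f_i$ belonging to some $D_{a_i}$. The family $\mathcal{D}=\{D_a\}_{a\in A}$ is a cover of $C$ if $C=\bigcup_{a\in A}D_a$. Write $D_{a_0\ldots a_n}=D_{a_0}\cap\cdots\cap D_{a_n}$ (intersection on objects and on morphisms). Ideals and filters. An ideal $D$ of $C$ is a full subcategory such that an object $y$ of $C$ belongs to $D$ whenever $C(y,x)\neq\emptyset$ for some object $x$ of $D$. A filter $D$ of $C$ is a full subcategory such that an object $y$ of $C$ belongs to $D$ whenever $C(x,y)\neq\emptyset$ for some object $x$ of $D$. A cover $\{D_a\}_{a\in A}$ is an ideal (resp. filter) cover if every $D_a$ is an ideal (resp. filter) of $C$. Čech nerve. Let $\Delta$ be the category of the totally ordered sets $[n]=\{0,\ldots,n\}$, $n\ge 0$, and order preserving maps, and let $\mathbf{Cat}$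 be the category of small categories. The Čech nerve is the functor $\check{C}(\mathcal{D}):\Delta^{\mathrm{op}}\to\mathbf{Cat}$ with $\check{C}(\mathcal{D})_n=\coprod_{a_0,\ldots,a_n\in A}D_{a_0\ldots a_n}$; an object or morphism $x$ in the summand $D_{a_0\ldots a_n}$ is written $x_{a_0\ldots a_n}$. An order preserving map $\varphi:[m]\to[n]$ is sent to the functor $x_{a_0\ldots a_n}\mapsto x_{b_0\ldots b_m}$ with $b_j=a_{\varphi(j)}$. Grothendieck construction. For a functor $F:K\to\mathbf{Cat}$ on a small category $K$, $\mathrm{Gr}(F)$ has as objects the pairs $(c,x)$ with $c\in\mathrm{ob}(K)$, $x\in\mathrm{ob}(F(c))$; morphisms $(c,x)\to(d,y)$ are pairs $(f,g)$ with $f\in K(c,d)$, $g\in F(d)(F(f)(x),y)$; composition is $(f_2,g_2)(f_1,g_1)=(f_2f_1,\,g_2\circ F(f_2)(g_1))$. Explicitly, objects of $\mathrm{Gr}(\check{C}(\mathcal{D}))$ are the $x_{a_0\ldots a_n}$ ($n\ge 0$, $a_i\in A$, $x\in\mathrm{ob}(D_{a_0\ldots a_n})$), and a morphism $x_{a_0\ldots a_n}\to y_{b_0\ldots b_m}$ is a pair $(\varphi,f_{b_0\ldots b_m})$ of an order preserving map $\varphi:[m]\to[n]$ with $b_j=a_{\varphi(j)}$ for all $j$ and a morphism $f:x\to y$ of $D_{b_0\ldots b_m}$. The natural functor $\rho$ forgets indices: $\rho(x_{a_0\ldots a_n})=x$ and $\rho(\varphi,f_{b_0\ldots b_m})=f$.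 *)

theory Defs
  imports "HOL-Analysis.Analysis" "HOL-Homology.Simplices"
begin

section \<open>Small categories and functors\<close>

text \<open>The structure maps are only meaningful on \<open>Ob\<close> and \<open>Ar\<close>;
  \<open>Cmp C g f\<close> is the composite of \<open>f\<close> followed by \<open>g\<close>.\<close>

record ('o, 'm) category =
  Ob :: "'o set"
  Ar :: "'m set"
  Src :: "'m \<Rightarrow> 'o"
  Tgt :: "'m \<Rightarrow> 'o"
  Idn :: "'o \<Rightarrow> 'm"
  Cmp :: "'m \<Rightarrow> 'm \<Rightarrow> 'm"

locale category =
  fixes C :: "('o, 'm) category"
  assumes Src_Ob: "f \<in> Ar C \<Longrightarrow> Src C f \<in> Ob C"
    and Tgt_Ob: "f \<in> Ar C \<Longrightarrow> Tgt C f \<in> Ob C"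
    and Idn_Ar: "x \<in> Ob C \<Longrightarrow> Idn C x \<in> Ar C"
    and Src_Idn: "x \<in> Ob C \<Longrightarrow> Src C (Idn C x) = x"
    and Tgt_Idn: "x \<in> Ob C \<Longrightarrow> Tgt C (Idn C x) = x"
    and Cmp_Ar: "\<lbrakk>f \<in> Ar C; g \<in> Ar C; Src C g = Tgt C f\<rbrakk> \<Longrightarrow> Cmp C g f \<in> Ar C"
    and Src_Cmp: "\<lbrakk>f \<in> Ar C; g \<in> Ar C; Src C g = Tgt C f\<rbrakk> \<Longrightarrow> Src C (Cmp C g f) = Src C f"
    and Tgt_Cmp: "\<lbrakk>f \<in> Ar C; g \<in> Ar C; Src C g = Tgt C f\<rbrakk> \<Longrightarrow> Tgt C (Cmp C g f) = Tgt C g"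
    and Cmp_Idn: "f \<in> Ar C \<Longrightarrow> Cmp C f (Idn C (Src C f)) = f"
    and Idn_Cmp: "f \<in> Ar C \<Longrightarrow> Cmp C (Idn C (Tgt C f)) f = f"
    and Cmp_assoc: "\<lbrakk>f \<in> Ar C; g \<in> Ar C; h \<in> Ar C; Src C g = Tgt C f; Src C h = Tgt C g\<rbrakk>
      \<Longrightarrow> Cmp C h (Cmp C g f) = Cmp C (Cmp C h g) f"

definition hom :: "('o, 'm) category \<Rightarrow> 'o \<Rightarrow> 'o \<Rightarrow> 'm set" where
  "hom C x y = {f \<in> Ar C. Src C f = x \<and> Tgt C f = y}"

definition opcat :: "('o, 'm) category \<Rightarrow> ('o, 'm) category" where
  "opcat C = C\<lparr>Src := Tgt C, Tgt := Src C, Cmp := (\<lambda>g f. Cmp C f g)\<rparr>"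

record ('o, 'm, 'p, 'q) functor_data =
  onOb :: "'o \<Rightarrow> 'p"
  onAr :: "'m \<Rightarrow> 'q"

text \<open>Functors are extensional (\<open>undefined\<close> off the source category), so that two functors are
  equal as HOL values iff they agree on the objects and morphisms of the source.\<close>

definition is_functor ::
  "('o, 'm) category \<Rightarrow> ('p, 'q) category \<Rightarrow> ('o, 'm, 'p, 'q) functor_data \<Rightarrow> bool" where
  "is_functor C D F \<longleftrightarrow>
     onOb F \<in> Ob C \<rightarrow>\<^sub>E Ob D \<and> onAr F \<in> Ar C \<rightarrow>\<^sub>E Ar D \<and>
     (\<forall>f\<in>Ar C. Src D (onAr F f) = onOb F (Src C f) \<and> Tgt D (onAr F f) = onOb F (Tgt C f)) \<and>
     (\<forall>x\<in>Ob C. onAr F (Idn C x) = Idn D (onOb F x)) \<and>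
     (\<forall>f\<in>Ar C. \<forall>g\<in>Ar C. Src C g = Tgt C f \<longrightarrow>
        onAr F (Cmp C g f) = Cmp D (onAr F g) (onAr F f))"

definition id_functor :: "('o, 'm) category \<Rightarrow> ('o, 'm, 'o, 'm) functor_data" where
  "id_functor C = \<lparr>onOb = restrict id (Ob C), onAr = restrict id (Ar C)\<rparr>"

text \<open>\<open>comp_functor C G F\<close> is \<open>G \<circ> F\<close> for \<open>F\<close> with source \<open>C\<close>.\<close>

definition comp_functor :: "('o, 'm) category \<Rightarrow> ('p, 'q, 'r, 's) functor_data \<Rightarrow>
    ('o, 'm, 'p, 'q) functor_data \<Rightarrow> ('o, 'm, 'r, 's) functor_data" where
  "comp_functor C G F =
     \<lparr>onOb = compose (Ob C) (onOb G) (onOb F), onAr = compose (Ar C) (onAr G) (onAr F)\<rparr>"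

text \<open>The categories of sets and of small categories carried by fixed HOL types. A morphism
  \<open>(S, T, f)\<close> records its source and target.\<close>

definition Set_cat :: "('s set, 's set \<times> 's set \<times> ('s \<Rightarrow> 's)) category" where
  "Set_cat = \<lparr>Ob = UNIV, Ar = {(S, T, f). f \<in> S \<rightarrow>\<^sub>E T},
     Src = fst, Tgt = (\<lambda>a. fst (snd a)), Idn = (\<lambda>S. (S, S, restrict id S)),
     Cmp = (\<lambda>(S', T', g) (S, T, f). (S, T', compose S g f))\<rparr>"

definition Cat_cat :: "(('o, 'm) category,
    ('o, 'm) category \<times> ('o, 'm) category \<times> ('o, 'm, 'o, 'm) functor_data) category" where
  "Cat_cat = \<lparr>Ob = {C. category C},
     Ar = {(C, D, F). category C \<and> category D \<and> is_functor C D F},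
     Src = fst, Tgt = (\<lambda>a. fst (snd a)), Idn = (\<lambda>C. (C, C, id_functor C)),
     Cmp = (\<lambda>(C', D', G) (C, D, F). (C, D', comp_functor C G F))\<rparr>"

text \<open>The underlying function, or functor, of the value at a morphism of a functor into
  \<open>Set_cat\<close> or \<open>Cat_cat\<close>.\<close>

definition act :: "('o, 'm, 'p, 'c \<times> 'd \<times> 'f) functor_data \<Rightarrow> 'm \<Rightarrow> 'f" where
  "act F f = snd (snd (onAr F f))"


section \<open>The simplex category, nerves and geometric realization\<close>

text \<open>The number \<open>n\<close> stands for the object \<open>[n] = {0, \<dots>, n}\<close> of \<open>Delta\<close>.\<close>

definition Delta :: "(nat, nat \<times> nat \<times> (nat \<Rightarrow> nat)) category" where
  "Delta = \<lparr>Ob = UNIV, Ar = {(m, n, \<phi>). \<phi> \<in> {..m} \<rightarrow>\<^sub>E {..n} \<and> mono_on {..m} \<phi>},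
     Src = fst, Tgt = (\<lambda>a. fst (snd a)), Idn = (\<lambda>n. (n, n, restrict id {..n})),
     Cmp = (\<lambda>(m', n', \<psi>) (m, n, \<phi>). (m, n', compose {..m} \<psi> \<phi>))\<rparr>"

definition ordinal :: "nat \<Rightarrow> (nat, nat \<times> nat) category" where
  "ordinal n = \<lparr>Ob = {..n}, Ar = {(i, j). i \<le> j \<and> j \<le> n}, Src = fst, Tgt = snd,
     Idn = (\<lambda>i. (i, i)), Cmp = (\<lambda>g f. (fst f, snd g))\<rparr>"

definition ordinal_functor ::
    "nat \<times> nat \<times> (nat \<Rightarrow> nat) \<Rightarrow> (nat, nat \<times> nat, nat, nat \<times> nat) functor_data" where
  "ordinal_functor = (\<lambda>(m, n, \<phi>).
     \<lparr>onOb = restrict \<phi> (Ob (ordinal m)),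
      onAr = (\<lambda>(i, j)\<in>Ar (ordinal m). (\<phi> i, \<phi> j))\<rparr>)"

type_synonym 's sset =
  "(nat, nat \<times> nat \<times> (nat \<Rightarrow> nat), 's set, 's set \<times> 's set \<times> ('s \<Rightarrow> 's)) functor_data"

definition simplicial_set :: "'s sset \<Rightarrow> bool" where
  "simplicial_set X \<longleftrightarrow> is_functor (opcat Delta) Set_cat X"

definition nerve :: "('o, 'm) category \<Rightarrow> (nat, nat \<times> nat, 'o, 'm) functor_data sset" where
  "nerve C =
     (let N = (\<lambda>n. {\<sigma>. is_functor (ordinal n) C \<sigma>}) in
      \<lparr>onOb = N,
       onAr = (\<lambda>(m, n, \<phi>)\<in>Ar Delta.
         (N n, N m, \<lambda>\<sigma>\<in>N n. comp_functor (ordinal m) \<sigma> (ordinal_functor (m, n, \<phi>))))\<rparr>)"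

definition quotient_topology :: "'a topology \<Rightarrow> ('a \<Rightarrow> 'b) \<Rightarrow> 'b topology" where
  "quotient_topology X q =
     topology (\<lambda>U. U \<subseteq> q ` topspace X \<and> openin X {x \<in> topspace X. q x \<in> U})"

lemma openin_quotient_topology:
  fixes q :: "'a \<Rightarrow> 'b"
  shows "openin (quotient_topology X q) U \<longleftrightarrow>
     U \<subseteq> q ` topspace X \<and> openin X {x \<in> topspace X. q x \<in> U}"
proof -
  have "istopology (\<lambda>U. U \<subseteq> q ` topspace X \<and> openin X {x \<in> topspace X. q x \<in> U})"
    unfolding istopology_def
  proof (rule conjI; clarify)
    fix S T :: "'b set"
    assume "openin X {x \<in> topspace X. q x \<in> S}" "openin X {x \<in> topspace X. q x \<in> T}"
      and "S \<subseteq> q ` topspace X"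
    moreover have "{x \<in> topspace X. q x \<in> S \<inter> T} =
        {x \<in> topspace X. q x \<in> S} \<inter> {x \<in> topspace X. q x \<in> T}" by auto
    ultimately show "S \<inter> T \<subseteq> q ` topspace X \<and> openin X {x \<in> topspace X. q x \<in> S \<inter> T}"
      by auto
  next
    fix K :: "'b set set"
    assume K: "\<forall>U\<in>K. U \<subseteq> q ` topspace X \<and> openin X {x \<in> topspace X. q x \<in> U}"
    have "{x \<in> topspace X. q x \<in> \<Union>K} = (\<Union>U\<in>K. {x \<in> topspace X. q x \<in> U})" by auto
    with K show "\<Union>K \<subseteq> q ` topspace X \<and> openin X {x \<in> topspace X. q x \<in> \<Union>K}"
      by (auto intro: openin_Union)
  qed
  then show ?thesis
    by (simp add: quotient_topology_def)
qed

lemma topspace_quotient_topology: "topspace (quotient_topology X q) = q ` topspace X"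
proof (rule subset_antisym)
  show "topspace (quotient_topology X q) \<subseteq> q ` topspace X"
    by (meson openin_quotient_topology openin_topspace)
  have "openin (quotient_topology X q) (q ` topspace X)"
  proof -
    have "{x \<in> topspace X. q x \<in> q ` topspace X} = topspace X" by auto
    then show ?thesis
      by (simp add: openin_quotient_topology)
  qed
  then show "q ` topspace X \<subseteq> topspace (quotient_topology X q)"
    by (rule openin_subset)
qed

lemma quotient_map_quotient_topology: "quotient_map X (quotient_topology X q) q"
  by (auto simp: quotient_map_def topspace_quotient_topology openin_quotient_topology)

text \<open>The affine map of standard simplices that sends the \<open>i\<close>th vertex to the \<open>\<phi> i\<close>th one.\<close>

definition simplex_push :: "nat \<Rightarrow> (nat \<Rightarrow> nat) \<Rightarrow> (nat \<Rightarrow> real) \<Rightarrow> nat \<Rightarrow> real" where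
  "simplex_push m \<phi> t = (\<lambda>j. \<Sum>i\<in>{i. i \<le> m \<and> \<phi> i = j}. t i)"

definition presentation :: "'s sset \<Rightarrow> (nat \<times> 's \<times> (nat \<Rightarrow> real)) topology" where
  "presentation X =
     sum_topology (\<lambda>n. prod_topology (discrete_topology (onOb X n))
       (subtopology (powertop_real UNIV) (standard_simplex n))) UNIV"

inductive glue :: "'s sset \<Rightarrow> nat \<times> 's \<times> (nat \<Rightarrow> real) \<Rightarrow> nat \<times> 's \<times> (nat \<Rightarrow> real) \<Rightarrow> bool"
  for X :: "'s sset" where
  "\<lbrakk>(m, n, \<phi>) \<in> Ar Delta; \<sigma> \<in> onOb X n; t \<in> standard_simplex m\<rbrakk>
   \<Longrightarrow> glue X (m, act X (m, n, \<phi>) \<sigma>, t) (n, \<sigma>, simplex_push m \<phi> t)"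

definition glue_class ::
    "'s sset \<Rightarrow> nat \<times> 's \<times> (nat \<Rightarrow> real) \<Rightarrow> (nat \<times> 's \<times> (nat \<Rightarrow> real)) set" where
  "glue_class X p = {p'. equivclp (glue X) p p'}"

definition realization :: "'s sset \<Rightarrow> (nat \<times> 's \<times> (nat \<Rightarrow> real)) set topology" where
  "realization X = quotient_topology (presentation X) (glue_class X)"

definition simplicial_map :: "'s sset \<Rightarrow> 't sset \<Rightarrow> (nat \<Rightarrow> 's \<Rightarrow> 't) \<Rightarrow> bool" where
  "simplicial_map X Y h \<longleftrightarrow>
     (\<forall>n. h n \<in> onOb X n \<rightarrow> onOb Y n) \<and>
     (\<forall>m n \<phi>. (m, n, \<phi>) \<in> Ar Delta \<longrightarrow>
        (\<forall>\<sigma>\<in>onOb X n. h m (act X (m, n, \<phi>) \<sigma>) = act Y (m, n, \<phi>) (h n \<sigma>)))"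

text \<open>On a class \<open>c\<close> the set below is a singleton, whatever the representatives; see
  \<open>realization_map_class\<close>.\<close>

definition realization_map :: "'t sset \<Rightarrow> (nat \<Rightarrow> 's \<Rightarrow> 't) \<Rightarrow>
    (nat \<times> 's \<times> (nat \<Rightarrow> real)) set \<Rightarrow> (nat \<times> 't \<times> (nat \<Rightarrow> real)) set" where
  "realization_map Y h c = the_elem ((\<lambda>(n, \<sigma>, t). glue_class Y (n, h n \<sigma>, t)) ` c)"

definition classifying_space :: "('o, 'm) category \<Rightarrow>
    (nat \<times> (nat, nat \<times> nat, 'o, 'm) functor_data \<times> (nat \<Rightarrow> real)) set topology" where
  "classifying_space C = realization (nerve C)"

definition nerve_map :: "('o, 'm, 'p, 'q) functor_data \<Rightarrow> nat \<Rightarrow>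
    (nat, nat \<times> nat, 'o, 'm) functor_data \<Rightarrow> (nat, nat \<times> nat, 'p, 'q) functor_data" where
  "nerve_map F n \<sigma> = comp_functor (ordinal n) F \<sigma>"

definition classifying_map :: "('p, 'q) category \<Rightarrow> ('o, 'm, 'p, 'q) functor_data \<Rightarrow>
    (nat \<times> (nat, nat \<times> nat, 'o, 'm) functor_data \<times> (nat \<Rightarrow> real)) set \<Rightarrow>
    (nat \<times> (nat, nat \<times> nat, 'p, 'q) functor_data \<times> (nat \<Rightarrow> real)) set" where
  "classifying_map D F = realization_map (nerve D) (nerve_map F)"

definition homotopy_equivalence :: "'a topology \<Rightarrow> 'b topology \<Rightarrow> ('a \<Rightarrow> 'b) \<Rightarrow> bool" where
  "homotopy_equivalence X Y f \<longleftrightarrow>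
     continuous_map X Y f \<and>
     (\<exists>g. continuous_map Y X g \<and>
        homotopic_with (\<lambda>x. True) X X (g \<circ> f) id \<and>
        homotopic_with (\<lambda>x. True) Y Y (f \<circ> g) id)"


section \<open>Covers, ideals and filters\<close>

definition subcategory :: "('o, 'm) category \<Rightarrow> ('o, 'm) category \<Rightarrow> bool" where
  "subcategory C D \<longleftrightarrow> category D \<and> Ob D \<subseteq> Ob C \<and> Ar D \<subseteq> Ar C \<and>
     (\<forall>f\<in>Ar D. Src D f = Src C f \<and> Tgt D f = Tgt C f) \<and>
     (\<forall>x\<in>Ob D. Idn D x = Idn C x) \<and>
     (\<forall>f\<in>Ar D. \<forall>g\<in>Ar D. Src C g = Tgt C f \<longrightarrow> Cmp D g f = Cmp C g f)"

inductive_set compositions :: "('o, 'm) category \<Rightarrow> 'm set \<Rightarrow> 'm set"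
  for C :: "('o, 'm) category" and S :: "'m set" where
  single: "f \<in> S \<Longrightarrow> f \<in> compositions C S"
| step: "\<lbrakk>f \<in> compositions C S; g \<in> S; Src C g = Tgt C f\<rbrakk> \<Longrightarrow> Cmp C g f \<in> compositions C S"

definition union_subcategory ::
    "('o, 'm) category \<Rightarrow> 'a set \<Rightarrow> ('a \<Rightarrow> ('o, 'm) category) \<Rightarrow> ('o, 'm) category" where
  "union_subcategory C A D =
     C\<lparr>Ob := (\<Union>a\<in>A. Ob (D a)), Ar := compositions C (\<Union>a\<in>A. Ar (D a))\<rparr>"

definition cover :: "('o, 'm) category \<Rightarrow> 'a set \<Rightarrow> ('a \<Rightarrow> ('o, 'm) category) \<Rightarrow> bool" where
  "cover C A D \<longleftrightarrow> (\<forall>a\<in>A. subcategory C (D a)) \<and> C = union_subcategory C A D"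

definition full_subcategory :: "('o, 'm) category \<Rightarrow> ('o, 'm) category \<Rightarrow> bool" where
  "full_subcategory C D \<longleftrightarrow> subcategory C D \<and> (\<forall>x\<in>Ob D. \<forall>y\<in>Ob D. hom D x y = hom C x y)"

definition category_ideal :: "('o, 'm) category \<Rightarrow> ('o, 'm) category \<Rightarrow> bool" where
  "category_ideal C D \<longleftrightarrow> full_subcategory C D \<and>
     (\<forall>y\<in>Ob C. (\<exists>x\<in>Ob D. hom C y x \<noteq> {}) \<longrightarrow> y \<in> Ob D)"

definition category_filter :: "('o, 'm) category \<Rightarrow> ('o, 'm) category \<Rightarrow> bool" where
  "category_filter C D \<longleftrightarrow> full_subcategory C D \<and>
     (\<forall>y\<in>Ob C. (\<exists>x\<in>Ob D. hom C x y \<noteq> {}) \<longrightarrow> y \<in> Ob D)"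

definition ideal_cover :: "('o, 'm) category \<Rightarrow> 'a set \<Rightarrow> ('a \<Rightarrow> ('o, 'm) category) \<Rightarrow> bool" where
  "ideal_cover C A D \<longleftrightarrow> cover C A D \<and> (\<forall>a\<in>A. category_ideal C (D a))"

definition filter_cover :: "('o, 'm) category \<Rightarrow> 'a set \<Rightarrow> ('a \<Rightarrow> ('o, 'm) category) \<Rightarrow> bool" where
  "filter_cover C A D \<longleftrightarrow> cover C A D \<and> (\<forall>a\<in>A. category_filter C (D a))"


section \<open>The Cech nerve and the Grothendieck construction\<close>

text \<open>A tuple \<open>a\<^sub>0 \<dots> a\<^sub>n\<close> is a list of length \<open>n + 1\<close>, and an object or morphism
  \<open>x\<close> in the summand of the tuple \<open>as\<close> is the pair \<open>(as, x)\<close>.\<close>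

definition tuples :: "'a set \<Rightarrow> nat \<Rightarrow> 'a list set" where
  "tuples A n = {as. length as = Suc n \<and> set as \<subseteq> A}"

definition reindex :: "nat \<Rightarrow> (nat \<Rightarrow> nat) \<Rightarrow> 'a list \<Rightarrow> 'a list" where
  "reindex m \<phi> as = map (\<lambda>j. as ! \<phi> j) [0..<Suc m]"

definition inter_subcategory ::
    "('o, 'm) category \<Rightarrow> ('a \<Rightarrow> ('o, 'm) category) \<Rightarrow> 'a list \<Rightarrow> ('o, 'm) category" where
  "inter_subcategory C D as =
     C\<lparr>Ob := (\<Inter>a\<in>set as. Ob (D a)), Ar := (\<Inter>a\<in>set as. Ar (D a))\<rparr>"

definition coproduct_category ::
    "'i set \<Rightarrow> ('i \<Rightarrow> ('o, 'm) category) \<Rightarrow> ('i \<times> 'o, 'i \<times> 'm) category" where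
  "coproduct_category I E =
     \<lparr>Ob = (SIGMA i:I. Ob (E i)), Ar = (SIGMA i:I. Ar (E i)),
      Src = (\<lambda>(i, f). (i, Src (E i) f)), Tgt = (\<lambda>(i, f). (i, Tgt (E i) f)),
      Idn = (\<lambda>(i, x). (i, Idn (E i) x)), Cmp = (\<lambda>(i, g) (j, f). (i, Cmp (E i) g f))\<rparr>"

definition cech_level :: "('o, 'm) category \<Rightarrow> 'a set \<Rightarrow> ('a \<Rightarrow> ('o, 'm) category) \<Rightarrow>
    nat \<Rightarrow> ('a list \<times> 'o, 'a list \<times> 'm) category" where
  "cech_level C A D n = coproduct_category (tuples A n) (inter_subcategory C D)"

definition cech_nerve :: "('o, 'm) category \<Rightarrow> 'a set \<Rightarrow> ('a \<Rightarrow> ('o, 'm) category) \<Rightarrow>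
    (nat, nat \<times> nat \<times> (nat \<Rightarrow> nat), ('a list \<times> 'o, 'a list \<times> 'm) category,
     ('a list \<times> 'o, 'a list \<times> 'm) category \<times> ('a list \<times> 'o, 'a list \<times> 'm) category \<times>
       ('a list \<times> 'o, 'a list \<times> 'm, 'a list \<times> 'o, 'a list \<times> 'm) functor_data) functor_data" where
  "cech_nerve C A D =
     \<lparr>onOb = cech_level C A D,
      onAr = (\<lambda>(m, n, \<phi>)\<in>Ar Delta.
        (cech_level C A D n, cech_level C A D m,
         \<lparr>onOb = (\<lambda>(as, x)\<in>Ob (cech_level C A D n). (reindex m \<phi> as, x)),
          onAr = (\<lambda>(as, f)\<in>Ar (cech_level C A D n). (reindex m \<phi> as, f))\<rparr>))\<rparr>"

text \<open>For \<open>F\<close> from \<open>K\<close> to \<open>Cat_cat\<close>. The morphism \<open>(f, g)\<close> from \<open>(c, x)\<close> to \<open>(d, y)\<close> is encoded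
  as \<open>((c, x), f, g)\<close>: its target \<open>(d, y)\<close> can be read off from \<open>f\<close> and \<open>g\<close>, its source object
  \<open>x\<close> cannot.\<close>

definition grothendieck :: "('k, 'l) category \<Rightarrow>
    ('k, 'l, ('o, 'm) category,
     ('o, 'm) category \<times> ('o, 'm) category \<times> ('o, 'm, 'o, 'm) functor_data) functor_data \<Rightarrow>
    ('k \<times> 'o, ('k \<times> 'o) \<times> 'l \<times> 'm) category" where
  "grothendieck K F =
     \<lparr>Ob = (SIGMA c:Ob K. Ob (onOb F c)),
      Ar = {((c, x), f, g). c \<in> Ob K \<and> x \<in> Ob (onOb F c) \<and>
              f \<in> Ar K \<and> Src K f = c \<and> g \<in> Ar (onOb F (Tgt K f)) \<and>
              Src (onOb F (Tgt K f)) g = onOb (act F f) x},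
      Src = fst,
      Tgt = (\<lambda>(s, f, g). (Tgt K f, Tgt (onOb F (Tgt K f)) g)),
      Idn = (\<lambda>(c, x). ((c, x), Idn K c, Idn (onOb F c) x)),
      Cmp = (\<lambda>(s2, f2, g2) (s1, f1, g1).
        (s1, Cmp K f2 f1, Cmp (onOb F (Tgt K f2)) g2 (onAr (act F f2) g1)))\<rparr>"

definition Gr_cech :: "('o, 'm) category \<Rightarrow> 'a set \<Rightarrow> ('a \<Rightarrow> ('o, 'm) category) \<Rightarrow>
    (nat \<times> 'a list \<times> 'o,
     (nat \<times> 'a list \<times> 'o) \<times> (nat \<times> nat \<times> (nat \<Rightarrow> nat)) \<times> 'a list \<times> 'm) category" where
  "Gr_cech C A D = grothendieck (opcat Delta) (cech_nerve C A D)"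

definition rho :: "('o, 'm) category \<Rightarrow> 'a set \<Rightarrow> ('a \<Rightarrow> ('o, 'm) category) \<Rightarrow>
    (nat \<times> 'a list \<times> 'o,
     (nat \<times> 'a list \<times> 'o) \<times> (nat \<times> nat \<times> (nat \<Rightarrow> nat)) \<times> 'a list \<times> 'm, 'o, 'm) functor_data" where
  "rho C A D =
     \<lparr>onOb = (\<lambda>(n, as, x)\<in>Ob (Gr_cech C A D). x),
      onAr = (\<lambda>(s, \<phi>, as, f)\<in>Ar (Gr_cech C A D). f)\<rparr>"


section \<open>The constructions are well defined\<close>

lemma category_opcat: "category C \<Longrightarrow> category (opcat C)"
  unfolding category_def opcat_def by simp

lemma category_Delta: "category Delta"
  apply (rule category.intro)
  apply (auto simp: Delta_def compose_def mono_on_def fun_eq_iff PiE_iff extensional_def Pi_iff)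
  done

lemma category_ordinal: "category (ordinal n)"
  by (rule category.intro) (auto simp: ordinal_def)

lemma category_Set_cat: "category Set_cat"
  apply (rule category.intro)
  apply (auto simp: Set_cat_def compose_def fun_eq_iff PiE_iff extensional_def Pi_iff)
  apply metis
  done

lemma is_functor_comp:
  assumes C: "category C" and F: "is_functor C D F" and G: "is_functor D E G"
  shows "is_functor C E (comp_functor C G F)"
proof -
  interpret category C by (rule C)
  have ob: "onOb F x \<in> Ob D" if "x \<in> Ob C" for x using F that by (auto simp: is_functor_def)
  have ar: "onAr F x \<in> Ar D" if "x \<in> Ar C" for x using F that by (auto simp: is_functor_def)
  from F G ob ar show ?thesis
    unfolding is_functor_def comp_functor_def
    by (auto simp: compose_def PiE_iff extensional_def Src_Ob Tgt_Ob Idn_Ar Cmp_Ar)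
qed

lemma is_functor_id: "category C \<Longrightarrow> is_functor C C (id_functor C)"
  unfolding category_def is_functor_def id_functor_def by auto

lemma comp_functor_assoc:
  assumes "is_functor C D F"
  shows "comp_functor C H (comp_functor C G F) = comp_functor C (comp_functor D H G) F"
  using assms
  by (auto simp: is_functor_def comp_functor_def compose_def fun_eq_iff PiE_iff Pi_iff)

lemma comp_functor_id_right: "is_functor C D F \<Longrightarrow> comp_functor C F (id_functor C) = F"
  by (rule functor_data.equality)
     (auto simp: is_functor_def comp_functor_def id_functor_def compose_def fun_eq_iff PiE_iff Pi_iff extensional_def)

lemma comp_functor_id_left: "is_functor C D F \<Longrightarrow> comp_functor C (id_functor D) F = F"
  by (rule functor_data.equality)
     (auto simp: is_functor_def comp_functor_def id_functor_def compose_def fun_eq_iff PiE_iff Pi_iff extensional_def)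

lemma category_Cat_cat: "category Cat_cat"
  by (rule category.intro)
     (auto simp: Cat_cat_def is_functor_comp is_functor_id comp_functor_id_right
        comp_functor_id_left comp_functor_assoc)

lemma is_functor_ordinal_functor:
  "(m, n, \<phi>) \<in> Ar Delta \<Longrightarrow> is_functor (ordinal m) (ordinal n) (ordinal_functor (m, n, \<phi>))"
  by (auto simp: Delta_def is_functor_def ordinal_functor_def ordinal_def mono_on_def PiE_iff Pi_iff)

lemma ordinal_functor_Idn: "ordinal_functor (Idn Delta n) = id_functor (ordinal n)"
  by (auto simp: Delta_def ordinal_functor_def id_functor_def ordinal_def fun_eq_iff)

lemma ordinal_functor_Cmp:
  assumes "(m, n, \<phi>) \<in> Ar Delta"
  shows "ordinal_functor (Cmp Delta (n, k, \<psi>) (m, n, \<phi>)) =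
    comp_functor (ordinal m) (ordinal_functor (n, k, \<psi>)) (ordinal_functor (m, n, \<phi>))"
  using assms
  by (auto simp: Delta_def ordinal_functor_def comp_functor_def ordinal_def compose_def fun_eq_iff
        mono_on_def PiE_iff Pi_iff)

lemma simplicial_set_nerve:
  fixes C :: "('o, 'm) category"
  shows "simplicial_set (nerve C)"
proof -
  have t: "is_functor (ordinal m) C (comp_functor (ordinal m) \<sigma> (ordinal_functor (m, n, \<phi>)))"
    if "(m, n, \<phi>) \<in> Ar Delta" "is_functor (ordinal n) C \<sigma>" for m n \<phi> \<sigma>
    using that by (metis is_functor_comp category_ordinal is_functor_ordinal_functor)
  have ops: "Ob (opcat Delta) = UNIV" "Ar (opcat Delta) = Ar Delta"
    "Src (opcat Delta) (m, n, \<phi>) = n" "Tgt (opcat Delta) (m, n, \<phi>) = m" 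
    "Idn (opcat Delta) = Idn Delta" 
    "Cmp (opcat Delta) f g = Cmp Delta g f" for m n \<phi> f g
    by (auto simp: opcat_def Delta_def)
  have sets: "Ob Set_cat = UNIV" "Ar Set_cat = {(S, T, f). f \<in> S \<rightarrow>\<^sub>E T}"
     "Src Set_cat (S, T, f) = S" "Tgt Set_cat (S, T, f) = T"
     "Idn Set_cat S = (S, S, restrict id S)"
     "Cmp Set_cat (S', T', g) (S, T, f) = (S, T', compose S g f)"
     for S T S' T' :: "'s set" and f g
    by (auto simp: Set_cat_def)
  have id: "Idn Delta n = (n, n, restrict id {..n})" for n by (simp add: Delta_def)
  have idA: "(n, n, restrict id {..n}) \<in> Ar Delta" for n
    using category.Idn_Ar[OF category_Delta, of n] by (simp add: Delta_def)
  have cmp: "Cmp Delta (n, k, \<psi>) (m, n, \<phi>) = (m, k, compose {..m} \<psi> \<phi>)" for k n m \<phi> \<psi>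
    by (simp add: Delta_def)
  have cmpA: "(m, k, compose {..m} \<psi> \<phi>) \<in> Ar Delta"
    if "(n, k, \<psi>) \<in> Ar Delta" "(m, n, \<phi>) \<in> Ar Delta" for k n m \<phi> \<psi>
    using category.Cmp_Ar[OF category_Delta that(2,1)] by (simp add: Delta_def)
  show ?thesis
    unfolding simplicial_set_def is_functor_def
  proof (intro conjI ballI impI)
    show "onOb (nerve C) \<in> Ob (opcat Delta) \<rightarrow>\<^sub>E Ob Set_cat"
      by (simp add: ops sets)
    show "onAr (nerve C) \<in> Ar (opcat Delta) \<rightarrow>\<^sub>E Ar Set_cat"
      by (auto simp: nerve_def Let_def ops sets t split: if_splits)
    fix f assume "f \<in> Ar (opcat Delta)"
    then show "Src Set_cat (onAr (nerve C) f) = onOb (nerve C) (Src (opcat Delta) f)"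
     and "Tgt Set_cat (onAr (nerve C) f) = onOb (nerve C) (Tgt (opcat Delta) f)"
      by (cases f; auto simp: nerve_def Let_def ops sets)+
  next
    fix n
    show "onAr (nerve C) (Idn (opcat Delta) n) = Idn Set_cat (onOb (nerve C) n)"
      using ordinal_functor_Idn[of n]
      by (auto simp: nerve_def Let_def ops sets id idA comp_functor_id_right)
  next
    fix f g assume f: "f \<in> Ar (opcat Delta)" and g: "g \<in> Ar (opcat Delta)"
      and fg: "Src (opcat Delta) g = Tgt (opcat Delta) f"
    obtain m n \<phi> where f': "f = (m, n, \<phi>)" by (cases f)
    with g fg obtain l \<psi> where g': "g = (l, m, \<psi>)" by (cases g) (auto simp: ops)
    have "comp_functor (ordinal l) \<sigma> (ordinal_functor (l, n, compose {..l} \<phi> \<psi>)) =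
       comp_functor (ordinal l) (comp_functor (ordinal m) \<sigma> (ordinal_functor (m, n, \<phi>)))
         (ordinal_functor (l, m, \<psi>))" for \<sigma> :: "(nat, nat \<times> nat, 'o, 'm) functor_data"
      using ordinal_functor_Cmp[of l m \<psi> n \<phi>] g
        comp_functor_assoc[OF is_functor_ordinal_functor, of l m \<psi>]
      by (simp add: g' ops cmp)
    then have "(\<lambda>\<sigma>\<in>{\<sigma>. is_functor (ordinal n) C \<sigma>}.
        comp_functor (ordinal l) \<sigma> (ordinal_functor (l, n, compose {..l} \<phi> \<psi>))) =
      compose {\<sigma>. is_functor (ordinal n) C \<sigma>}
        (\<lambda>\<sigma>\<in>{\<sigma>. is_functor (ordinal m) C \<sigma>}. comp_functor (ordinal l) \<sigma> (ordinal_functor (l, m, \<psi>)))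
        (\<lambda>\<sigma>\<in>{\<sigma>. is_functor (ordinal n) C \<sigma>}. comp_functor (ordinal m) \<sigma> (ordinal_functor (m, n, \<phi>)))"
      using f by (auto simp: compose_def fun_eq_iff t f' ops)
    with f g show "onAr (nerve C) (Cmp (opcat Delta) g f) = Cmp Set_cat (onAr (nerve C) g) (onAr (nerve C) f)"
      by (simp add: f' g' ops nerve_def Let_def sets cmp cmpA)
  qed
qed

lemma simplicial_map_nerve_map:
  assumes C: "category C" and F: "is_functor C D F"
  shows "simplicial_map (nerve C) (nerve D) (nerve_map F)"
  unfolding simplicial_map_def
proof (intro conjI allI impI ballI)
  fix n
  show "nerve_map F n \<in> onOb (nerve C) n \<rightarrow> onOb (nerve D) n"
    using is_functor_comp[OF category_ordinal _ F] by (auto simp: nerve_def Let_def nerve_map_def)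
next
  fix m n \<phi> \<sigma> assume d: "(m, n, \<phi>) \<in> Ar Delta" and s: "\<sigma> \<in> onOb (nerve C) n"
  then have s': "is_functor (ordinal n) C \<sigma>" by (simp add: nerve_def Let_def)
  show "nerve_map F m (act (nerve C) (m, n, \<phi>) \<sigma>) = act (nerve D) (m, n, \<phi>) (nerve_map F n \<sigma>)"
    using d s' is_functor_comp[OF category_ordinal s' F]
      comp_functor_assoc[OF is_functor_ordinal_functor[OF d], of F \<sigma>]
    by (simp add: nerve_def Let_def nerve_map_def act_def)
qed

lemma glue_simplicial_map:
  assumes "simplicial_map X Y h" and "glue X (n, \<sigma>, t) (n', \<sigma>', t')"
  shows "glue Y (n, h n \<sigma>, t) (n', h n' \<sigma>', t')"
  using assms(2)
proof cases
  case (1 \<phi>)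
  with assms(1) have "h n \<sigma> = act Y (n, n', \<phi>) (h n' \<sigma>')" "h n' \<sigma>' \<in> onOb Y n'"
    by (auto simp: simplicial_map_def)
  with 1 show ?thesis by (auto intro: glue.intros)
qed

lemma realization_map_class:
  assumes h: "simplicial_map X Y h"
  shows "realization_map Y h (glue_class X (n, \<sigma>, t)) = glue_class Y (n, h n \<sigma>, t)"
proof -
  define H where "H = (\<lambda>(n, \<sigma>, t :: nat \<Rightarrow> real). (n, h n \<sigma>, t))"
  have 1: "equivclp (glue Y) (H p) (H q)" if "equivclp (glue X) p q" for p q
    using that
  proof (induction rule: equivclp_induct)
    case base
    show ?case by (rule equivclp_refl)
  next
    case (step q r)
    then have "equivclp (glue Y) (H q) (H r)"
      using glue_simplicial_map[OF h]
      by (auto simp: H_def intro: r_into_equivclp equivclp_sym split: prod.splits)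
    with step.IH show ?case by (rule equivclp_trans)
  qed
  have 2: "glue_class Y (H q) = glue_class Y (H p)" if "equivclp (glue X) p q" for p q
    using 1[OF that] unfolding glue_class_def by (auto intro: equivclp_trans equivclp_sym)
  have "(\<lambda>q. glue_class Y (H q)) ` glue_class X p = {glue_class Y (H p)}" for p
  proof -
    have "glue_class Y (H q) = glue_class Y (H p)" if "q \<in> glue_class X p" for q
      using that by (intro 2) (simp add: glue_class_def)
    moreover have "p \<in> glue_class X p"
      by (simp add: glue_class_def)
    ultimately show ?thesis by blast
  qed
  from this[of "(n, \<sigma>, t)"] show ?thesis
    by (simp add: realization_map_def H_def case_prod_beta')
qed

lemma category_inter_subcategory:
  assumes C: "category C" and D: "\<And>a. a \<in> set as \<Longrightarrow> subcategory C (D a)" and ne: "as \<noteq> []"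
  shows "category (inter_subcategory C D as)"
proof -
  interpret category C by (rule C)
  have sub: "Ob (D a) \<subseteq> Ob C" "Ar (D a) \<subseteq> Ar C" if "a \<in> set as" for a
    using D[OF that] by (auto simp: subcategory_def)
  have cl: "f \<in> Ar (D a) \<Longrightarrow> Src C f \<in> Ob (D a)" "f \<in> Ar (D a) \<Longrightarrow> Tgt C f \<in> Ob (D a)"
    "x \<in> Ob (D a) \<Longrightarrow> Idn C x \<in> Ar (D a)"
    "f \<in> Ar (D a) \<Longrightarrow> g \<in> Ar (D a) \<Longrightarrow> Src C g = Tgt C f \<Longrightarrow> Cmp C g f \<in> Ar (D a)"
    if "a \<in> set as" for a f g x
    using D[OF that] unfolding subcategory_def category_def by metis+
  obtain a where "a \<in> set as" using ne by (cases as) auto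
  then have "f \<in> Ar C" if "\<forall>a\<in>set as. f \<in> Ar (D a)" for f
    using that sub(2)[of a] by auto
  moreover have "x \<in> Ob C" if "\<forall>a\<in>set as. x \<in> Ob (D a)" for x
    using that sub(1)[of a] \<open>a \<in> set as\<close> by auto
  ultimately show ?thesis
    by unfold_locales
      (auto simp: inter_subcategory_def cl Src_Idn Tgt_Idn Src_Cmp Tgt_Cmp Cmp_Idn Idn_Cmp Cmp_assoc)
qed

lemma category_coproduct_category:
  assumes "\<And>i. i \<in> I \<Longrightarrow> category (E i)"
  shows "category (coproduct_category I E)"
  by (rule category.intro)
    (auto simp: coproduct_category_def
      category.Src_Ob[OF assms] category.Tgt_Ob[OF assms] category.Idn_Ar[OF assms]
      category.Src_Idn[OF assms] category.Tgt_Idn[OF assms] category.Cmp_Ar[OF assms]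
      category.Src_Cmp[OF assms] category.Tgt_Cmp[OF assms] category.Cmp_Idn[OF assms]
      category.Idn_Cmp[OF assms] category.Cmp_assoc[OF assms])

lemma category_cech_level:
  assumes "category C" and "\<And>a. a \<in> A \<Longrightarrow> subcategory C (D a)"
  shows "category (cech_level C A D n)"
  unfolding cech_level_def
  by (rule category_coproduct_category, rule category_inter_subcategory)
    (use assms in \<open>auto simp: tuples_def\<close>)

lemma Delta_le: "(m, n, \<phi>) \<in> Ar Delta \<Longrightarrow> j \<le> m \<Longrightarrow> \<phi> j \<le> n"
  by (auto simp: Delta_def PiE_iff)

lemma set_reindex:
  assumes "as \<in> tuples A n" and "(m, n, \<phi>) \<in> Ar Delta"
  shows "set (reindex m \<phi> as) \<subseteq> set as"
  using assms(1) Delta_le[OF assms(2)]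
  by (auto simp: reindex_def tuples_def less_Suc_eq_le simp del: upt_Suc intro!: nth_mem)

lemma reindex_tuples:
  assumes "as \<in> tuples A n" and "(m, n, \<phi>) \<in> Ar Delta"
  shows "reindex m \<phi> as \<in> tuples A m"
  using assms set_reindex[OF assms] by (auto simp: tuples_def) (simp add: reindex_def)

lemma reindex_id: "as \<in> tuples A n \<Longrightarrow> reindex n (restrict id {..n}) as = as"
  by (auto simp: reindex_def tuples_def intro!: nth_equalityI simp del: upt_Suc)

lemma reindex_reindex:
  assumes "(l, m, \<psi>) \<in> Ar Delta"
  shows "reindex l \<psi> (reindex m \<phi> as) = reindex l (compose {..l} \<phi> \<psi>) as"
proof -
  have "\<psi> j < Suc m" if "j < Suc l" for j
    using Delta_le[OF assms, of j] that by simp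
  then show ?thesis
    by (auto simp: reindex_def compose_def less_Suc_eq_le simp del: upt_Suc)
qed

lemma is_functor_cech_nerve:
  assumes C: "category C" and D: "\<And>a. a \<in> A \<Longrightarrow> subcategory C (D a)"
  shows "is_functor (opcat Delta) Cat_cat (cech_nerve C A D)"
proof -
  let ?L = "cech_level C A D"
  note cat = category_cech_level[OF C D]
  define G where "G = (\<lambda>(m, n, \<phi>).
     \<lparr>onOb = (\<lambda>(as, x)\<in>Ob (?L n). (reindex m \<phi> as, x)),
      onAr = (\<lambda>(as, f)\<in>Ar (?L n). (reindex m \<phi> as, f))\<rparr>)"
  have G: "is_functor (?L n) (?L m) (G (m, n, \<phi>))" if d: "(m, n, \<phi>) \<in> Ar Delta" for m n \<phi>
  proof -
    have inj: "(as, x) \<in> Ob (?L n) \<Longrightarrow> (reindex m \<phi> as, x) \<in> Ob (?L m)"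
      "(as, f) \<in> Ar (?L n) \<Longrightarrow> (reindex m \<phi> as, f) \<in> Ar (?L m)" for as x f
      using set_reindex[of as A n m \<phi>] d reindex_tuples[of as A n m \<phi>]
      by (auto simp: cech_level_def coproduct_category_def inter_subcategory_def)
    have st: "Src (?L k) (as, f) = (as, Src C f)" "Tgt (?L k) (as, f) = (as, Tgt C f)"
      "Idn (?L k) (as, x) = (as, Idn C x)" "Cmp (?L k) (as, g) (bs, f) = (as, Cmp C g f)"
      for k as bs f g x
      by (auto simp: cech_level_def coproduct_category_def inter_subcategory_def)
    interpret Ln: category "?L n" by (rule cat)
    have cl: "(as, f) \<in> Ar (?L n) \<Longrightarrow> (as, Src C f) \<in> Ob (?L n)"
      "(as, f) \<in> Ar (?L n) \<Longrightarrow> (as, Tgt C f) \<in> Ob (?L n)"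
      "(as, x) \<in> Ob (?L n) \<Longrightarrow> (as, Idn C x) \<in> Ar (?L n)"
      "(as, f) \<in> Ar (?L n) \<Longrightarrow> (as, g) \<in> Ar (?L n) \<Longrightarrow> Src C g = Tgt C f
        \<Longrightarrow> (as, Cmp C g f) \<in> Ar (?L n)" for as f g x
      using Ln.Src_Ob[of "(as, f)"] Ln.Tgt_Ob[of "(as, f)"] Ln.Idn_Ar[of "(as, x)"]
        Ln.Cmp_Ar[of "(as, f)" "(as, g)"] by (auto simp: st)
    show ?thesis
      unfolding is_functor_def
      by (auto simp: G_def inj st cl)
  qed
  have ops: "Ob (opcat Delta) = UNIV" "Ar (opcat Delta) = Ar Delta"
    "Src (opcat Delta) (m, n, \<phi>) = n" "Tgt (opcat Delta) (m, n, \<phi>) = m" 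
    "Idn (opcat Delta) n = (n, n, restrict id {..n})" 
    "Cmp (opcat Delta) (l, m, \<psi>) (m, n, \<phi>) = (l, n, compose {..l} \<phi> \<psi>)" for l m n \<phi> \<psi>
    by (auto simp: opcat_def Delta_def)
  have on: "onOb (cech_nerve C A D) = ?L"
    "onAr (cech_nerve C A D) (m, n, \<phi>) = (?L n, ?L m, G (m, n, \<phi>))"
    if "(m, n, \<phi>) \<in> Ar Delta" for m n \<phi>
    using that by (simp_all add: cech_nerve_def G_def)
  have on1: "onOb (cech_nerve C A D) = ?L" by (simp add: cech_nerve_def)
  show ?thesis
    unfolding is_functor_def
  proof (intro conjI ballI impI)
    show "onOb (cech_nerve C A D) \<in> Ob (opcat Delta) \<rightarrow>\<^sub>E Ob Cat_cat"
      by (auto simp: on1 ops Cat_cat_def cat)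
    have "onAr (cech_nerve C A D) a \<in> Ar Cat_cat" if "a \<in> Ar Delta" for a
      using that by (cases a) (auto simp: on Cat_cat_def cat G)
    moreover have "onAr (cech_nerve C A D) \<in> extensional (Ar Delta)"
      by (simp add: cech_nerve_def)
    ultimately show "onAr (cech_nerve C A D) \<in> Ar (opcat Delta) \<rightarrow>\<^sub>E Ar Cat_cat"
      by (auto simp: ops PiE_iff)
    fix f assume "f \<in> Ar (opcat Delta)"
    then show "Src Cat_cat (onAr (cech_nerve C A D) f) = onOb (cech_nerve C A D) (Src (opcat Delta) f)"
      and "Tgt Cat_cat (onAr (cech_nerve C A D) f) = onOb (cech_nerve C A D) (Tgt (opcat Delta) f)"
      by (cases f; simp add: ops on Cat_cat_def)+
  next
    fix n
    have idA: "(n, n, restrict id {..n}) \<in> Ar Delta"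
      using category.Idn_Ar[OF category_Delta, of n] by (simp add: Delta_def)
    have "G (n, n, restrict id {..n}) = id_functor (?L n)"
      by (auto simp: G_def id_functor_def fun_eq_iff cech_level_def coproduct_category_def reindex_id)
    then show "onAr (cech_nerve C A D) (Idn (opcat Delta) n)
        = Idn Cat_cat (onOb (cech_nerve C A D) n)"
      by (simp add: ops on1 on idA Cat_cat_def)
  next
    fix f g assume f: "f \<in> Ar (opcat Delta)" and g: "g \<in> Ar (opcat Delta)"
      and fg: "Src (opcat Delta) g = Tgt (opcat Delta) f"
    obtain m n \<phi> where f': "f = (m, n, \<phi>)" by (cases f)
    with g fg obtain l \<psi> where g': "g = (l, m, \<psi>)" by (cases g) (auto simp: ops)
    have f2: "(m, n, \<phi>) \<in> Ar Delta" and g2: "(l, m, \<psi>) \<in> Ar Delta"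
      using f g by (auto simp: f' g' ops)
    have cmpA: "(l, n, compose {..l} \<phi> \<psi>) \<in> Ar Delta"
      using category.Cmp_Ar[OF category_Delta g2 f2] by (simp add: Delta_def)
    have m: "onOb (G (m, n, \<phi>)) x \<in> Ob (?L m)" if "x \<in> Ob (?L n)" for x
      using G[OF f2] that by (auto simp: is_functor_def)
    have m': "onAr (G (m, n, \<phi>)) x \<in> Ar (?L m)" if "x \<in> Ar (?L n)" for x
      using G[OF f2] that by (auto simp: is_functor_def)
    have "onOb (G (l, n, compose {..l} \<phi> \<psi>)) = compose (Ob (?L n)) (onOb (G (l, m, \<psi>))) (onOb (G (m, n, \<phi>)))"
      using m by (force simp: fun_eq_iff G_def compose_def[of "Ob _"] reindex_reindex[OF g2])
    moreover have "onAr (G (l, n, compose {..l} \<phi> \<psi>)) = compose (Ar (?L n)) (onAr (G (l, m, \<psi>))) (onAr (G (m, n, \<phi>)))"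
      using m' by (force simp: fun_eq_iff G_def compose_def[of "Ar _"] reindex_reindex[OF g2])
    ultimately have "G (l, n, compose {..l} \<phi> \<psi>) = comp_functor (?L n) (G (l, m, \<psi>)) (G (m, n, \<phi>))"
      by (simp add: comp_functor_def functor_data.equality)
    then show "onAr (cech_nerve C A D) (Cmp (opcat Delta) g f)
        = Cmp Cat_cat (onAr (cech_nerve C A D) g) (onAr (cech_nerve C A D) f)"
      by (simp add: f' g' ops on[OF f2] on[OF g2] on[OF cmpA] Cat_cat_def)
  qed
qed

lemma category_grothendieck:
  assumes K: "category K" and F: "is_functor K Cat_cat F"
  shows "category (grothendieck K F)"
proof -
  interpret K: category K by (rule K)
  have cat: "category (onOb F c)" if "c \<in> Ob K" for c
    using F that by (auto simp: is_functor_def Cat_cat_def)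
  have fn: "is_functor (onOb F (Src K f)) (onOb F (Tgt K f)) (act F f)" if "f \<in> Ar K" for f
  proof -
    have "onAr F f \<in> Ar Cat_cat" "Src Cat_cat (onAr F f) = onOb F (Src K f)"
      "Tgt Cat_cat (onAr F f) = onOb F (Tgt K f)"
      using F that by (auto simp: is_functor_def)
    then show ?thesis by (auto simp: Cat_cat_def act_def)
  qed
  have idf: "act F (Idn K c) = id_functor (onOb F c)" if "c \<in> Ob K" for c
    using F that by (auto simp: is_functor_def Cat_cat_def act_def)
  have cmpf: "act F (Cmp K g f) = comp_functor (onOb F (Src K f)) (act F g) (act F f)"
    if "f \<in> Ar K" "g \<in> Ar K" "Src K g = Tgt K f" for f g
  proof -
    have "onAr F (Cmp K g f) = Cmp Cat_cat (onAr F g) (onAr F f)"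
      "Src Cat_cat (onAr F f) = onOb F (Src K f)"
      using F that by (auto simp: is_functor_def)
    then show ?thesis by (auto simp: Cat_cat_def act_def split: prod.splits)
  qed
  have fA: "onAr (act F f) h \<in> Ar (onOb F (Tgt K f))"
    and fS: "Src (onOb F (Tgt K f)) (onAr (act F f) h) = onOb (act F f) (Src (onOb F (Src K f)) h)"
    and fT: "Tgt (onOb F (Tgt K f)) (onAr (act F f) h) = onOb (act F f) (Tgt (onOb F (Src K f)) h)"
    if "f \<in> Ar K" "h \<in> Ar (onOb F (Src K f))" for f h
    using fn[OF that(1)] that(2) by (auto simp: is_functor_def)
  have fO: "onOb (act F f) x \<in> Ob (onOb F (Tgt K f))"
    and fI: "onAr (act F f) (Idn (onOb F (Src K f)) x) = Idn (onOb F (Tgt K f)) (onOb (act F f) x)"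
    if "f \<in> Ar K" "x \<in> Ob (onOb F (Src K f))" for f x
    using fn[OF that(1)] that(2) by (auto simp: is_functor_def)
  have fC: "onAr (act F f) (Cmp (onOb F (Src K f)) h' h)
      = Cmp (onOb F (Tgt K f)) (onAr (act F f) h') (onAr (act F f) h)"
    if "f \<in> Ar K" "h \<in> Ar (onOb F (Src K f))" "h' \<in> Ar (onOb F (Src K f))"
      "Src (onOb F (Src K f)) h' = Tgt (onOb F (Src K f)) h" for f h h'
    using fn[OF that(1)] that(2-) by (auto simp: is_functor_def)
  note simps = category.Src_Ob[OF cat] category.Tgt_Ob[OF cat] category.Idn_Ar[OF cat]
      category.Src_Idn[OF cat] category.Tgt_Idn[OF cat] category.Cmp_Ar[OF cat]
      category.Src_Cmp[OF cat] category.Tgt_Cmp[OF cat] category.Cmp_Idn[OF cat]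
      category.Idn_Cmp[OF cat] category.Cmp_assoc[OF cat]
      K.Src_Ob K.Tgt_Ob K.Idn_Ar K.Src_Idn K.Tgt_Idn K.Cmp_Ar K.Src_Cmp K.Tgt_Cmp
      K.Cmp_Idn K.Idn_Cmp K.Cmp_assoc
  have cmp: "Cmp (grothendieck K F) g f \<in> Ar (grothendieck K F) \<and>
      Src (grothendieck K F) (Cmp (grothendieck K F) g f) = Src (grothendieck K F) f \<and>
      Tgt (grothendieck K F) (Cmp (grothendieck K F) g f) = Tgt (grothendieck K F) g"
    if fg: "f \<in> Ar (grothendieck K F)" "g \<in> Ar (grothendieck K F)"
      "Src (grothendieck K F) g = Tgt (grothendieck K F) f" for f g
  proof -
    obtain x k1 h1 k2 h2 where
      f: "f = ((Src K k1, x), k1, h1)"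
      and g: "g = ((Tgt K k1, Tgt (onOb F (Tgt K k1)) h1), k2, h2)"
      and k: "k1 \<in> Ar K" "k2 \<in> Ar K" "Src K k2 = Tgt K k1" "x \<in> Ob (onOb F (Src K k1))"
      "h1 \<in> Ar (onOb F (Tgt K k1))" "h2 \<in> Ar (onOb F (Tgt K k2))"
      and s: "Src (onOb F (Tgt K k2)) h2 = onOb (act F k2) (Tgt (onOb F (Tgt K k1)) h1)"
        "Src (onOb F (Tgt K k1)) h1 = onOb (act F k1) x"
      using fg by (auto simp: grothendieck_def)
    let ?a = "onAr (act F k2) h1"
    have a: "?a \<in> Ar (onOb F (Tgt K k2))" "Src (onOb F (Tgt K k2)) h2 = Tgt (onOb F (Tgt K k2)) ?a"
      "Src (onOb F (Tgt K k2)) ?a = onOb (act F k2) (onOb (act F k1) x)"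
      using fA[of k2 h1] fT[of k2 h1] fS[of k2 h1] k s by auto
    interpret E: category "onOb F (Tgt K k2)"
      using cat k K.Tgt_Ob by blast
    show ?thesis
      using k a E.Cmp_Ar[OF a(1) k(6) a(2)] E.Src_Cmp[OF a(1) k(6) a(2)]
        E.Tgt_Cmp[OF a(1) k(6) a(2)]
      by (simp add: grothendieck_def f g K.Src_Ob K.Cmp_Ar K.Src_Cmp K.Tgt_Cmp cmpf
          comp_functor_def compose_def)
  qed
  show ?thesis
  proof (rule category.intro, goal_cases)
    case (6 f g)
    then show ?case using cmp by blast
  next
    case (7 f g)
    then show ?case using cmp by blast
  next
    case (8 f g)
    then show ?case using cmp by blast
  next
    case (9 f)
    then obtain x k h where f: "f = ((Src K k, x), k, h)" and k: "k \<in> Ar K"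
      "h \<in> Ar (onOb F (Tgt K k))" "x \<in> Ob (onOb F (Src K k))"
      "Src (onOb F (Tgt K k)) h = onOb (act F k) x"
      by (auto simp: grothendieck_def)
    show ?case
      using k category.Cmp_Idn[OF cat[OF K.Tgt_Ob[OF k(1)]] k(2)]
      by (simp add: grothendieck_def f K.Cmp_Idn fI)
  next
    case (10 f)
    then show ?case by (auto simp: grothendieck_def simps idf id_functor_def)
  next
    case (11 f g h)
    then obtain x k1 h1 k2 h2 k3 h3 where
      f: "f = ((Src K k1, x), k1, h1)"
      and g: "g = ((Tgt K k1, Tgt (onOb F (Tgt K k1)) h1), k2, h2)"
      and h: "h = ((Tgt K k2, Tgt (onOb F (Tgt K k2)) h2), k3, h3)"
      and k: "k1 \<in> Ar K" "k2 \<in> Ar K" "k3 \<in> Ar K" "Src K k2 = Tgt K k1" "Src K k3 = Tgt K k2"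
      "h1 \<in> Ar (onOb F (Tgt K k1))" "h2 \<in> Ar (onOb F (Tgt K k2))" "h3 \<in> Ar (onOb F (Tgt K k3))"
      and s: "Src (onOb F (Tgt K k2)) h2 = onOb (act F k2) (Tgt (onOb F (Tgt K k1)) h1)"
        "Src (onOb F (Tgt K k3)) h3 = onOb (act F k3) (Tgt (onOb F (Tgt K k2)) h2)"
      by (auto simp: grothendieck_def)
    let ?a = "onAr (act F k2) h1" and ?b = "onAr (act F k3) h2"
    have a: "?a \<in> Ar (onOb F (Tgt K k2))" "Src (onOb F (Tgt K k2)) h2 = Tgt (onOb F (Tgt K k2)) ?a"
      using fA[of k2 h1] fT[of k2 h1] k s by auto
    have b: "?b \<in> Ar (onOb F (Tgt K k3))" "Src (onOb F (Tgt K k3)) h3 = Tgt (onOb F (Tgt K k3)) ?b"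
      using fA[of k3 h2] fT[of k3 h2] k s by auto
    have c: "onAr (act F k3) ?a \<in> Ar (onOb F (Tgt K k3))"
      "Src (onOb F (Tgt K k3)) ?b = Tgt (onOb F (Tgt K k3)) (onAr (act F k3) ?a)"
      using fA[of k3 ?a] fT[of k3 ?a] fS[of k3 h2] k a by auto
    have "Cmp (onOb F (Tgt K k3)) h3 (onAr (act F k3) (Cmp (onOb F (Tgt K k2)) h2 ?a))
      = Cmp (onOb F (Tgt K k3)) (Cmp (onOb F (Tgt K k3)) h3 ?b) (onAr (act F (Cmp K k3 k2)) h1)"
      using fC[of k3 ?a h2] k a cmpf[of k2 k3] b c
        category.Cmp_assoc[OF cat[OF K.Tgt_Ob[OF k(3)]] c(1) b(1) k(8) c(2) b(2)]
      by (simp add: comp_functor_def compose_def)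
    then show ?case
      by (simp add: grothendieck_def f g h k K.Cmp_assoc K.Tgt_Cmp)
  qed (auto simp: grothendieck_def simps idf id_functor_def)
qed

lemma category_Gr_cech:
  assumes "category C" and "\<And>a. a \<in> A \<Longrightarrow> subcategory C (D a)"
  shows "category (Gr_cech C A D)"
  unfolding Gr_cech_def
  by (intro category_grothendieck category_opcat category_Delta is_functor_cech_nerve assms)

lemma Ob_Gr_cech:
  "Ob (Gr_cech C A D) = {(n, as, x). as \<in> tuples A n \<and> (\<forall>a\<in>set as. x \<in> Ob (D a))}"
  by (auto simp: Gr_cech_def grothendieck_def cech_nerve_def cech_level_def coproduct_category_def
      inter_subcategory_def opcat_def Delta_def)

lemma Ar_Gr_cech:
  "Ar (Gr_cech C A D) =
     {((n, as, x), (m, n', \<phi>), (bs, f)). as \<in> tuples A n \<and> (\<forall>a\<in>set as. x \<in> Ob (D a)) \<and>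
        n' = n \<and> (m, n, \<phi>) \<in> Ar Delta \<and> bs \<in> tuples A m \<and> bs = reindex m \<phi> as \<and>
        (\<forall>a\<in>set bs. f \<in> Ar (D a)) \<and> Src C f = x}"
  by (auto simp: Gr_cech_def grothendieck_def cech_nerve_def cech_level_def coproduct_category_def
      inter_subcategory_def opcat_def act_def Delta_def)

lemma is_functor_rho:
  assumes C: "category C" and D: "\<And>a. a \<in> A \<Longrightarrow> subcategory C (D a)"
  shows "is_functor (Gr_cech C A D) C (rho C A D)"
proof -
  interpret G: category "Gr_cech C A D" by (rule category_Gr_cech[OF C D])
  have O: "x \<in> Ob C" if "(n, as, x) \<in> Ob (Gr_cech C A D)" for n as x
  proof -
    have "hd as \<in> A" "hd as \<in> set as" using that by (cases as; force simp: Ob_Gr_cech tuples_def)+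
    then show ?thesis using D[of "hd as"] that by (auto simp: Ob_Gr_cech subcategory_def)
  qed
  have A: "f \<in> Ar C" if "(s, p, as, f) \<in> Ar (Gr_cech C A D)" for s p as f
  proof -
    have "as \<in> tuples A (fst p)" and f: "\<forall>a\<in>set as. f \<in> Ar (D a)"
      using that by (auto simp: Ar_Gr_cech)
    then have "hd as \<in> A" "hd as \<in> set as"
      by (cases as; force simp: tuples_def)+
    with f show ?thesis using D[of "hd as"] by (auto simp: subcategory_def)
  qed
  have str: "Src (Gr_cech C A D) (s, p, as, f) = s"
    "Idn (Gr_cech C A D) (n, as, x) = ((n, as, x), Idn Delta n, as, Idn C x)"
    for s p as f n x
    by (auto simp: Gr_cech_def grothendieck_def cech_nerve_def cech_level_def
      coproduct_category_def inter_subcategory_def opcat_def)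
  have tgt: "Tgt (Gr_cech C A D) (s, p, as, f) = (fst p, as, Tgt C f)" for s p as f
    by (auto simp: Gr_cech_def grothendieck_def cech_nerve_def cech_level_def
      coproduct_category_def inter_subcategory_def opcat_def Delta_def)
  have cmp: "\<exists>q. Cmp (Gr_cech C A D) (s', p', as', f') (s, p, as, f) = (s, q, as', Cmp C f' f)"
    if "(s, p, as, f) \<in> Ar (Gr_cech C A D)" "(s', p', as', f') \<in> Ar (Gr_cech C A D)"
      "s' = Tgt (Gr_cech C A D) (s, p, as, f)" for s p as f s' p' as' f'
    using that
    by (auto simp: tgt Ar_Gr_cech)
       (auto simp: Gr_cech_def grothendieck_def cech_nerve_def cech_level_def act_def
         coproduct_category_def inter_subcategory_def opcat_def Delta_def)
  show ?thesis
    unfolding is_functor_def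
  proof (intro conjI ballI impI)
    show "onOb (rho C A D) \<in> Ob (Gr_cech C A D) \<rightarrow>\<^sub>E Ob C"
      by (auto simp: rho_def O)
    show "onAr (rho C A D) \<in> Ar (Gr_cech C A D) \<rightarrow>\<^sub>E Ar C"
      by (auto simp: rho_def A)
    fix u assume u: "u \<in> Ar (Gr_cech C A D)"
    obtain s p as f where u': "u = (s, p, as, f)" by (cases u)
    obtain n bs x where s: "s = (n, bs, x)" by (cases s)
    show "Src C (onAr (rho C A D) u) = onOb (rho C A D) (Src (Gr_cech C A D) u)"
      using u G.Src_Ob[OF u] by (auto simp: rho_def u' str s) (auto simp: Ar_Gr_cech)
    show "Tgt C (onAr (rho C A D) u) = onOb (rho C A D) (Tgt (Gr_cech C A D) u)"
      using u G.Tgt_Ob[OF u] by (auto simp: rho_def u' tgt)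
    fix v assume v: "v \<in> Ar (Gr_cech C A D)" and uv: "Src (Gr_cech C A D) v = Tgt (Gr_cech C A D) u"
    obtain s' p' as' f' where v': "v = (s', p', as', f')" by (cases v)
    show "onAr (rho C A D) (Cmp (Gr_cech C A D) v u)
        = Cmp C (onAr (rho C A D) v) (onAr (rho C A D) u)"
      using u v G.Cmp_Ar[OF u v uv] cmp[of s p as f s' p' as' f'] uv
      by (auto simp: rho_def u' v' str)
  next
    fix x assume x: "x \<in> Ob (Gr_cech C A D)"
    show "onAr (rho C A D) (Idn (Gr_cech C A D) x) = Idn C (onOb (rho C A D) x)"
      using x G.Idn_Ar[OF x] by (cases x) (auto simp: rho_def str)
  qed
qed

lemma simplex_push_standard_simplex:
  assumes d: "(m, n, \<phi>) \<in> Ar Delta" and t: "t \<in> standard_simplex m"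
  shows "simplex_push m \<phi> t \<in> standard_simplex n"
proof -
  have le: "\<phi> i \<le> n" if "i \<le> m" for i using Delta_le[OF d that] .
  have t0: "0 \<le> t i" for i using t by (simp add: standard_simplex_def)
  have s: "(\<Sum>i\<le>m. t i) = 1" using t by (simp add: standard_simplex_def)
  have 1: "0 \<le> simplex_push m \<phi> t j" for j
    by (simp add: simplex_push_def sum_nonneg t0)
  have 2: "simplex_push m \<phi> t j \<le> 1" for j
    unfolding simplex_push_def s[symmetric] by (rule sum_mono2) (auto simp: t0)
  have 3: "simplex_push m \<phi> t j = 0" if "j > n" for j
  proof -
    have "{i. i \<le> m \<and> \<phi> i = j} = {}" using le that by fastforce
    then show ?thesis unfolding simplex_push_def by (metis sum.empty)
  qed
  have "(\<Sum>j\<le>n. \<Sum>i\<in>{i \<in> {..m}. \<phi> i = j}. t i) = (\<Sum>i\<le>m. t i)"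
    by (rule sum.group) (auto simp: le)
  then have 4: "(\<Sum>j\<le>n. simplex_push m \<phi> t j) = 1"
    by (simp add: simplex_push_def s)
  from 1 2 3 4 show ?thesis by (simp add: standard_simplex_def)
qed

end

theory Submission
  imports Defs
begin

text \<open>
  A point of a classifying space \<open>B E\<close> is a step function of time: a simplex
  \<open>x\<^sub>0 \<rightarrow> \<dots> \<rightarrow> x\<^sub>n\<close> with barycentric coordinates \<open>t\<close> is read as the particle that
  spends time \<open>t\<^sub>0\<close> at \<open>x\<^sub>0\<close>, then time \<open>t\<^sub>1\<close> at \<open>x\<^sub>1\<close>, and so on, during the unit
  interval \<open>[0, 1)\<close>. The gluing relation of the realization says precisely that only this motion
  matters. More generally a diagram \<open>F\<close> on a finite poset \<open>P\<close> and a monotone \<open>f: [0, 1) \<rightarrow> P\<close>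
  determine the point \<open>realize E F f\<close>, the coordinates of which are the measures of the sets
  \<open>{f = p}\<close>. Two facts make this usable: \<open>realize_map\<close> (the point does not change under a map of
  posets that is compatible with the diagrams) and \<open>continuous_map_realize\<close> (the point depends
  continuously on a parameter as soon as, at almost every time, \<open>f\<close> is locally constant in the
  parameter). Since the unit interval is locally compact, a compatible family of such data, one for
  each simplex, is a homotopy (\<open>classifying_space_homotopy\<close>).

  Choose for each object \<open>x\<close> of \<open>C\<close> an index \<open>a(x)\<close> with \<open>x \<in> D\<^bsub>a(x)\<^esub>\<close>. For an ideal
  cover, the earlier positions of a moving particle lie in \<open>D\<^bsub>a(x)\<^esub>\<close> for each later position
  \<open>x\<close>; for a filter cover the roles of earlier and later are exchanged. So one half of the unit
  interval is used for the motion itself and the other half for collecting indices: let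
  \<open>r\<^sub>a\<close> be the share of the second half that is spent at objects with index \<open>a\<close> (of the first
  half, for a filter cover). The inverse map \<open>g: B C \<rightarrow> B Gr\<close> plays the motion of the other half
  at half speed, and at time \<open>u\<close> equips the object with the tuple
  \<open>T(u) = {a | r\<^sub>a > u * r\<^sub>b for all b}\<close>, listed in increasing order for a fixed total order of the
  indices. As \<open>u\<close> grows the tuple shrinks, which is the direction of the morphisms of the
  Grothendieck construction, so this is a step function in \<open>Gr\<close>. Because \<open>T(u)\<close> is a set of
  indices that is determined by time spent, and not a list of the vertices, the construction
  respects degenerate simplices as well as faces.

  The composite of \<open>g\<close> with \<open>B \<rho>\<close> only changes the speed of the motion, hence is homotopic to the
  identity. For the other composite, let the moving object of \<open>Gr\<close> be \<open>x\<close> with tuple \<open>as\<close>. After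
  the same change of speed there are natural morphisms
  \<open>x\<^bsub>as\<^esub> \<leftarrow> x\<^bsub>as T\<^esub> \<rightarrow> x\<^bsub>T\<^esub>\<close> that omit one half of the concatenated tuple \<open>as T\<close>. Letting the
  particle follow the middle term up to time \<open>s\<close> and one of the outer terms afterwards gives, for
  \<open>s\<close> from \<open>0\<close> to \<open>1\<close>, the two homotopies of \<open>join_homotopy\<close>; together they connect the change
  of speed with \<open>g \<circ> B \<rho>\<close>.
\<close>

section \<open>Step functions and their weights\<close>

abbreviation unit_measure :: "real measure" where
  "unit_measure \<equiv> lebesgue_on {0..<1}"

lemma finite_unit_measure: "finite_measure unit_measure"
  by (intro finite_measure_lebesgue_on measurable_convex bounded_Ico convex_real_interval)

interpretation unit_measure: finite_measure unit_measure
  by (rule finite_unit_measure)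

definition weight :: "(real \<Rightarrow> 'p) \<Rightarrow> 'p \<Rightarrow> real" where
  "weight f p = measure unit_measure {u \<in> {0..<1}. f u = p}"

definition step_function :: "(real \<Rightarrow> 'p) \<Rightarrow> bool" where
  "step_function f \<longleftrightarrow> finite (f ` {0..<1}) \<and>
     (\<forall>p. {u \<in> {0..<1}. f u = p} \<in> sets unit_measure)"

lemma sets_unit_measure_interval:
  assumes "is_interval S" and "S \<subseteq> {0..<1::real}"
  shows "S \<in> sets unit_measure"
proof -
  have "S \<in> lmeasurable"
    using assms by (intro measurable_convex is_interval_convex bounded_subset[OF _ assms(2)]) auto
  then show ?thesis
    using assms(2) by (auto simp: sets_restrict_space_iff fmeasurableD)
qed

lemma weight_nonneg: "0 \<le> weight f p"
  by (simp add: weight_def)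

lemma weight_eq_0: "p \<notin> f ` {0..<1} \<Longrightarrow> weight f p = 0"
proof -
  assume "p \<notin> f ` {0..<1}"
  then have "{u \<in> {0..<1}. f u = p} = {}" by auto
  then show ?thesis by (simp only: weight_def measure_empty)
qed

lemma weight_cong: "(\<And>u. 0 \<le> u \<Longrightarrow> u < 1 \<Longrightarrow> f u = g u) \<Longrightarrow> weight f p = weight g p"
  unfolding weight_def by (rule arg_cong[where f = "measure unit_measure"]) auto

lemma sum_weight:
  assumes f: "step_function f" and Q: "finite Q"
  shows "(\<Sum>p\<in>Q. weight f p) = measure unit_measure {u \<in> {0..<1}. f u \<in> Q}"
proof -
  have "measure unit_measure (\<Union>p\<in>Q. {u \<in> {0..<1}. f u = p}) = (\<Sum>p\<in>Q. weight f p)"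
    unfolding weight_def using f
    by (intro unit_measure.finite_measure_finite_Union Q) (auto simp: step_function_def disjoint_family_on_def)
  moreover have "(\<Union>p\<in>Q. {u \<in> {0..<1}. f u = p}) = {u \<in> {0..<1}. f u \<in> Q}" by auto
  ultimately show ?thesis by simp
qed

lemma measure_unit_atLeastLessThan:
  assumes "0 \<le> a" "a \<le> b" "b \<le> 1"
  shows "measure unit_measure {a..<b} = b - a"
  using assms by (simp add: measure_restrict_space measure_completion)

lemma sum_weight_eq_1:
  assumes f: "step_function f" and Q: "finite Q" "f ` {0..<1} \<subseteq> Q"
  shows "(\<Sum>p\<in>Q. weight f p) = 1"
proof -
  have "{u \<in> {0..<1}. f u \<in> Q} = {0..<1}" using Q by auto
  then show ?thesis
    using measure_unit_atLeastLessThan[of 0 1] by (simp add: sum_weight[OF f Q(1)])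
qed

lemma step_function_comp:
  assumes f: "step_function f"
  shows "step_function (\<lambda>u. h (f u))"
proof -
  have fin: "finite (f ` {0..<1})" using f by (simp add: step_function_def)
  have "{u \<in> {0..<1}. h (f u) = q} \<in> sets unit_measure" for q
  proof -
    have "{u \<in> {0..<1}. h (f u) = q} =
        (\<Union>p\<in>{p \<in> f ` {0..<1}. h p = q}. {u \<in> {0..<1}. f u = p})" by auto
    then show ?thesis using f fin
      by (auto simp: step_function_def intro!: sets.finite_UN)
  qed
  moreover have "finite ((\<lambda>u. h (f u)) ` {0..<1})"
    using finite_imageI[OF fin, of h] by (simp add: image_image)
  ultimately show ?thesis by (simp add: step_function_def)
qed

lemma weight_comp:
  assumes f: "step_function f" and P: "finite P" "f ` {0..<1} \<subseteq> P"
  shows "weight (\<lambda>u. h (f u)) q = (\<Sum>p\<in>{p \<in> P. h p = q}. weight f p)"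
proof -
  have "{u \<in> {0..<1}. h (f u) = q} = {u \<in> {0..<1}. f u \<in> {p \<in> P. h p = q}}"
    using P by auto
  then have "weight (\<lambda>u. h (f u)) q = measure unit_measure {u \<in> {0..<1}. f u \<in> {p \<in> P. h p = q}}"
    unfolding weight_def by (rule arg_cong)
  then show ?thesis using sum_weight[OF f, of "{p \<in> P. h p = q}"] P by simp
qed

text \<open>The fibres of a monotone map to a partial order are intervals, hence measurable.\<close>
lemma step_function_mono:
  fixes f :: "real \<Rightarrow> 'p::order"
  assumes m: "mono_on {0..<1} f" and fin: "finite (f ` {0..<1})"
  shows "step_function f"
  unfolding step_function_def
proof (intro conjI allI fin)
  fix p
  have "is_interval {u \<in> {0..<1}. f u = p}"
    unfolding is_interval_1
  proof (intro ballI allI impI)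
    fix a b x assume a: "a \<in> {u \<in> {0..<1}. f u = p}" and b: "b \<in> {u \<in> {0..<1}. f u = p}"
      and x: "a \<le> x \<and> x \<le> b"
    from a b x have "f a \<le> f x" by (intro mono_onD[OF m]) simp_all
    moreover from a b x have "f x \<le> f b" by (intro mono_onD[OF m]) simp_all
    ultimately have "f x = p" using a b by simp
    with a b x show "x \<in> {u \<in> {0..<1}. f u = p}" by simp
  qed
  then show "{u \<in> {0..<1}. f u = p} \<in> sets unit_measure"
    by (rule sets_unit_measure_interval) auto
qed

text \<open>The continuity hypothesis for families of step functions. Finitely many exceptional times are
  unavoidable: at the jumps of \<open>f z\<close> the value changes under arbitrarily small changes of \<open>z\<close>.\<close>
definition ae_stable :: "'z::topological_space set \<Rightarrow> ('z \<Rightarrow> real \<Rightarrow> 'p) \<Rightarrow> bool" where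
  "ae_stable Z f \<longleftrightarrow> (\<forall>z\<in>Z. \<exists>N. finite N \<and>
     (\<forall>u\<in>{0..<1} - N. \<forall>\<^sub>F z' in at z within Z. f z' u = f z u))"

lemma ae_stable_comp: "ae_stable Z f \<Longrightarrow> ae_stable Z (\<lambda>z u. h (f z u))"
  unfolding ae_stable_def
proof
  fix z assume "\<forall>z\<in>Z. \<exists>N. finite N \<and> (\<forall>u\<in>{0..<1} - N. \<forall>\<^sub>F z' in at z within Z. f z' u = f z u)"
    and "z \<in> Z"
  then obtain N where N: "finite N"
    "\<forall>u\<in>{0..<1} - N. \<forall>\<^sub>F z' in at z within Z. f z' u = f z u" by blast
  have "\<forall>\<^sub>F z' in at z within Z. h (f z' u) = h (f z u)" if "u \<in> {0..<1} - N" for u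
    using N(2)[rule_format, OF that] by (rule eventually_mono) simp
  with N(1) show "\<exists>N. finite N \<and>
      (\<forall>u\<in>{0..<1} - N. \<forall>\<^sub>F z' in at z within Z. h (f z' u) = h (f z u))" by blast
qed

lemma ae_stable_pair:
  assumes "ae_stable Z f" and "ae_stable Z g"
  shows "ae_stable Z (\<lambda>z u. (f z u, g z u))"
  unfolding ae_stable_def
proof
  fix z assume z: "z \<in> Z"
  obtain M N where "finite M" "finite N"
    and 1: "\<forall>u\<in>{0..<1} - M. \<forall>\<^sub>F z' in at z within Z. f z' u = f z u"
    and 2: "\<forall>u\<in>{0..<1} - N. \<forall>\<^sub>F z' in at z within Z. g z' u = g z u"
    using assms z unfolding ae_stable_def by metis
  have "\<forall>\<^sub>F z' in at z within Z. (f z' u, g z' u) = (f z u, g z u)"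
    if "u \<in> {0..<1} - (M \<union> N)" for u
    using eventually_conj[of "\<lambda>z'. f z' u = f z u" _ "\<lambda>z'. g z' u = g z u"] 1 2 that
    by (auto elim: eventually_mono)
  then show "\<exists>N. finite N \<and> (\<forall>u\<in>{0..<1} - N. \<forall>\<^sub>F z' in at z within Z. (f z' u, g z' u) = (f z u, g z u))"
    using \<open>finite M\<close> \<open>finite N\<close> by (intro exI[of _ "M \<union> N"]) blast
qed

text \<open>Dominated convergence: along a sequence \<open>x n \<longlonglongrightarrow> z\<close> the indicator functions of the sets
  \<open>{f (x n) = p}\<close> converge at every time outside a finite set.\<close>
lemma continuous_on_weight:
  fixes Z :: "'z::{first_countable_topology, t2_space} set"
  assumes st: "ae_stable Z f" and f: "\<And>z. z \<in> Z \<Longrightarrow> step_function (f z)"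
  shows "continuous_on Z (\<lambda>z. weight (f z) p)"
proof (rule continuous_on_sequentiallyI)
  fix x z assume x: "\<forall>n. x n \<in> Z" and z: "z \<in> Z" and lim: "x \<longlonglongrightarrow> z"
  define S where "S = (\<lambda>z. {u \<in> {0..<1}. f z u = p})"
  have S: "S z \<in> sets unit_measure" if "z \<in> Z" for z
    using f[OF that] by (simp add: S_def step_function_def)
  obtain N where N: "finite N"
    and ev: "\<forall>u\<in>{0..<1} - N. \<forall>\<^sub>F z' in at z within Z. f z' u = f z u"
    using st z unfolding ae_stable_def by blast
  have "(\<lambda>n. \<integral>u. indicat_real (S (x n)) u \<partial>unit_measure) \<longlonglongrightarrow> (\<integral>u. indicat_real (S z) u \<partial>unit_measure)"
  proof (rule integral_dominated_convergence[where w = "\<lambda>_. 1"])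
    show "AE u in unit_measure. (\<lambda>n. indicat_real (S (x n)) u) \<longlonglongrightarrow> indicat_real (S z) u"
    proof (rule AE_I')
      have "negligible N" using N by (rule negligible_finite)
      then have "N \<in> null_sets lebesgue" by (simp add: negligible_iff_null_sets)
      then show "N \<inter> {0..<1} \<in> null_sets unit_measure"
        by (subst null_sets_restrict_space) (auto intro: null_set_Int2)
      have "(\<lambda>n. indicat_real (S (x n)) u) \<longlonglongrightarrow> indicat_real (S z) u" if u: "u \<in> {0..<1} - N" for u
      proof (rule tendsto_eventually)
        have "\<forall>\<^sub>F z' in nhds z. z' \<in> Z \<longrightarrow> f z' u = f z u"
          using ev u unfolding eventually_at_filter by (fastforce elim: eventually_mono)
        then have "\<forall>\<^sub>F n in sequentially. x n \<in> Z \<longrightarrow> f (x n) u = f z u"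
          using lim by (rule eventually_compose_filterlim)
        then show "\<forall>\<^sub>F n in sequentially. indicat_real (S (x n)) u = indicat_real (S z) u"
          using x by (auto elim!: eventually_mono simp: S_def indicator_def)
      qed
      then show "{u \<in> space unit_measure. \<not> (\<lambda>n. indicat_real (S (x n)) u) \<longlonglongrightarrow> indicat_real (S z) u}
          \<subseteq> N \<inter> {0..<1}"
        by auto
    qed
    show "indicat_real (S z) \<in> borel_measurable unit_measure" using S[OF z] by measurable
    show "indicat_real (S (x n)) \<in> borel_measurable unit_measure" for n
      using S[of "x n"] x by (intro borel_measurable_indicator) auto
  qed auto
  moreover have "(\<integral>u. indicat_real (S z) u \<partial>unit_measure) = weight (f z) p" if "z \<in> Z" for z
  proof -
    have "S z \<inter> space unit_measure = S z" by (auto simp: S_def)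
    then show ?thesis by (simp add: weight_def) (simp add: S_def)
  qed
  ultimately show "(\<lambda>n. weight (f (x n)) p) \<longlonglongrightarrow> weight (f z) p"
    using x z by simp
qed

section \<open>Points of a classifying space given by step functions\<close>

text \<open>A functor on the poset \<open>P\<close>; the value at the relation \<open>p \<le> q\<close> is \<open>onAr F (p, q)\<close>. Unlike a
  functor from a category, it is not required to be extensional, so that diagrams on varying
  posets can be given by one formula.\<close>
definition diagram ::
    "('o, 'm) category \<Rightarrow> 'p::order set \<Rightarrow> ('p, 'p \<times> 'p, 'o, 'm) functor_data \<Rightarrow> bool" where
  "diagram E P F \<longleftrightarrow>
     (\<forall>p\<in>P. onOb F p \<in> Ob E \<and> onAr F (p, p) = Idn E (onOb F p)) \<and>
     (\<forall>p\<in>P. \<forall>q\<in>P. p \<le> q \<longrightarrow> onAr F (p, q) \<in> hom E (onOb F p) (onOb F q)) \<and>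
     (\<forall>p\<in>P. \<forall>q\<in>P. \<forall>r\<in>P. p \<le> q \<longrightarrow> q \<le> r \<longrightarrow>
        onAr F (p, r) = Cmp E (onAr F (q, r)) (onAr F (p, q)))"

lemma
  assumes "diagram E P F"
  shows diagram_Ob: "p \<in> P \<Longrightarrow> onOb F p \<in> Ob E"
    and diagram_Idn: "p \<in> P \<Longrightarrow> onAr F (p, p) = Idn E (onOb F p)"
    and diagram_hom: "\<lbrakk>p \<in> P; q \<in> P; p \<le> q\<rbrakk> \<Longrightarrow> onAr F (p, q) \<in> hom E (onOb F p) (onOb F q)"
    and diagram_Cmp: "\<lbrakk>p \<in> P; q \<in> P; r \<in> P; p \<le> q; q \<le> r\<rbrakk> \<Longrightarrow>
      onAr F (p, r) = Cmp E (onAr F (q, r)) (onAr F (p, q))"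
proof -
  note F = assms[unfolded diagram_def]
  note 1 = F[THEN conjunct1, rule_format] and 2 = F[THEN conjunct2, THEN conjunct1, rule_format]
    and 3 = F[THEN conjunct2, THEN conjunct2, rule_format]
  show "p \<in> P \<Longrightarrow> onOb F p \<in> Ob E" and "p \<in> P \<Longrightarrow> onAr F (p, p) = Idn E (onOb F p)"
    using 1 by auto
  show "\<lbrakk>p \<in> P; q \<in> P; p \<le> q\<rbrakk> \<Longrightarrow> onAr F (p, q) \<in> hom E (onOb F p) (onOb F q)"
    by (rule 2)
  show "\<lbrakk>p \<in> P; q \<in> P; r \<in> P; p \<le> q; q \<le> r\<rbrakk> \<Longrightarrow>
      onAr F (p, r) = Cmp E (onAr F (q, r)) (onAr F (p, q))"
    by (rule 3)
qed

definition pullback ::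
    "('p \<Rightarrow> 'q) \<Rightarrow> ('q, 'q \<times> 'q, 'o, 'm) functor_data \<Rightarrow> ('p, 'p \<times> 'p, 'o, 'm) functor_data" where
  "pullback g F = \<lparr>onOb = \<lambda>p. onOb F (g p), onAr = \<lambda>(p, q). onAr F (g p, g q)\<rparr>"

lemma diagram_pullback:
  assumes F: "diagram E Q F" and g: "\<And>p. p \<in> P \<Longrightarrow> g p \<in> Q"
    "\<And>p q. p \<in> P \<Longrightarrow> q \<in> P \<Longrightarrow> p \<le> q \<Longrightarrow> g p \<le> g q"
  shows "diagram E P (pullback g F)"
  unfolding diagram_def
proof (intro conjI ballI impI)
  fix p assume "p \<in> P"
  then show "onOb (pullback g F) p \<in> Ob E" "onAr (pullback g F) (p, p) = Idn E (onOb (pullback g F) p)"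
    using diagram_Ob[OF F] diagram_Idn[OF F] g(1) by (simp_all add: pullback_def)
next
  fix p q assume "p \<in> P" "q \<in> P" "p \<le> q"
  then show "onAr (pullback g F) (p, q) \<in> hom E (onOb (pullback g F) p) (onOb (pullback g F) q)"
    using diagram_hom[OF F] g by (simp add: pullback_def)
next
  fix p q r assume "p \<in> P" "q \<in> P" "r \<in> P" "p \<le> q" "q \<le> r"
  then show "onAr (pullback g F) (p, r) = Cmp E (onAr (pullback g F) (q, r)) (onAr (pullback g F) (p, q))"
    using diagram_Cmp[OF F, of "g p" "g q" "g r"] g by (simp add: pullback_def)
qed

definition chain_simplex ::
    "('p, 'p \<times> 'p, 'o, 'm) functor_data \<Rightarrow> 'p list \<Rightarrow> (nat, nat \<times> nat, 'o, 'm) functor_data" where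
  "chain_simplex F ps =
     \<lparr>onOb = (\<lambda>i\<in>{..length ps - 1}. onOb F (ps ! i)),
      onAr = (\<lambda>(i, j)\<in>Ar (ordinal (length ps - 1)). onAr F (ps ! i, ps ! j))\<rparr>"

text \<open>The value beyond the end of the list is zero, as the standard simplex demands.\<close>
definition list_weight :: "(real \<Rightarrow> 'p) \<Rightarrow> 'p list \<Rightarrow> nat \<Rightarrow> real" where
  "list_weight f ps i = (if i < length ps then weight f (ps ! i) else 0)"

definition chain_point ::
    "('o, 'm) category \<Rightarrow> ('p, 'p \<times> 'p, 'o, 'm) functor_data \<Rightarrow> 'p list \<Rightarrow> (real \<Rightarrow> 'p) \<Rightarrow>
     (nat \<times> (nat, nat \<times> nat, 'o, 'm) functor_data \<times> (nat \<Rightarrow> real)) set" where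
  "chain_point E F ps f = glue_class (nerve E) (length ps - 1, chain_simplex F ps, list_weight f ps)"

definition support :: "(real \<Rightarrow> 'p) \<Rightarrow> 'p set" where
  "support f = {p. 0 < weight f p}"

text \<open>Only used for a strict order \<open>R\<close> that is total on the finite set \<open>S\<close>; the list is then
  determined by \<open>S\<close>.\<close>
definition enumeration :: "('p \<Rightarrow> 'p \<Rightarrow> bool) \<Rightarrow> 'p set \<Rightarrow> 'p list" where
  "enumeration R S = (SOME xs. sorted_wrt R xs \<and> set xs = S)"

text \<open>The point of the classifying space that follows \<open>F\<close> along \<open>f\<close>. A monotone \<open>f\<close> takes its values
  of positive weight in a chain, and this chain is the simplex.\<close>
definition realize ::
    "('o, 'm) category \<Rightarrow> ('p::order, 'p \<times> 'p, 'o, 'm) functor_data \<Rightarrow> (real \<Rightarrow> 'p) \<Rightarrow>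
     (nat \<times> (nat, nat \<times> nat, 'o, 'm) functor_data \<times> (nat \<Rightarrow> real)) set" where
  "realize E F f = chain_point E F (enumeration (<) (support f)) f"

text \<open>Insertion of \<open>x\<close> between the elements below it and the others.\<close>
lemma enumeration:
  assumes fin: "finite S" and trans: "\<And>x y z. R x y \<Longrightarrow> R y z \<Longrightarrow> R x z"
    and total: "\<And>x y. x \<in> S \<Longrightarrow> y \<in> S \<Longrightarrow> x \<noteq> y \<Longrightarrow> R x y \<or> R y x"
  shows "sorted_wrt R (enumeration R S)" and "set (enumeration R S) = S"
proof -
  have "\<exists>xs. sorted_wrt R xs \<and> set xs = S"
    using fin total
  proof (induction S rule: finite_induct)
    case empty
    show ?case by (intro exI[of _ "[]"]) simp
  next
    case (insert x S)
    then obtain xs where xs: "sorted_wrt R xs" "set xs = S" by auto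
    let ?ys = "filter (\<lambda>y. R y x) xs @ x # filter (\<lambda>y. \<not> R y x) xs"
    have "R x y" if "y \<in> S" "\<not> R y x" for y
      using insert.prems[of x y] insert.hyps(2) that by auto
    then have "sorted_wrt R ?ys"
      using xs trans by (auto simp: sorted_wrt_append sorted_wrt_filter)
    moreover have "set ?ys = insert x S" using xs(2) by auto
    ultimately show ?case by blast
  qed
  from someI_ex[OF this] show "sorted_wrt R (enumeration R S)" "set (enumeration R S) = S"
    by (auto simp: enumeration_def)
qed

lemma sorted_wrt_irrefl_distinct:
  "sorted_wrt R xs \<Longrightarrow> (\<And>x. \<not> R x x) \<Longrightarrow> distinct xs"
  by (induction xs) auto

lemma sorted_wrt_less_nth_le:
  fixes ps :: "'p::order list"
  shows "sorted_wrt (<) ps \<Longrightarrow> i \<le> j \<Longrightarrow> j < length ps \<Longrightarrow> ps ! i \<le> ps ! j"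
  using sorted_wrt_nth_less[of "(<)" ps i j] by (cases "i = j") (auto intro: less_imp_le)

lemma onOb_nerve: "onOb (nerve E) n = {\<sigma>. is_functor (ordinal n) E \<sigma>}"
  by (simp add: nerve_def Let_def)

lemma act_nerve:
  "(m, n, \<phi>) \<in> Ar Delta \<Longrightarrow> \<sigma> \<in> onOb (nerve E) n \<Longrightarrow>
   act (nerve E) (m, n, \<phi>) \<sigma> = comp_functor (ordinal m) \<sigma> (ordinal_functor (m, n, \<phi>))"
  by (simp add: nerve_def Let_def act_def)

lemma act_nerve_closed:
  "(m, n, \<phi>) \<in> Ar Delta \<Longrightarrow> \<sigma> \<in> onOb (nerve E) n \<Longrightarrow> act (nerve E) (m, n, \<phi>) \<sigma> \<in> onOb (nerve E) m"
  using is_functor_comp[OF category_ordinal is_functor_ordinal_functor, of m n \<phi> E \<sigma>]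
  by (auto simp: act_nerve onOb_nerve)

lemma act_nerve_onOb:
  "(m, n, \<phi>) \<in> Ar Delta \<Longrightarrow> \<sigma> \<in> onOb (nerve E) n \<Longrightarrow> i \<le> m \<Longrightarrow>
   onOb (act (nerve E) (m, n, \<phi>) \<sigma>) i = onOb \<sigma> (\<phi> i)"
  by (simp add: act_nerve comp_functor_def ordinal_functor_def ordinal_def compose_def)

lemma act_nerve_onAr:
  "(m, n, \<phi>) \<in> Ar Delta \<Longrightarrow> \<sigma> \<in> onOb (nerve E) n \<Longrightarrow> i \<le> j \<Longrightarrow> j \<le> m \<Longrightarrow>
   onAr (act (nerve E) (m, n, \<phi>) \<sigma>) (i, j) = onAr \<sigma> (\<phi> i, \<phi> j)"
  by (simp add: act_nerve comp_functor_def ordinal_functor_def ordinal_def compose_def)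

lemma nerve_eqI:
  assumes "\<sigma> \<in> onOb (nerve E) n" and "\<tau> \<in> onOb (nerve E) n"
    and "\<And>i. i \<le> n \<Longrightarrow> onOb \<sigma> i = onOb \<tau> i"
    and "\<And>i j. i \<le> j \<Longrightarrow> j \<le> n \<Longrightarrow> onAr \<sigma> (i, j) = onAr \<tau> (i, j)"
  shows "\<sigma> = \<tau>"
proof (rule functor_data.equality)
  have 1: "onOb \<sigma> \<in> extensional {..n}" "onOb \<tau> \<in> extensional {..n}"
    and 2: "onAr \<sigma> \<in> extensional (Ar (ordinal n))" "onAr \<tau> \<in> extensional (Ar (ordinal n))"
    using assms(1,2) unfolding onOb_nerve is_functor_def PiE_def by (simp_all add: ordinal_def)
  show "onOb \<sigma> = onOb \<tau>"
    using assms(3) by (intro extensionalityI[OF 1]) simp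
  show "onAr \<sigma> = onAr \<tau>"
    using assms(4) by (intro extensionalityI[OF 2]) (auto simp: ordinal_def)
qed simp

lemma diagram_nerve:
  assumes "\<sigma> \<in> onOb (nerve E) n"
  shows "diagram E {..n} \<sigma>"
proof -
  have s: "is_functor (ordinal n) E \<sigma>" using assms by (simp add: onOb_nerve)
  then have "onOb \<sigma> \<in> Ob (ordinal n) \<rightarrow>\<^sub>E Ob E" "onAr \<sigma> \<in> Ar (ordinal n) \<rightarrow>\<^sub>E Ar E"
    and st: "\<forall>f\<in>Ar (ordinal n). Src E (onAr \<sigma> f) = onOb \<sigma> (Src (ordinal n) f) \<and>
      Tgt E (onAr \<sigma> f) = onOb \<sigma> (Tgt (ordinal n) f)"
    and idn: "\<forall>x\<in>Ob (ordinal n). onAr \<sigma> (Idn (ordinal n) x) = Idn E (onOb \<sigma> x)"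
    and cmp: "\<forall>f\<in>Ar (ordinal n). \<forall>g\<in>Ar (ordinal n). Src (ordinal n) g = Tgt (ordinal n) f \<longrightarrow>
        onAr \<sigma> (Cmp (ordinal n) g f) = Cmp E (onAr \<sigma> g) (onAr \<sigma> f)"
    unfolding is_functor_def by blast+
  note F = this
  have O: "onOb \<sigma> i \<in> Ob E" if "i \<le> n" for i
    using F(1) that by (simp add: ordinal_def PiE_iff)
  have A: "onAr \<sigma> (i, j) \<in> Ar E" if "i \<le> j" "j \<le> n" for i j
    using F(2) that by (simp add: ordinal_def PiE_iff)
  have 1: "onAr \<sigma> (i, i) = Idn E (onOb \<sigma> i)" if "i \<le> n" for i
    using idn[rule_format, of i] that by (simp add: ordinal_def)
  have 2: "onAr \<sigma> (i, j) \<in> hom E (onOb \<sigma> i) (onOb \<sigma> j)" if "i \<le> j" "j \<le> n" for i j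
    using st[rule_format, of "(i, j)"] A[OF that] that by (simp add: ordinal_def hom_def)
  have 3: "onAr \<sigma> (i, k) = Cmp E (onAr \<sigma> (j, k)) (onAr \<sigma> (i, j))"
    if "i \<le> j" "j \<le> k" "k \<le> n" for i j k
    using cmp[rule_format, of "(i, j)" "(j, k)"] that by (simp add: ordinal_def)
  show ?thesis unfolding diagram_def atMost_iff Ball_def using O 1 2 3 by blast
qed

lemma chain_simplex_nerve:
  assumes F: "diagram E P F" and ps: "sorted_wrt (<) ps" "set ps \<subseteq> P" "ps \<noteq> []"
  shows "chain_simplex F ps \<in> onOb (nerve E) (length ps - 1)"
proof -
  have lt: "i < length ps" if "i \<le> length ps - 1" for i
    using ps(3) that by (cases ps) auto
  have in_P: "ps ! i \<in> P" if "i \<le> length ps - 1" for i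
    using ps(2) lt[OF that] by (auto dest: nth_mem)
  have le: "ps ! i \<le> ps ! j" if "i \<le> j" "j \<le> length ps - 1" for i j
    using sorted_wrt_less_nth_le[OF ps(1) that(1) lt[OF that(2)]] .
  note O = diagram_Ob[OF F] and I = diagram_Idn[OF F] and M = diagram_Cmp[OF F]
  have A: "onAr F (p, q) \<in> Ar E \<and> Src E (onAr F (p, q)) = onOb F p \<and> Tgt E (onAr F (p, q)) = onOb F q"
    if "p \<in> P" "q \<in> P" "p \<le> q" for p q
    using diagram_hom[OF F that] by (simp add: hom_def)
  have "onOb (chain_simplex F ps) \<in> Ob (ordinal (length ps - 1)) \<rightarrow>\<^sub>E Ob E"
    by (auto simp: chain_simplex_def ordinal_def O in_P)
  moreover have "onAr (chain_simplex F ps) \<in> Ar (ordinal (length ps - 1)) \<rightarrow>\<^sub>E Ar E"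
    by (auto simp: chain_simplex_def ordinal_def A in_P le)
  ultimately show ?thesis
    unfolding onOb_nerve mem_Collect_eq is_functor_def
    by (auto simp: chain_simplex_def ordinal_def A I in_P le intro!: M)
qed

lemma glue_class_eqI: 
  assumes "glue X p q"
  shows "glue_class X p = glue_class X q"
proof -
  have e: "equivclp (glue X) p q" using assms by (rule r_into_equivclp)
  show ?thesis
    unfolding glue_class_def
    using equivclp_trans[OF e] equivclp_trans[OF equivclp_sym[OF e]] by (intro Collect_cong iffI)
qed

lemma list_weight_simplex:
  assumes f: "step_function f" and ps: "distinct ps" "support f \<subseteq> set ps"
    and P: "finite P" "f ` {0..<1} \<subseteq> P"
  shows "list_weight f ps \<in> standard_simplex (length ps - 1)" and "ps \<noteq> []"
proof -
  have "(\<Sum>p\<in>set ps. weight f p) = (\<Sum>p\<in>set ps \<union> P. weight f p)"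
    using ps(2) P weight_nonneg[of f]
    by (intro sum.mono_neutral_left) (auto simp: support_def less_le)
  also have "\<dots> = 1" using P by (intro sum_weight_eq_1[OF f]) auto
  finally have 1: "(\<Sum>p\<in>set ps. weight f p) = 1" .
  then show ne: "ps \<noteq> []" by auto
  have eq: "{..length ps - 1} = {..<length ps}" using ne by (cases ps) auto
  have 2: "(\<Sum>i\<le>length ps - 1. list_weight f ps i) = 1"
    unfolding eq 1[symmetric] sum.distinct_set_conv_list[OF ps(1)] sum_list_sum_nth
    by (simp add: list_weight_def atLeast0LessThan)
  have nn: "0 \<le> list_weight f ps i" for i by (simp add: list_weight_def weight_nonneg)
  have "list_weight f ps i \<le> 1" for i
  proof (cases "i \<le> length ps - 1")
    case True
    then show ?thesis unfolding 2[symmetric]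
      by (intro member_le_sum) (auto simp: nn)
  next
    case False
    then have "\<not> i < length ps" by arith
    then show ?thesis by (simp add: list_weight_def)
  qed
  with nn 2 show "list_weight f ps \<in> standard_simplex (length ps - 1)"
    by (auto simp: standard_simplex_def list_weight_def)
qed

lemma finite_support: "step_function f \<Longrightarrow> finite (support f)"
  and support_subset: "support f \<subseteq> f ` {0..<1}"
proof -
  show *: "support f \<subseteq> f ` {0..<1}"
    using weight_eq_0[of _ f] by (force simp: support_def)
  show "finite (support f)" if "step_function f"
    using that finite_subset[OF *] by (simp add: step_function_def)
qed

lemma enumeration_support:
  fixes f :: "real \<Rightarrow> 'p::order"
  assumes f: "step_function f" and mono: "mono_on {0..<1} f"
  shows "sorted_wrt (<) (enumeration (<) (support f))" 
    and "set (enumeration (<) (support f)) = support f"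
proof -
  have "p < q \<or> q < p" if pq: "p \<in> support f" "q \<in> support f" "p \<noteq> q" for p q
  proof -
    obtain u v where "u \<in> {0..<1}" "p = f u" "v \<in> {0..<1}" "q = f v"
      using subsetD[OF support_subset pq(1)] subsetD[OF support_subset pq(2)]
      by (elim imageE)
    with mono_onD[OF mono, of u v] mono_onD[OF mono, of v u] \<open>p \<noteq> q\<close> show ?thesis
      by (cases u v rule: linorder_le_cases) (auto simp: less_le)
  qed
  then show "sorted_wrt (<) (enumeration (<) (support f))" 
    and "set (enumeration (<) (support f)) = support f"
    using enumeration[OF finite_support[OF f], of "(<)"] by auto
qed

text \<open>The motion determines the point. Let \<open>ps\<close> be the chain on which \<open>f\<close> is supported. Sending
  \<open>ps ! i\<close> to the position of \<open>h (ps ! i)\<close> in \<open>qs\<close> is an order preserving map \<open>\<theta>\<close> of ordinals; it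
  pulls the simplex of \<open>qs\<close> back to that of \<open>ps\<close>, and it pushes the weights of \<open>f\<close> forward to those of
  \<open>h \<circ> f\<close>. So the two representatives are glued. For \<open>h\<close> the identity this allows longer chains
  than the support; for general \<open>h\<close> it covers faces and degeneracies at once.\<close>
lemma chain_point_eq_realize:
  fixes f :: "real \<Rightarrow> 'p::order" and h :: "'p \<Rightarrow> 'q::order"
  assumes f: "mono_on {0..<1} f" "f ` {0..<1} \<subseteq> P" "finite P"
    and hf: "mono_on {0..<1} (\<lambda>u. h (f u))"
    and G: "diagram E Q G" and qs: "sorted_wrt (<) qs" "set qs \<subseteq> Q" "support (\<lambda>u. h (f u)) \<subseteq> set qs"
    and ob: "\<And>p. p \<in> P \<Longrightarrow> onOb F p = onOb G (h p)"
    and ar: "\<And>p q. p \<in> P \<Longrightarrow> q \<in> P \<Longrightarrow> p \<le> q \<Longrightarrow> onAr F (p, q) = onAr G (h p, h q)"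
  shows "chain_point E G qs (\<lambda>u. h (f u)) = realize E F f"
proof -
  have st: "step_function f"
    using f finite_subset by (intro step_function_mono) auto
  define ps where "ps = enumeration (<) (support f)"
  have ps: "sorted_wrt (<) ps" "set ps = support f"
    unfolding ps_def using enumeration_support[OF st f(1)] by auto
  have dps: "distinct ps" and dqs: "distinct qs"
    using ps(1) qs(1) by (auto intro: sorted_wrt_irrefl_distinct)
  have t: "list_weight f ps \<in> standard_simplex (length ps - 1)" and ps_ne: "ps \<noteq> []"
    using list_weight_simplex[OF st dps _ f(3,2)] ps(2) by auto
  have psP: "set ps \<subseteq> P" using ps(2) support_subset[of f] f(2) by auto
  have wc: "weight (\<lambda>u. h (f u)) q = (\<Sum>p\<in>{p \<in> P. h p = q}. weight f p)" for q
    by (rule weight_comp[OF st f(3,2)])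
  have hps: "h p \<in> set qs" if "p \<in> set ps" for p
  proof -
    have "weight f p \<le> weight (\<lambda>u. h (f u)) (h p)"
      unfolding wc using that psP f(3) by (intro member_le_sum) (auto simp: weight_nonneg)
    then show ?thesis using that ps(2) qs(3) by (auto simp: support_def)
  qed
  let ?k = "length ps - 1" and ?l = "length qs - 1"
  have lt: "i < length ps" if "i \<le> ?k" for i
    using ps_ne that by (cases ps) auto
  have "\<exists>j<length qs. qs ! j = h (ps ! i)" if "i \<le> ?k" for i
    using hps[of "ps ! i"] lt[OF that] by (auto simp: in_set_conv_nth)
  then obtain \<theta>0 where \<theta>0: "\<And>i. i \<le> ?k \<Longrightarrow> \<theta>0 i < length qs \<and> qs ! \<theta>0 i = h (ps ! i)"
    by metis
  define \<theta> where "\<theta> = restrict \<theta>0 {..?k}"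
  have \<theta>: "\<theta> i < length qs" "qs ! \<theta> i = h (ps ! i)" if "i \<le> ?k" for i
    using \<theta>0[OF that] that by (auto simp: \<theta>_def)
  \<comment> \<open>The two values are compared through times at which they are taken.\<close>
  have h_mono: "h (ps ! i) \<le> h (ps ! j)" if ij: "i \<le> j" "j \<le> ?k" for i j
  proof (cases "i = j")
    case False
    with that have "ps ! i < ps ! j"
      using ps(1) lt[of j] by (simp add: sorted_wrt_iff_nth_less)
    moreover obtain u v where "u \<in> {0..<1}" "ps ! i = f u" "v \<in> {0..<1}" "ps ! j = f v"
    proof -
      have "ps ! i \<in> f ` {0..<1}" "ps ! j \<in> f ` {0..<1}"
        using ij ps(2) support_subset[of f] lt[of i] lt[of j] nth_mem[of i ps] nth_mem[of j ps] by auto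
      then show ?thesis using that by (elim imageE)
    qed
    ultimately show ?thesis
      using mono_onD[OF f(1), of v u] mono_onD[OF hf, of u v]
      by (cases u v rule: linorder_le_cases) auto
  qed simp
  have \<theta>_mono: "\<theta> i \<le> \<theta> j" if "i \<le> j" "j \<le> ?k" for i j
  proof (rule ccontr)
    assume "\<not> \<theta> i \<le> \<theta> j"
    then have "qs ! \<theta> j < qs ! \<theta> i"
      using qs(1) \<theta>(1)[of i] that by (simp add: sorted_wrt_iff_nth_less)
    then show False using h_mono[OF that] \<theta>(2) that by auto
  qed
  have d: "(?k, ?l, \<theta>) \<in> Ar Delta"
    using \<theta>(1) \<theta>_mono by (fastforce simp: Delta_def mono_on_def \<theta>_def)
  have qs_ne: "qs \<noteq> []" using \<theta>(1)[of 0] by auto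
  have G_s: "chain_simplex G qs \<in> onOb (nerve E) ?l"
    by (rule chain_simplex_nerve[OF G qs(1,2) qs_ne])
  have PI: "ps ! i \<in> P" if "i \<le> ?k" for i using psP lt[OF that] by auto
  have "chain_simplex F ps = act (nerve E) (?k, ?l, \<theta>) (chain_simplex G qs)"
  proof (rule functor_data.equality)
    have 1: "\<theta> i \<le> length qs - Suc 0" if "i \<le> length ps - Suc 0" for i using \<theta>(1)[of i] that by simp
    show "onOb (chain_simplex F ps) = onOb (act (nerve E) (?k, ?l, \<theta>) (chain_simplex G qs))"
      unfolding act_nerve[OF d G_s]
      by (auto simp: chain_simplex_def comp_functor_def ordinal_functor_def ordinal_def compose_def
          fun_eq_iff 1 \<theta>(2) ob PI)
    have 2: "onAr F (ps ! i, ps ! j) = onAr G (h (ps ! i), h (ps ! j))" if "i \<le> j" "j \<le> ?k" for i j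
      using that by (intro ar PI sorted_wrt_less_nth_le[OF ps(1)] lt) auto
    show "onAr (chain_simplex F ps) = onAr (act (nerve E) (?k, ?l, \<theta>) (chain_simplex G qs))"
      unfolding act_nerve[OF d G_s]
      by (auto simp: chain_simplex_def comp_functor_def ordinal_functor_def ordinal_def compose_def
          fun_eq_iff 1 \<theta>(2) \<theta>_mono 2)
  qed simp
  then have "glue (nerve E) (?k, chain_simplex F ps, list_weight f ps)
      (?l, chain_simplex G qs, simplex_push ?k \<theta> (list_weight f ps))"
    using glue.intros[OF d G_s t] by simp
  moreover have "simplex_push ?k \<theta> (list_weight f ps) = list_weight (\<lambda>u. h (f u)) qs"
  proof
    fix j
    show "simplex_push ?k \<theta> (list_weight f ps) j = list_weight (\<lambda>u. h (f u)) qs j"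
    proof (cases "j < length qs")
      case True
      have "(\<Sum>i\<in>{i. i \<le> ?k \<and> \<theta> i = j}. list_weight f ps i)
          = (\<Sum>p\<in>{p \<in> set ps. h p = qs ! j}. weight f p)"
      proof (rule sum.reindex_cong[where l = "\<lambda>i. ps ! i", symmetric])
        show "inj_on (\<lambda>i. ps ! i) {i. i \<le> ?k \<and> \<theta> i = j}"
          using dps lt by (auto simp: inj_on_def nth_eq_iff_index_eq)
        show "{p \<in> set ps. h p = qs ! j} = (\<lambda>i. ps ! i) ` {i. i \<le> ?k \<and> \<theta> i = j}"
        proof -
          have "\<exists>i. i \<le> ?k \<and> \<theta> i = j \<and> p = ps ! i" if "p \<in> set ps" "h p = qs ! j" for p
          proof -
            obtain i where i: "i < length ps" "p = ps ! i" using \<open>p \<in> set ps\<close> by (auto simp: in_set_conv_nth)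
            then have "i \<le> ?k" by simp
            moreover have "\<theta> i = j"
              using \<theta>[OF \<open>i \<le> ?k\<close>] i True dqs that by (simp add: nth_eq_iff_index_eq)
            ultimately show ?thesis using i by auto
          qed
          then show ?thesis using lt \<theta>(2) by auto
        qed
        show "\<And>i. i \<in> {i. i \<le> ?k \<and> \<theta> i = j} \<Longrightarrow> weight f (ps ! i) = list_weight f ps i"
          using lt by (simp add: list_weight_def)
      qed
      also have "\<dots> = (\<Sum>p\<in>{p \<in> P. h p = qs ! j}. weight f p)"
        using psP ps(2) f(3) weight_nonneg[of f]
        by (intro sum.mono_neutral_left) (auto simp: support_def less_le)
      finally show ?thesis using True by (simp add: simplex_push_def list_weight_def wc)
    next
      case False
      then have "{i. i \<le> ?k \<and> \<theta> i = j} = {}" using \<theta>(1) by auto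
      then show ?thesis using False by (simp only: simplex_push_def list_weight_def sum.empty if_False)
    qed
  qed
  ultimately show ?thesis
    unfolding realize_def chain_point_def ps_def[symmetric]
    by (metis glue_class_eqI)
qed

lemma realize_map:
  fixes f :: "real \<Rightarrow> 'p::order" and h :: "'p \<Rightarrow> 'q::order"
  assumes f: "mono_on {0..<1} f" "f ` {0..<1} \<subseteq> P" "finite P"
    and hf: "mono_on {0..<1} (\<lambda>u. h (f u))" and hP: "\<And>u. 0 \<le> u \<Longrightarrow> u < 1 \<Longrightarrow> h (f u) \<in> Q"
    and G: "diagram E Q G" 
    and ob: "\<And>p. p \<in> P \<Longrightarrow> onOb F p = onOb G (h p)"
    and ar: "\<And>p q. p \<in> P \<Longrightarrow> q \<in> P \<Longrightarrow> p \<le> q \<Longrightarrow> onAr F (p, q) = onAr G (h p, h q)"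
  shows "realize E G (\<lambda>u. h (f u)) = realize E F f"
proof -
  have "step_function f"
    using f finite_subset by (intro step_function_mono) auto
  then have st: "step_function (\<lambda>u. h (f u))" by (rule step_function_comp)
  note en = enumeration_support[OF st hf]
  show ?thesis
    unfolding realize_def[of E G]
    by (rule chain_point_eq_realize[OF f hf G en(1) _ _ ob ar])
      (use en(2) support_subset[of "\<lambda>u. h (f u)"] hP in auto)
qed

lemma realize_cong:
  assumes "\<And>u. 0 \<le> u \<Longrightarrow> u < 1 \<Longrightarrow> f u = g u"
  shows "realize E F f = realize E F g"
proof -
  have w: "weight f = weight g"
    using weight_cong[of f g] assms by auto
  then have "list_weight f = list_weight g"
    by (simp add: list_weight_def fun_eq_iff)
  with w show ?thesis
    by (simp add: realize_def chain_point_def support_def)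
qed

lemma classifying_map_realize:
  fixes F :: "('p::order, 'p \<times> 'p, 'o, 'm) functor_data"
  assumes E: "category E" and K: "is_functor E E' K"
    and F: "diagram E P F" and f: "mono_on {0..<1} f" "f ` {0..<1} \<subseteq> P" "finite P"
  shows "classifying_map E' K (realize E F f) =
    realize E' \<lparr>onOb = \<lambda>p. onOb K (onOb F p), onAr = \<lambda>a. onAr K (onAr F a)\<rparr> f"
proof -
  have st: "step_function f"
    using f finite_subset by (intro step_function_mono) auto
  define ps where "ps = enumeration (<) (support f)"
  have ps: "sorted_wrt (<) ps" "set ps = support f"
    unfolding ps_def using enumeration_support[OF st f(1)] by auto
  have ps_ne: "ps \<noteq> []"
    using list_weight_simplex(2)[OF st sorted_wrt_irrefl_distinct[OF ps(1)] _ f(3,2)] ps(2) by auto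
  have psP: "set ps \<subseteq> P" using ps(2) support_subset[of f] f(2) by auto
  have "nerve_map K (length ps - 1) (chain_simplex F ps) =
      chain_simplex \<lparr>onOb = \<lambda>p. onOb K (onOb F p), onAr = \<lambda>a. onAr K (onAr F a)\<rparr> ps"
    by (rule functor_data.equality)
      (auto simp: nerve_map_def chain_simplex_def comp_functor_def compose_def fun_eq_iff ordinal_def)
  then show ?thesis
    unfolding classifying_map_def realize_def chain_point_def ps_def[symmetric]
    using realization_map_class[OF simplicial_map_nerve_map[OF E K]] by metis
qed

section \<open>Continuity of families of points\<close>

lemma continuous_map_from_sum_topology:
  assumes "\<And>i. i \<in> I \<Longrightarrow> continuous_map (X i) Y (\<lambda>x. g (i, x))"
  shows "continuous_map (sum_topology X I) Y g"
  unfolding continuous_map_def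
proof (intro conjI allI impI)
  show "g \<in> topspace (sum_topology X I) \<rightarrow> topspace Y"
  proof
    fix p assume "p \<in> topspace (sum_topology X I)"
    then obtain i x where "p = (i, x)" "i \<in> I" "x \<in> topspace (X i)" by auto
    then show "g p \<in> topspace Y"
      using continuous_map_image_subset_topspace[OF assms, of i] by auto
  qed
  fix U assume U: "openin Y U"
  have "openin (X i) {x. (i, x) \<in> {p \<in> topspace (sum_topology X I). g p \<in> U}}" if i: "i \<in> I" for i
  proof -
    have "{x. (i, x) \<in> {p \<in> topspace (sum_topology X I). g p \<in> U}} = {x \<in> topspace (X i). g (i, x) \<in> U}"
      using i by auto
    then show ?thesis
      using openin_continuous_map_preimage[OF assms[OF i] U] by simp
  qed
  then show "openin (sum_topology X I) {p \<in> topspace (sum_topology X I). g p \<in> U}"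
    by (auto simp: openin_sum_topology)
qed

lemma continuous_map_glue_class: "continuous_map (presentation X) (realization X) (glue_class X)"
  unfolding realization_def
  by (intro quotient_imp_continuous_map quotient_map_quotient_topology)

text \<open>Only finitely many chains \<open>ps\<close> occur. The parameters for which all the weight lies on \<open>ps\<close> form
  a closed set, on which the point is given by the fixed simplex of \<open>ps\<close> and continuously varying
  coordinates. These closed sets cover the parameter space, and on their overlaps the points agree
  because both equal \<open>realize\<close>.\<close>
lemma continuous_map_realize:
  fixes Z :: "'z::{first_countable_topology, t2_space} set" and f :: "'z \<Rightarrow> real \<Rightarrow> 'p::order"
  assumes P: "finite P" and F: "diagram E P F"
    and f: "\<And>z. z \<in> Z \<Longrightarrow> mono_on {0..<1} (f z)" "\<And>z. z \<in> Z \<Longrightarrow> f z ` {0..<1} \<subseteq> P"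
    and st: "ae_stable Z f"
  shows "continuous_map (top_of_set Z) (classifying_space E) (\<lambda>z. realize E F (f z))"
proof -
  have sf: "step_function (f z)" if "z \<in> Z" for z
    using f[OF that] P finite_subset by (intro step_function_mono) auto
  define I where "I = {ps. sorted_wrt (<) ps \<and> set ps \<subseteq> P}"
  define T where "T = (\<lambda>ps. {z \<in> Z. (\<Sum>p\<in>set ps. weight (f z) p) = 1})"
  have cw: "continuous_on Z (\<lambda>z. weight (f z) p)" for p
    by (rule continuous_on_weight[OF st sf])
  have "I \<subseteq> {ps. set ps \<subseteq> P \<and> distinct ps}"
    by (auto simp: I_def intro: sorted_wrt_irrefl_distinct)
  then have I: "finite I"
    using finite_subset_distinct[OF P] by (rule finite_subset)
  have clo: "closedin (top_of_set Z) (T ps)" for ps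
    unfolding T_def by (intro continuous_closedin_preimage_constant continuous_on_sum cw)
  have zero: "weight (f z) p = 0" if "ps \<in> I" "z \<in> T ps" "p \<notin> set ps" for ps z p
  proof (cases "p \<in> P")
    case True
    have "(\<Sum>p\<in>insert p (set ps). weight (f z) p) \<le> (\<Sum>p\<in>P. weight (f z) p)"
      using that P True by (intro sum_mono2) (auto simp: I_def weight_nonneg)
    also have "\<dots> = 1"
      using that f(2)[of z] sf[of z] P by (intro sum_weight_eq_1) (auto simp: T_def)
    finally show ?thesis
      using that weight_nonneg[of "f z" p] by (simp add: T_def)
  next
    case False
    then show ?thesis using f(2)[of z] that by (intro weight_eq_0) (auto simp: T_def)
  qed
  have supp: "support (f z) \<subseteq> set ps" if "ps \<in> I" "z \<in> T ps" for ps z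
    using zero[OF that] by (force simp: support_def)
  have eq: "chain_point E F ps (f z) = realize E F (f z)" if "ps \<in> I" "z \<in> T ps" for ps z
  proof -
    have z: "z \<in> Z" using that by (simp add: T_def)
    show ?thesis
      using chain_point_eq_realize[of "f z" P "\<lambda>p. p" E P F ps F] f[OF z] P F supp[OF that] that(1)
      by (simp add: I_def)
  qed
  show ?thesis
  proof (rule pasting_lemma_closed[OF I, where T = T])
    show "closedin (top_of_set Z) (T ps)" if "ps \<in> I" for ps by (rule clo)
    show "continuous_map (subtopology (top_of_set Z) (T ps)) (classifying_space E)
        (\<lambda>z. chain_point E F ps (f z))" if ps: "ps \<in> I" for ps
    proof (cases "T ps = {}")
      case True
      then show ?thesis by (simp add: continuous_map_on_empty)
    next
      case False
      then have ne: "ps \<noteq> []" by (auto simp: T_def)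
      have s: "chain_simplex F ps \<in> onOb (nerve E) (length ps - 1)"
        using chain_simplex_nerve[OF F _ _ ne] ps by (simp add: I_def)
      have dps: "distinct ps"
        using ps sorted_wrt_irrefl_distinct[of "(<)" ps] by (simp add: I_def)
      have lw: "list_weight (f z) ps \<in> standard_simplex (length ps - 1)" if "z \<in> T ps" for z
        using list_weight_simplex(1)[OF sf dps supp[OF ps that] P f(2)] that
        by (simp add: T_def)
      have "continuous_on (T ps) (\<lambda>z. list_weight (f z) ps i)" for i
        unfolding list_weight_def
        by (cases "i < length ps") (auto simp: T_def intro!: continuous_on_subset[OF cw])
      then have "continuous_map (top_of_set (T ps)) (powertop_real UNIV) (\<lambda>z. list_weight (f z) ps)"
        by (simp add: continuous_map_componentwise_UNIV)
      then have "continuous_map (top_of_set (T ps))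
          (subtopology (powertop_real UNIV) (standard_simplex (length ps - 1))) (\<lambda>z. list_weight (f z) ps)"
        using lw by (intro continuous_map_into_subtopology) auto
      moreover have "continuous_map (top_of_set (T ps))
          (discrete_topology (onOb (nerve E) (length ps - 1))) (\<lambda>z. chain_simplex F ps)"
        using s by simp
      ultimately have "continuous_map (top_of_set (T ps))
          (prod_topology (discrete_topology (onOb (nerve E) (length ps - 1)))
            (subtopology (powertop_real UNIV) (standard_simplex (length ps - 1))))
          (\<lambda>z. (chain_simplex F ps, list_weight (f z) ps))"
        by (intro continuous_map_pairedI)
      then have "continuous_map (top_of_set (T ps)) (presentation (nerve E))
          ((\<lambda>x. (length ps - 1, x)) \<circ> (\<lambda>z. (chain_simplex F ps, list_weight (f z) ps)))"
        unfolding presentation_def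
        by (rule continuous_map_compose) (rule continuous_map_component_injection[OF UNIV_I, of _ "length ps - 1"])
      from continuous_map_compose[OF this continuous_map_glue_class]
      have "continuous_map (top_of_set (T ps)) (realization (nerve E)) (\<lambda>z. chain_point E F ps (f z))"
        by (simp add: chain_point_def o_def)
      moreover have "subtopology (top_of_set Z) (T ps) = top_of_set (T ps)"
      proof -
        have "Z \<inter> T ps = T ps" by (auto simp: T_def)
        then show ?thesis by (simp add: subtopology_subtopology)
      qed
      ultimately show ?thesis by (simp add: classifying_space_def)
    qed
    show "chain_point E F ps (f z) = chain_point E F qs (f z)"
      if "ps \<in> I" "qs \<in> I" "z \<in> topspace (top_of_set Z) \<inter> T ps \<inter> T qs" for ps qs z
      using that eq[of ps z] eq[of qs z] by simp
    show "\<exists>ps. ps \<in> I \<and> z \<in> T ps \<and> realize E F (f z) = chain_point E F ps (f z)"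
      if "z \<in> topspace (top_of_set Z)" for z
    proof -
      have z: "z \<in> Z" using that by simp
      define ps where "ps = enumeration (<) (support (f z))"
      have ps: "sorted_wrt (<) ps" "set ps = support (f z)"
        unfolding ps_def using enumeration_support[OF sf[OF z] f(1)[OF z]] by auto
      have "set ps \<subseteq> P" using ps(2) support_subset[of "f z"] f(2)[OF z] by auto
      moreover have "(\<Sum>p\<in>set ps. weight (f z) p) = (\<Sum>p\<in>P. weight (f z) p)"
        using calculation P ps(2) weight_nonneg[of "f z"]
        by (intro sum.mono_neutral_left) (auto simp: support_def less_le)
      moreover have "\<dots> = 1"
        by (rule sum_weight_eq_1[OF sf[OF z] P f(2)[OF z]])
      ultimately show ?thesis
        using z ps by (intro exI[of _ ps]) (simp add: I_def T_def realize_def ps_def)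
    qed
  qed
qed

lemma topspace_presentation:
  "topspace (presentation X) = {(n, \<sigma>, t). \<sigma> \<in> onOb X n \<and> t \<in> standard_simplex n}"
  by (auto simp: presentation_def)

text \<open>The parameter of the homotopy can be treated on the presentation of \<open>B C\<close> because the product of
  a quotient map with the identity of a locally compact Hausdorff space is a quotient map. On the
  presentation the summands of the single simplices are open, and \<open>continuous_map_realize\<close> applies
  to each of them.\<close>
lemma classifying_space_homotopy:
  fixes C :: "('o, 'm) category" and E :: "('v, 'w) category"
    and P :: "nat \<Rightarrow> (nat, nat \<times> nat, 'o, 'm) functor_data \<Rightarrow> 'p::order set"
    and f :: "nat \<Rightarrow> (nat, nat \<times> nat, 'o, 'm) functor_data \<Rightarrow> (nat \<Rightarrow> real) \<times> real \<Rightarrow> real \<Rightarrow> 'p"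
  assumes P: "\<And>n \<sigma>. \<sigma> \<in> onOb (nerve C) n \<Longrightarrow> finite (P n \<sigma>)"
    and F: "\<And>n \<sigma>. \<sigma> \<in> onOb (nerve C) n \<Longrightarrow> diagram E (P n \<sigma>) (F n \<sigma>)"
    and f: "\<And>n \<sigma> z. \<lbrakk>\<sigma> \<in> onOb (nerve C) n; z \<in> standard_simplex n \<times> {0..1}\<rbrakk> \<Longrightarrow>
        mono_on {0..<1} (f n \<sigma> z) \<and> f n \<sigma> z ` {0..<1} \<subseteq> P n \<sigma>"
    and st: "\<And>n \<sigma>. \<sigma> \<in> onOb (nerve C) n \<Longrightarrow> ae_stable (standard_simplex n \<times> {0..1}) (f n \<sigma>)"
    and compat: "\<And>m n \<phi> \<sigma> t s. \<lbrakk>(m, n, \<phi>) \<in> Ar Delta; \<sigma> \<in> onOb (nerve C) n;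
        t \<in> standard_simplex m; s \<in> {0..1}\<rbrakk> \<Longrightarrow>
        realize E (F m (act (nerve C) (m, n, \<phi>) \<sigma>)) (f m (act (nerve C) (m, n, \<phi>) \<sigma>) (t, s)) =
        realize E (F n \<sigma>) (f n \<sigma> (simplex_push m \<phi> t, s))"
  obtains H where
    "continuous_map (prod_topology (top_of_set {0..1}) (classifying_space C)) (classifying_space E) H"
    "\<And>n \<sigma> t s. \<lbrakk>\<sigma> \<in> onOb (nerve C) n; t \<in> standard_simplex n; s \<in> {0..1}\<rbrakk> \<Longrightarrow>
      H (s, glue_class (nerve C) (n, \<sigma>, t)) = realize E (F n \<sigma>) (f n \<sigma> (t, s))"
proof -
  define \<Phi> where "\<Phi> = (\<lambda>s (n, \<sigma>, t). realize E (F n \<sigma>) (f n \<sigma> (t, s)))"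
  define H where "H = (\<lambda>(s, c). \<Phi> s (SOME p. p \<in> c))"
  have inv: "\<Phi> s p = \<Phi> s q" if g: "glue (nerve C) p q" and s: "s \<in> {0..1}" for s p q
    using g
  proof cases
    case (1 m n \<phi> \<sigma> t)
    then show ?thesis using compat[OF 1(3,4,5) s] by (simp add: \<Phi>_def)
  qed
  have \<Phi>_eq: "\<Phi> s p = \<Phi> s q" if "equivclp (glue (nerve C)) p q" and s: "s \<in> {0..1}" for s p q
    using that(1)
  proof (induction rule: equivclp_induct)
    case base
    show ?case ..
  next
    case (step q r)
    from step.hyps(2) have "\<Phi> s q = \<Phi> s r"
      using inv[of q r s] inv[of r q s] s by auto
    with step.IH show ?case by simp
  qed
  have H: "H (s, glue_class (nerve C) p) = \<Phi> s p" if s: "s \<in> {0..1}" for s p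
  proof -
    have "p \<in> glue_class (nerve C) p" by (simp add: glue_class_def)
    then have "(SOME q. q \<in> glue_class (nerve C) p) \<in> glue_class (nerve C) p" by (rule someI)
    then show ?thesis
      using \<Phi>_eq[of p "SOME q. q \<in> glue_class (nerve C) p" s] s by (simp add: H_def glue_class_def)
  qed
  let ?I = "top_of_set {0..1::real}" and ?X = "presentation (nerve C)"
  have q: "quotient_map (prod_topology ?I ?X) (prod_topology ?I (classifying_space C))
      (\<lambda>(s, p). (s, glue_class (nerve C) p))"
    unfolding classifying_space_def realization_def
  proof (rule quotient_map_prod_right)
    show "locally_compact_space ?I"
      by (intro compact_imp_locally_compact_space) (simp add: compact_space_subtopology)
    show "Hausdorff_space ?I \<or> regular_space ?I"
      by (simp add: Hausdorff_space_subtopology)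
    show "quotient_map ?X (quotient_topology ?X (glue_class (nerve C))) (glue_class (nerve C))"
      by (rule quotient_map_quotient_topology)
  qed
  define T :: "nat \<times> (nat, nat \<times> nat, 'o, 'm) functor_data \<Rightarrow> _"
    where "T = (\<lambda>(n, \<sigma>). {0..1::real} \<times> ({n} \<times> {\<sigma>} \<times> standard_simplex n))"
  define J where "J = {(n, \<sigma>). \<sigma> \<in> onOb (nerve C) n}"
  have "continuous_map (prod_topology ?I ?X) (classifying_space E) (\<lambda>(s, p). \<Phi> s p)"
  proof (rule pasting_lemma[where I = J and T = T and
        f = "\<lambda>(n, \<sigma>) (s, p). realize E (F n \<sigma>) (f n \<sigma> (snd (snd p), s))"])
    fix j assume j: "j \<in> J"
    obtain n \<sigma> where j': "j = (n, \<sigma>)" by (cases j)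
    have \<sigma>: "\<sigma> \<in> onOb (nerve C) n" using j by (simp add: j' J_def)
    have "openin (prod_topology (discrete_topology (onOb (nerve C) n))
        (subtopology (powertop_real UNIV) (standard_simplex n))) ({\<sigma>} \<times> standard_simplex n)"
      using \<sigma> openin_topspace[of "subtopology (powertop_real UNIV) (standard_simplex n)"]
      by (simp add: openin_prod_Times_iff)
    moreover have "open_map (prod_topology (discrete_topology (onOb (nerve C) n))
        (subtopology (powertop_real UNIV) (standard_simplex n))) ?X (Pair n)"
      unfolding presentation_def by (rule open_map_component_injection) simp
    ultimately have "openin ?X (Pair n ` ({\<sigma>} \<times> standard_simplex n))"
      unfolding open_map_def by blast
    also have "Pair n ` ({\<sigma>} \<times> standard_simplex n) = {n} \<times> {\<sigma>} \<times> standard_simplex n" by auto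
    finally have "openin ?X ({n} \<times> {\<sigma>} \<times> standard_simplex n)" .
    then show "openin (prod_topology ?I ?X) (T j)"
      by (simp add: T_def j' openin_prod_Times_iff)
    have "continuous_map ?X (powertop_real UNIV) (\<lambda>p. snd (snd p))"
      unfolding presentation_def
    proof (rule continuous_map_from_sum_topology)
      show "continuous_map (prod_topology (discrete_topology (onOb (nerve C) i))
          (subtopology (powertop_real UNIV) (standard_simplex i))) (powertop_real UNIV)
          (\<lambda>x. snd (snd (i, x)))" for i
        using continuous_map_snd[of "discrete_topology (onOb (nerve C) i)"
            "subtopology (powertop_real UNIV) (standard_simplex i)"]
        by (simp add: continuous_map_in_subtopology)
    qed
    then have "continuous_map (prod_topology ?I ?X) (powertop_real UNIV) (\<lambda>x. snd (snd (snd x)))"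
      using continuous_map_compose[OF continuous_map_snd, of _ "powertop_real UNIV" "\<lambda>p. snd (snd p)" ?I]
      by (simp add: o_def)
    moreover have "continuous_map (prod_topology ?I ?X) euclideanreal (\<lambda>x. fst x)"
      using continuous_map_fst[of ?I ?X] by (simp add: continuous_map_in_subtopology)
    ultimately have "continuous_map (prod_topology ?I ?X) (prod_topology (powertop_real UNIV) euclideanreal)
        (\<lambda>x. (snd (snd (snd x)), fst x))"
      by (rule continuous_map_pairedI)
    then have "continuous_map (prod_topology ?I ?X) euclidean (\<lambda>x. (snd (snd (snd x)), fst x))"
      by (simp add: euclidean_product_topology)
    then have "continuous_map (subtopology (prod_topology ?I ?X) (T j)) (top_of_set (standard_simplex n \<times> {0..1}))
        (\<lambda>x. (snd (snd (snd x)), fst x))"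
      by (intro continuous_map_into_subtopology continuous_map_from_subtopology)
        (auto simp: T_def j')
    from continuous_map_compose[OF this continuous_map_realize[OF P F _ _ st], OF \<sigma> \<sigma> _ _ \<sigma>]
    show "continuous_map (subtopology (prod_topology ?I ?X) (T j)) (classifying_space E)
        ((\<lambda>(n, \<sigma>) (s, p). realize E (F n \<sigma>) (f n \<sigma> (snd (snd p), s))) j)"
      using f[OF \<sigma>] by (simp add: j' o_def case_prod_beta')
  next
    fix i j x assume "i \<in> J" "j \<in> J" "x \<in> topspace (prod_topology ?I ?X) \<inter> T i \<inter> T j"
    then show "(\<lambda>(n, \<sigma>) (s, p). realize E (F n \<sigma>) (f n \<sigma> (snd (snd p), s))) i x =
        (\<lambda>(n, \<sigma>) (s, p). realize E (F n \<sigma>) (f n \<sigma> (snd (snd p), s))) j x"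
      by (auto simp: T_def)
  next
    fix x assume "x \<in> topspace (prod_topology ?I ?X)"
    then show "\<exists>j. j \<in> J \<and> x \<in> T j \<and> (\<lambda>(s, p). \<Phi> s p) x =
        (\<lambda>(n, \<sigma>) (s, p). realize E (F n \<sigma>) (f n \<sigma> (snd (snd p), s))) j x"
      by (auto simp: T_def J_def topspace_presentation \<Phi>_def)
  qed
  then have "continuous_map (prod_topology ?I ?X) (classifying_space E)
      (H \<circ> (\<lambda>(s, p). (s, glue_class (nerve C) p)))"
    by (rule continuous_map_eq) (auto simp: H)
  with q have "continuous_map (prod_topology ?I (classifying_space C)) (classifying_space E) H"
    by (rule continuous_compose_quotient_map)
  then show ?thesis
    by (rule that) (simp add: H \<Phi>_def)
qed

section \<open>Points of a simplex as step functions\<close>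

text \<open>The vertex occupied at time \<open>u\<close> by the particle that spends time \<open>t i\<close> at the vertex \<open>i\<close>.\<close>
definition simplex_index :: "(nat \<Rightarrow> real) \<Rightarrow> real \<Rightarrow> nat" where
  "simplex_index t u = (LEAST i. u < (\<Sum>j\<le>i. t j))"

lemma simplex_sum_mono: "t \<in> standard_simplex n \<Longrightarrow> i \<le> k \<Longrightarrow> (\<Sum>j\<le>i. t j) \<le> (\<Sum>j\<le>k. t j)"
  by (intro sum_mono2) (auto simp: standard_simplex_def)

lemma simplex_index_le_iff:
  assumes t: "t \<in> standard_simplex n" and u: "u < 1"
  shows "simplex_index t u \<le> i \<longleftrightarrow> u < (\<Sum>j\<le>i. t j)"
proof
  have "u < (\<Sum>j\<le>n. t j)" using t u by (simp add: standard_simplex_def)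
  then have "u < (\<Sum>j\<le>simplex_index t u. t j)"
    unfolding simplex_index_def by (rule LeastI)
  also assume "simplex_index t u \<le> i"
  then have "(\<Sum>j\<le>simplex_index t u. t j) \<le> (\<Sum>j\<le>i. t j)" by (rule simplex_sum_mono[OF t])
  finally show "u < (\<Sum>j\<le>i. t j)" .
qed (simp add: simplex_index_def Least_le)

lemma simplex_index_le: "t \<in> standard_simplex n \<Longrightarrow> u < 1 \<Longrightarrow> simplex_index t u \<le> n"
  by (simp add: simplex_index_le_iff) (simp add: standard_simplex_def)

lemma simplex_index_mono:
  assumes t: "t \<in> standard_simplex n" and "u \<le> v" "v < 1"
  shows "simplex_index t u \<le> simplex_index t v"
proof -
  have "v < (\<Sum>j\<le>simplex_index t v. t j)"
    using simplex_index_le_iff[OF t \<open>v < 1\<close>, of "simplex_index t v"] by simp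
  then show ?thesis using assms by (subst simplex_index_le_iff[OF t]) auto
qed

lemma mono_simplex_index:
  assumes t: "t \<in> standard_simplex n"
  shows "mono_on {0..<1} (simplex_index t)" and "simplex_index t ` {0..<1} \<subseteq> {..n}"
  using simplex_index_mono[OF t] simplex_index_le[OF t] by (auto intro!: mono_onI)

text \<open>Passing to a face or a degeneracy relabels the vertices and keeps the motion.\<close>
lemma simplex_index_push:
  assumes d: "(m, n, \<phi>) \<in> Ar Delta" and t: "t \<in> standard_simplex m"
    and u0: "0 \<le> u" and u: "u < 1"
  shows "simplex_index (simplex_push m \<phi> t) u = \<phi> (simplex_index t u)"
proof -
  have t': "simplex_push m \<phi> t \<in> standard_simplex n" by (rule simplex_push_standard_simplex[OF d t])
  have mono: "\<phi> i \<le> \<phi> j" if "i \<le> j" "j \<le> m" for i j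
    using d that by (auto simp: Delta_def mono_on_def)
  have t0: "0 \<le> t i" for i using t by (simp add: standard_simplex_def)
  let ?l = "simplex_index t u"
  have l: "?l \<le> m" by (rule simplex_index_le[OF t u])
  have sum: "(\<Sum>j\<le>i. simplex_push m \<phi> t j) = (\<Sum>l\<in>{l. l \<le> m \<and> \<phi> l \<le> i}. t l)" for i
  proof -
    have "(\<Sum>j\<le>i. \<Sum>l\<in>{l \<in> {l. l \<le> m \<and> \<phi> l \<le> i}. \<phi> l = j}. t l) = (\<Sum>l\<in>{l. l \<le> m \<and> \<phi> l \<le> i}. t l)"
      by (rule sum.group) auto
    moreover have "{l \<in> {l. l \<le> m \<and> \<phi> l \<le> i}. \<phi> l = j} = {l. l \<le> m \<and> \<phi> l = j}" if "j \<le> i" for j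
      using that by auto
    ultimately show ?thesis by (simp add: simplex_push_def)
  qed
  have le: "simplex_index (simplex_push m \<phi> t) u \<le> i \<longleftrightarrow> \<phi> ?l \<le> i" for i
  proof
    assume "\<phi> ?l \<le> i"
    then have "{..?l} \<subseteq> {l. l \<le> m \<and> \<phi> l \<le> i}"
      using mono[of _ ?l] l by (auto intro: order_trans)
    then have "(\<Sum>j\<le>?l. t j) \<le> (\<Sum>l\<in>{l. l \<le> m \<and> \<phi> l \<le> i}. t l)"
      by (intro sum_mono2) (auto simp: t0)
    moreover have "u < (\<Sum>j\<le>?l. t j)" using simplex_index_le_iff[OF t u, of ?l] by simp
    ultimately show "simplex_index (simplex_push m \<phi> t) u \<le> i"
      unfolding simplex_index_le_iff[OF t' u] sum by simp
  next
    assume "simplex_index (simplex_push m \<phi> t) u \<le> i"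
    then have *: "u < (\<Sum>l\<in>{l. l \<le> m \<and> \<phi> l \<le> i}. t l)"
      unfolding simplex_index_le_iff[OF t' u] sum .
    show "\<phi> ?l \<le> i"
    proof (rule ccontr)
      assume a: "\<not> \<phi> ?l \<le> i"
      have lt: "l < ?l" if "l \<le> m" "\<phi> l \<le> i" for l
      proof (rule ccontr)
        assume "\<not> l < ?l"
        then have "\<phi> ?l \<le> \<phi> l" using mono[of ?l l] that by simp
        then show False using a that by simp
      qed
      show False
      proof (cases "?l = 0")
        case True
        then have "{l. l \<le> m \<and> \<phi> l \<le> i} = {}" using lt by auto
        then have "u < 0" using * by (simp only: sum.empty)
        with u0 show False by simp
      next
        case False
        then have "{l. l \<le> m \<and> \<phi> l \<le> i} \<subseteq> {..?l - 1}" using lt by fastforce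
        then have "(\<Sum>l\<in>{l. l \<le> m \<and> \<phi> l \<le> i}. t l) \<le> (\<Sum>l\<le>?l - 1. t l)"
          by (intro sum_mono2) (auto simp: t0)
        with * have "u < (\<Sum>l\<le>?l - 1. t l)" by simp
        then have "?l \<le> ?l - 1" unfolding simplex_index_le_iff[OF t u] .
        with False show False by simp
      qed
    qed
  qed
  show ?thesis using le[of "\<phi> ?l"] le[of "simplex_index (simplex_push m \<phi> t) u"] by simp
qed

lemma weight_simplex_index:
  assumes t: "t \<in> standard_simplex n"
  shows "weight (simplex_index t) i = t i"
proof -
  have t0: "0 \<le> t j" for j using t by (simp add: standard_simplex_def)
  have le1: "(\<Sum>j\<le>i. t j) \<le> 1"
  proof -
    have "(\<Sum>j\<le>i. t j) \<le> (\<Sum>j\<le>max i n. t j)" by (rule simplex_sum_mono[OF t]) simp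
    also have "\<dots> = (\<Sum>j\<le>n. t j)"
      using t by (intro sum.mono_neutral_right) (auto simp: standard_simplex_def)
    finally show ?thesis using t by (simp add: standard_simplex_def)
  qed
  have split: "(\<Sum>j\<le>i. t j) = (\<Sum>j<i. t j) + t i"
    by (simp flip: lessThan_Suc_atMost)
  have "u \<in> {u \<in> {0..<1}. simplex_index t u = i} \<longleftrightarrow> u \<in> {(\<Sum>j<i. t j)..<(\<Sum>j\<le>i. t j)}" for u
  proof -
    have "simplex_index t u = i \<longleftrightarrow> (\<Sum>j<i. t j) \<le> u \<and> u < (\<Sum>j\<le>i. t j)" if u: "0 \<le> u" "u < 1"
    proof (cases i)
      case 0
      then show ?thesis using simplex_index_le_iff[OF t u(2), of 0] u by simp
    next
      case (Suc k)
      have "simplex_index t u = i \<longleftrightarrow> simplex_index t u \<le> i \<and> \<not> simplex_index t u \<le> k"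
        using Suc by auto
      then show ?thesis
        unfolding simplex_index_le_iff[OF t u(2)] using Suc by (auto simp: lessThan_Suc_atMost)
    qed
    moreover have "0 \<le> (\<Sum>j<i. t j)" by (simp add: sum_nonneg t0)
    ultimately show ?thesis using le1 by auto
  qed
  then have "{u \<in> {0..<1}. simplex_index t u = i} = {(\<Sum>j<i. t j)..<(\<Sum>j\<le>i. t j)}" by blast
  then show ?thesis
    unfolding weight_def using measure_unit_atLeastLessThan[of "\<Sum>j<i. t j" "\<Sum>j\<le>i. t j"] le1 split t0
    by (simp add: sum_nonneg)
qed

text \<open>The vertex \<open>i\<close> is occupied during an interval of length \<open>t i\<close>.\<close>
lemma realize_simplex_index:
  assumes s: "\<sigma> \<in> onOb (nerve E) n" and t: "t \<in> standard_simplex n"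
  shows "realize E \<sigma> (simplex_index t) = glue_class (nerve E) (n, \<sigma>, t)"
proof -
  note D = diagram_nerve[OF s]
  have "sorted_wrt (<) [0..<Suc n]" by (rule sorted_wrt_upt)
  then have "chain_simplex \<sigma> [0..<Suc n] \<in> onOb (nerve E) (length [0..<Suc n] - 1)"
    by (rule chain_simplex_nerve[OF D]) auto
  then have cs: "chain_simplex \<sigma> [0..<Suc n] = \<sigma>"
    using s by (intro nerve_eqI[of _ E n])
      (auto simp: chain_simplex_def ordinal_def simp del: upt_Suc)
  have lw: "list_weight (simplex_index t) [0..<Suc n] = t"
    using t by (auto simp: list_weight_def fun_eq_iff weight_simplex_index[OF t] standard_simplex_def
      simp del: upt_Suc)
  have "chain_point E \<sigma> [0..<Suc n] (\<lambda>u. simplex_index t u) = realize E \<sigma> (simplex_index t)"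
    by (rule chain_point_eq_realize[OF mono_simplex_index[OF t] _ mono_simplex_index(1)[OF t] D])
      (use order_trans[OF support_subset mono_simplex_index(2)[OF t]] in
        \<open>auto simp: sorted_wrt_upt lessThan_Suc_atMost simp flip: atLeast0LessThan simp del: upt_Suc\<close>)
  then show ?thesis
    by (simp add: chain_point_def cs lw del: upt_Suc)
qed

section \<open>Reparametrization of time\<close>

text \<open>At \<open>s = 0\<close> the unit interval is mapped onto its first half (\<open>e = 0\<close>) or second half (\<open>e = 1\<close>) at
  half speed, at \<open>s = 1\<close> identically onto itself; the values for other \<open>s\<close> interpolate.\<close>
definition reparam :: "real \<Rightarrow> real \<Rightarrow> real \<Rightarrow> real" where
  "reparam e s u = (1 - s) * ((e + u) / 2) + s * u"

lemma reparam_1: "reparam e 1 u = u"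
  by (simp add: reparam_def)

lemma reparam_range:
  assumes "0 \<le> e" "e \<le> 1" "0 \<le> s" "s \<le> 1" "0 \<le> u" "u < 1"
  shows "0 \<le> reparam e s u" "reparam e s u < 1"
proof -
  show "0 \<le> reparam e s u" using assms by (simp add: reparam_def)
  have "(1 - s) * ((e + u) / 2) \<le> (1 - s) * ((1 + u) / 2)"
    using assms by (intro mult_left_mono) auto
  then have "reparam e s u \<le> 1 - (1 - u) * ((1 + s) / 2)"
    by (simp add: reparam_def field_simps)
  moreover have "0 < (1 - u) * ((1 + s) / 2)" using assms by (intro mult_pos_pos) auto
  ultimately show "reparam e s u < 1" by linarith
qed

lemma reparam_mono: "0 \<le> s \<Longrightarrow> s \<le> 1 \<Longrightarrow> u \<le> v \<Longrightarrow> reparam e s u \<le> reparam e s v"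
  unfolding reparam_def by (intro add_mono mult_left_mono) auto

lemma finite_reparam_eq: "0 \<le> s \<Longrightarrow> finite {u. reparam e s u = c}"
proof (rule finite_subset)
  assume "0 \<le> s"
  then show "{u. reparam e s u = c} \<subseteq> {(2 * c - (1 - s) * e) / (1 + s)}"
    by (auto simp: reparam_def field_simps)
qed simp

text \<open>Apart from the times at which a partial sum of the coordinates is hit exactly, each of the
  inequalities that decide the occupied vertex is strict, and so persists for nearby parameters.\<close>
lemma ae_stable_simplex_index:
  assumes T: "\<And>i. continuous_on Z (\<lambda>z. T z i)" "\<And>z. z \<in> Z \<Longrightarrow> T z \<in> standard_simplex n"
    and S: "continuous_on Z S" "\<And>z. z \<in> Z \<Longrightarrow> S z \<in> {0..1}" and e: "0 \<le> e" "e \<le> 1"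
  shows "ae_stable Z (\<lambda>z u. simplex_index (T z) (reparam e (S z) u))"
  unfolding ae_stable_def
proof
  fix z assume z: "z \<in> Z"
  define d where "d = (\<lambda>i u z. (\<Sum>j\<le>i. T z j) - reparam e (S z) u)"
  define N where "N = (\<Union>i\<le>n. {u. reparam e (S z) u = (\<Sum>j\<le>i. T z j)})"
  have "finite N" using S(2)[OF z] by (simp add: N_def finite_reparam_eq)
  moreover have "\<forall>\<^sub>F z' in at z within Z.
      simplex_index (T z') (reparam e (S z') u) = simplex_index (T z) (reparam e (S z) u)"
    if u: "u \<in> {0..<1} - N" for u
  proof -
    have "\<forall>\<^sub>F z' in at z within Z. 0 < d i u z' \<longleftrightarrow> 0 < d i u z" if i: "i \<in> {..n}" for i
    proof -
      have "continuous_on Z (d i u)"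
        unfolding d_def reparam_def by (intro continuous_intros T S)
      then have lim: "(d i u \<longlongrightarrow> d i u z) (at z within Z)"
        using z by (simp add: continuous_on_def)
      have "d i u z \<noteq> 0" using u i unfolding N_def d_def by force
      then consider "0 < d i u z" | "d i u z < 0" by linarith
      then show ?thesis
      proof cases
        case 1
        show ?thesis using order_tendstoD(1)[OF lim 1] by (rule eventually_mono) (simp add: 1)
      next
        case 2
        show ?thesis using order_tendstoD(2)[OF lim 2] by (rule eventually_mono) (use 2 in simp)
      qed
    qed
    then have "\<forall>\<^sub>F z' in at z within Z. \<forall>i\<in>{..n}. 0 < d i u z' \<longleftrightarrow> 0 < d i u z"
      by (intro eventually_ball_finite) auto
    moreover have "\<forall>\<^sub>F z' in at z within Z. z' \<in> Z" by (simp add: eventually_at_filter)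
    ultimately show ?thesis
    proof eventually_elim
      case (elim z')
      let ?i = "simplex_index (T z) (reparam e (S z) u)"
        and ?i' = "simplex_index (T z') (reparam e (S z') u)"
      have r: "reparam e (S z) u < 1" "reparam e (S z') u < 1"
        using reparam_range[OF e] S(2)[OF z] S(2)[OF elim(2)] u by auto
      have le: "?i \<le> n" "?i' \<le> n"
        using simplex_index_le[OF T(2)] z elim r by auto
      have "?i' \<le> i \<longleftrightarrow> ?i \<le> i" if "i \<le> n" for i
        using elim(1) that unfolding simplex_index_le_iff[OF T(2)[OF z] r(1)]
          simplex_index_le_iff[OF T(2)[OF elim(2)] r(2)] by (auto simp: d_def)
      from this[of ?i] this[of ?i'] le show ?case by simp
    qed
  qed
  ultimately show "\<exists>N. finite N \<and> (\<forall>u\<in>{0..<1} - N. \<forall>\<^sub>F z' in at z within Z.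
      simplex_index (T z') (reparam e (S z') u) = simplex_index (T z) (reparam e (S z) u))"
    by blast
qed

lemma ae_stable_cut:
  fixes S :: "'z::topological_space \<Rightarrow> real"
  assumes S: "continuous_on Z S"
  shows "ae_stable Z (\<lambda>z u. if u < S z then x else y)"
  unfolding ae_stable_def
proof
  fix z assume z: "z \<in> Z"
  have lim: "(S \<longlongrightarrow> S z) (at z within Z)" using S z by (simp add: continuous_on_def)
  have "\<forall>\<^sub>F z' in at z within Z. (if u < S z' then x else y) = (if u < S z then x else y)"
    if "u \<noteq> S z" for u
  proof (cases "u < S z")
    case True
    show ?thesis using order_tendstoD(1)[OF lim True] by (rule eventually_mono) (simp add: True)
  next
    case False
    with that have "S z < u" by simp
    show ?thesis using order_tendstoD(2)[OF lim \<open>S z < u\<close>] by (rule eventually_mono) (use False in simp)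
  qed
  then show "\<exists>N. finite N \<and> (\<forall>u\<in>{0..<1} - N. \<forall>\<^sub>F z' in at z within Z.
      (if u < S z' then x else y) = (if u < S z then x else y))"
    by (intro exI[of _ "{S z}"]) auto
qed

section \<open>Dropping labels of small weight\<close>

text \<open>The indices that are no longer in the tuple at time \<open>u\<close>: those whose weight is at most \<open>u\<close> times
  the maximal weight. The complement is the tuple itself; working with the dropped indices turns the
  order of tuples into the inclusion order of sets, so that time is monotone for the product order.\<close>
definition dropped :: "('a \<Rightarrow> real) \<Rightarrow> real \<Rightarrow> 'a set" where
  "dropped r u = {a. \<exists>b. r a \<le> u * r b}"

lemma dropped_mono: "(\<And>a. 0 \<le> r a) \<Longrightarrow> u \<le> v \<Longrightarrow> dropped r u \<subseteq> dropped r v"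
proof
  fix x assume r: "\<And>a. 0 \<le> r a" and uv: "u \<le> v" and "x \<in> dropped r u"
  then obtain b where "r x \<le> u * r b" by (auto simp: dropped_def)
  also have "\<dots> \<le> v * r b" by (rule mult_right_mono[OF uv r])
  finally show "x \<in> dropped r v" by (auto simp: dropped_def)
qed

lemma not_dropped_pos: "(\<And>a. 0 \<le> r a) \<Longrightarrow> a \<notin> dropped r u \<Longrightarrow> 0 < r a"
  unfolding dropped_def by (auto simp: less_le dest: spec[of _ a])

lemma max_not_dropped:
  assumes "\<And>b. r b \<le> r a" "0 < r a" "0 \<le> u" "u < 1"
  shows "a \<notin> dropped r u"
proof
  assume "a \<in> dropped r u"
  then obtain b where "r a \<le> u * r b" by (auto simp: dropped_def)
  also have "\<dots> \<le> u * r a" using assms by (intro mult_left_mono) auto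
  also have "\<dots> < r a" using assms by simp
  finally show False by simp
qed

lemma exists_max_weight:
  fixes r :: "'a \<Rightarrow> real"
  assumes U: "finite U" and r: "\<And>a. 0 \<le> r a" "\<And>a. a \<notin> U \<Longrightarrow> r a = 0" and pos: "0 < r c"
  obtains m where "m \<in> U" "\<And>b. r b \<le> r m" "0 < r m"
proof -
  have c: "c \<in> U" using pos r(2)[of c] by auto
  have "Max (r ` U) \<in> r ` U" using U c by (intro Max_in) auto
  then obtain m where m: "m \<in> U" "r m = Max (r ` U)" by auto
  have "r b \<le> r m" if "b \<in> U" for b using that U m by simp
  moreover from this[OF c] pos have "0 < r m" by simp
  ultimately show thesis using that[OF m(1)] r(2) by (metis less_imp_le)
qed

text \<open>An index changes its status at time \<open>u\<close> only if its weight is exactly \<open>u\<close> times the maximal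
  weight. Since the maximal weight is positive, this happens at one time for each index.\<close>
lemma ae_stable_dropped:
  fixes r :: "'z::topological_space \<Rightarrow> 'a \<Rightarrow> real"
  assumes U: "finite U" and r: "\<And>z a. z \<in> Z \<Longrightarrow> 0 \<le> r z a" "\<And>z a. z \<in> Z \<Longrightarrow> a \<notin> U \<Longrightarrow> r z a = 0"
    and pos: "\<And>z. z \<in> Z \<Longrightarrow> \<exists>a. 0 < r z a" and cont: "\<And>a. continuous_on Z (\<lambda>z. r z a)"
  shows "ae_stable Z (\<lambda>z u. dropped (r z) u)"
  unfolding ae_stable_def
proof
  fix z assume z: "z \<in> Z"
  obtain m where m: "m \<in> U" "\<And>b. r z b \<le> r z m" "0 < r z m"
  proof -
    obtain c where "0 < r z c" using pos[OF z] by blast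
    then show thesis
      using exists_max_weight[of U "r z" c, OF U r(1)[OF z] r(2)[OF z]] that by blast
  qed
  define N where "N = (\<lambda>a. r z a / r z m) ` U"
  have "finite N" using U by (simp add: N_def)
  moreover have "\<forall>\<^sub>F z' in at z within Z. dropped (r z') u = dropped (r z) u"
    if u: "u \<in> {0..<1} - N" for u
  proof -
    have lim: "((\<lambda>z'. r z' a) \<longlongrightarrow> r z a) (at z within Z)" for a
      using cont[of a] z by (simp add: continuous_on_def)
    have "\<forall>\<^sub>F z' in at z within Z. z' \<in> Z \<longrightarrow> (a \<in> dropped (r z') u \<longleftrightarrow> a \<in> dropped (r z) u)" if a: "a \<in> U" for a
    proof -
      have "r z a \<noteq> u * r z m" 
      proof
        assume "r z a = u * r z m"
        then have "u = r z a / r z m" using m(3) by simp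
        with a have "u \<in> N" unfolding N_def by (rule image_eqI[rotated])
        with u show False by simp
      qed
      then consider "r z a < u * r z m" | "u * r z m < r z a" by linarith
      then show ?thesis
      proof cases
        case 1
        have lim': "((\<lambda>z'. u * r z' m - r z' a) \<longlongrightarrow> u * r z m - r z a) (at z within Z)"
          by (intro tendsto_intros lim)
        from order_tendstoD(1)[OF lim', of 0] 1
        have "\<forall>\<^sub>F z' in at z within Z. 0 < u * r z' m - r z' a" by simp
        moreover have "a \<in> dropped (r z) u" using 1 by (auto simp: dropped_def intro: less_imp_le)
        ultimately show ?thesis
        proof eventually_elim
          case (elim z')
          then have "a \<in> dropped (r z') u" by (auto simp: dropped_def intro: less_imp_le)
          with \<open>a \<in> dropped (r z) u\<close> show ?case by simp
        qed
      next
        case 2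
        have lt: "u * r z b < r z a" for b
          using mult_left_mono[OF m(2)[of b], of u] u 2 by auto
        then have nd: "a \<notin> dropped (r z) u" by (auto simp: dropped_def not_le)
        have "\<forall>\<^sub>F z' in at z within Z. 0 < r z' a - u * r z' b" for b
        proof -
          have "((\<lambda>z'. r z' a - u * r z' b) \<longlongrightarrow> r z a - u * r z b) (at z within Z)"
            by (intro tendsto_intros lim)
          from order_tendstoD(1)[OF this, of 0] lt[of b] show ?thesis by simp
        qed
        then have "\<forall>\<^sub>F z' in at z within Z. \<forall>b\<in>U. 0 < r z' a - u * r z' b"
          by (intro eventually_ball_finite U) auto
        moreover have "\<forall>\<^sub>F z' in at z within Z. 0 < r z' a"
          using order_tendstoD(1)[OF lim] not_dropped_pos[OF r(1)[OF z] nd] by simp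
        ultimately show ?thesis
        proof eventually_elim
          case (elim z')
          have "u * r z' b < r z' a" if "z' \<in> Z" for b
            using elim r(2)[OF that, of b] by (cases "b \<in> U") auto
          then have "a \<notin> dropped (r z') u" if "z' \<in> Z"
            using that by (simp add: dropped_def not_le)
          with nd show ?case by simp
        qed
      qed
    qed
    then have "\<forall>\<^sub>F z' in at z within Z. \<forall>a\<in>U. z' \<in> Z \<longrightarrow> (a \<in> dropped (r z') u \<longleftrightarrow> a \<in> dropped (r z) u)"
      by (intro eventually_ball_finite U) auto
    moreover have "\<forall>\<^sub>F z' in at z within Z. z' \<in> Z" by (simp add: eventually_at_filter)
    ultimately show ?thesis
    proof eventually_elim
      case (elim z')
      have out: "a \<in> dropped (r y) u" if "y \<in> Z" "a \<notin> U" for a y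
        using r(2)[OF that] by (auto simp: dropped_def intro!: exI[of _ a])
      have "a \<in> dropped (r z') u \<longleftrightarrow> a \<in> dropped (r z) u" for a
        using elim out[OF z, of a] out[OF elim(2), of a] by (cases "a \<in> U") auto
      then show ?case by blast
    qed
  qed
  ultimately show "\<exists>N. finite N \<and> (\<forall>u\<in>{0..<1} - N. \<forall>\<^sub>F z' in at z within Z. dropped (r z') u = dropped (r z) u)"
    by blast
qed

section \<open>Diagrams in the Grothendieck construction of the Cech nerve\<close>

text \<open>The part of a diagram in the Grothendieck construction that concerns the tuples: tuples \<open>L p\<close>, and
  for \<open>p \<le> q\<close> the order preserving map of positions \<open>\<phi> p q\<close> that exhibits \<open>L q\<close> as a reindexing of
  \<open>L p\<close>. The maps go from the positions of \<open>L q\<close> to those of \<open>L p\<close>.\<close>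
locale label_diagram =
  fixes P :: "'p::order set" and L :: "'p \<Rightarrow> 'a list" and \<phi> :: "'p \<Rightarrow> 'p \<Rightarrow> nat \<Rightarrow> nat"
  assumes nonempty: "p \<in> P \<Longrightarrow> L p \<noteq> []"
    and idx_refl: "\<lbrakk>p \<in> P; k < length (L p)\<rbrakk> \<Longrightarrow> \<phi> p p k = k"
    and idx_less: "\<lbrakk>p \<in> P; q \<in> P; p \<le> q; k < length (L q)\<rbrakk> \<Longrightarrow> \<phi> p q k < length (L p)"
    and idx_nth: "\<lbrakk>p \<in> P; q \<in> P; p \<le> q; k < length (L q)\<rbrakk> \<Longrightarrow> L p ! \<phi> p q k = L q ! k"
    and idx_mono: "\<lbrakk>p \<in> P; q \<in> P; p \<le> q; k \<le> l; l < length (L q)\<rbrakk> \<Longrightarrow> \<phi> p q k \<le> \<phi> p q l"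
    and idx_trans: "\<lbrakk>p \<in> P; q \<in> P; r \<in> P; p \<le> q; q \<le> r; k < length (L r)\<rbrakk> \<Longrightarrow>
      \<phi> p r k = \<phi> p q (\<phi> q r k)"

lemma label_diagram_pullback:
  assumes "label_diagram P L \<phi>" and "\<And>q. q \<in> Q \<Longrightarrow> g q \<in> P"
    and "\<And>q r. q \<in> Q \<Longrightarrow> r \<in> Q \<Longrightarrow> q \<le> r \<Longrightarrow> g q \<le> g r"
  shows "label_diagram Q (\<lambda>q. L (g q)) (\<lambda>q r. \<phi> (g q) (g r))"
proof -
  interpret label_diagram P L \<phi> by (rule assms(1))
  show ?thesis
    by unfold_locales (simp_all add: assms nonempty idx_refl idx_less idx_nth idx_mono idx_trans)
qed

text \<open>Level \<open>0\<close> carries the concatenation of two families of tuples, level \<open>1\<close> one of its two parts: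
  the first one if \<open>b\<close> holds, the second one otherwise. The positions in the second part of a
  concatenation are shifted by the length of the first part.\<close>
definition join_label :: "bool \<Rightarrow> ('p \<Rightarrow> 'a list) \<Rightarrow> ('p \<Rightarrow> 'a list) \<Rightarrow> 'p \<times> nat \<Rightarrow> 'a list" where
  "join_label b L M = (\<lambda>(p, \<epsilon>). if \<epsilon> = 0 then L p @ M p else if b then L p else M p)"

definition join_reindex ::
    "bool \<Rightarrow> ('p \<Rightarrow> 'a list) \<Rightarrow> ('p \<Rightarrow> 'p \<Rightarrow> nat \<Rightarrow> nat) \<Rightarrow> ('p \<Rightarrow> 'p \<Rightarrow> nat \<Rightarrow> nat) \<Rightarrow>
     'p \<times> nat \<Rightarrow> 'p \<times> nat \<Rightarrow> nat \<Rightarrow> nat" where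
  "join_reindex b L K \<psi> = (\<lambda>(p, \<epsilon>) (q, \<delta>) k.
     if b \<or> \<epsilon> = 0 \<and> \<delta> = 0 then
       (if k < length (L q) then K p q k else length (L p) + \<psi> p q (k - length (L q)))
     else if \<epsilon> = 0 then length (L p) + \<psi> p q k else \<psi> p q k)"

lemma label_diagram_join:
  assumes "label_diagram P L K" and "label_diagram P M \<psi>"
  shows "label_diagram (P \<times> {..1}) (join_label b L M) (join_reindex b L K \<psi>)"
proof -
  interpret L: label_diagram P L K by (rule assms(1))
  interpret M: label_diagram P M \<psi> by (rule assms(2))
  note defs = join_label_def join_reindex_def less_eq_prod_def
  show ?thesis
  proof (unfold_locales, goal_cases)
    case (1 p)
    then show ?case by (cases p) (auto simp: defs L.nonempty M.nonempty)
  next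
    case (2 p k)
    then show ?case by (cases p) (auto simp: defs L.idx_refl M.idx_refl split: if_splits)
  next
    case (3 p q k)
    then show ?case
      using L.idx_less[of "fst p" "fst q" k] M.idx_less[of "fst p" "fst q" "k - length (L (fst q))"]
        M.idx_less[of "fst p" "fst q" k]
      by (cases p; cases q) (auto simp: defs split: if_splits)
  next
    case (4 p q k)
    then show ?case
      using L.idx_less[of "fst p" "fst q" k] L.idx_nth[of "fst p" "fst q" k]
        M.idx_less[of "fst p" "fst q" "k - length (L (fst q))"]
        M.idx_nth[of "fst p" "fst q" "k - length (L (fst q))"]
        M.idx_less[of "fst p" "fst q" k] M.idx_nth[of "fst p" "fst q" k]
      by (cases p; cases q) (auto simp: defs nth_append split: if_splits)
  next
    case (5 p q k l)
    then show ?case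
      using L.idx_less[of "fst p" "fst q" k] L.idx_mono[of "fst p" "fst q" k l]
        M.idx_mono[of "fst p" "fst q" "k - length (L (fst q))" "l - length (L (fst q))"]
        M.idx_mono[of "fst p" "fst q" k l]
      by (cases p; cases q) (auto simp: defs split: if_splits)
  next
    case (6 p q r k)
    then show ?case
      using L.idx_less[of "fst q" "fst r" k] L.idx_trans[of "fst p" "fst q" "fst r" k]
        M.idx_trans[of "fst p" "fst q" "fst r" "k - length (L (fst r))"]
        M.idx_trans[of "fst p" "fst q" "fst r" k]
      by (cases p; cases q; cases r) (auto simp: defs split: if_splits)
  qed
qed

definition position :: "'a list \<Rightarrow> 'a \<Rightarrow> nat" where
  "position xs a = (LEAST k. k < length xs \<and> xs ! k = a)"

lemma position:
  assumes "a \<in> set xs"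
  shows "position xs a < length xs" and "xs ! position xs a = a"
proof -
  have "\<exists>k. k < length xs \<and> xs ! k = a" using assms by (auto simp: in_set_conv_nth)
  from LeastI_ex[OF this] show "position xs a < length xs" and "xs ! position xs a = a"
    by (auto simp: position_def)
qed

text \<open>For a decreasing family of finite sets, the sorted list of a smaller set is a reindexing of the
  sorted list of a larger one, by the positions of its elements.\<close>
lemma label_diagram_enumeration:
  fixes S :: "'p::order \<Rightarrow> 'a set"
  assumes S: "\<And>p. p \<in> P \<Longrightarrow> finite (S p)" "\<And>p. p \<in> P \<Longrightarrow> S p \<noteq> {}"
    and anti: "\<And>p q. p \<in> P \<Longrightarrow> q \<in> P \<Longrightarrow> p \<le> q \<Longrightarrow> S q \<subseteq> S p"
    and R: "\<And>x. \<not> R x x" "\<And>x y z. R x y \<Longrightarrow> R y z \<Longrightarrow> R x z" "\<And>x y. x \<noteq> y \<Longrightarrow> R x y \<or> R y x"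
  shows "label_diagram P (\<lambda>p. enumeration R (S p))
    (\<lambda>p q k. position (enumeration R (S p)) (enumeration R (S q) ! k))"
proof -
  let ?E = "\<lambda>p. enumeration R (S p)"
  have sorted: "sorted_wrt R (?E p)" and set: "set (?E p) = S p" if "p \<in> P" for p
    using enumeration[OF S(1)[OF that], of R] R(2,3) by blast+
  have nth_in: "?E q ! k \<in> set (?E p)" if "p \<in> P" "q \<in> P" "p \<le> q" "k < length (?E q)" for p q k
    using nth_mem[OF that(4)] set that anti[OF that(1-3)] by auto
  have inj: "k = l" if "p \<in> P" "k < length (?E p)" "l < length (?E p)" "?E p ! k = ?E p ! l" for p k l
    using sorted_wrt_irrefl_distinct[OF sorted[OF that(1)] R(1)] that(2-) by (simp add: nth_eq_iff_index_eq)
  have less: "R (?E p ! k) (?E p ! l)" if "p \<in> P" "k < l" "l < length (?E p)" for p k l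
    using sorted[OF that(1)] that(2,3) by (rule sorted_wrt_nth_less)
  show ?thesis
  proof (unfold_locales, goal_cases)
    case (1 p)
    then show ?case using set[of p] S(2)[of p] by auto
  next
    case (2 p k)
    then show ?case
      using position[of "?E p ! k" "?E p"] inj[of p k "position (?E p) (?E p ! k)"] by simp
  next
    case (3 p q k)
    then show ?case using position(1)[OF nth_in] by simp
  next
    case (4 p q k)
    then show ?case using position(2)[OF nth_in] by simp
  next
    case (5 p q k l)
    let ?a = "position (?E p) (?E q ! k)" and ?b = "position (?E p) (?E q ! l)"
    have a: "?a < length (?E p)" "?E p ! ?a = ?E q ! k" and b: "?b < length (?E p)" "?E p ! ?b = ?E q ! l"
      using position[OF nth_in[OF 5(1-3)]] 5(4,5) by auto
    show ?case
    proof (rule ccontr)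
      assume "\<not> ?a \<le> ?b"
      then have "R (?E q ! l) (?E q ! k)" using less[OF 5(1), of ?b ?a] a b by simp
      moreover have "k = l \<or> R (?E q ! k) (?E q ! l)"
        using less[OF 5(2) _ 5(5)] 5(4) by (cases "k = l") auto
      ultimately show False using R(1,2) by metis
    qed
  next
    case (6 p q r k)
    then show ?case using position(2)[OF nth_in, of q r k] by simp
  qed
qed

text \<open>The diagram in the Grothendieck construction with tuples \<open>L\<close> and underlying diagram \<open>G\<close>. A tuple of
  length \<open>k\<close> has degree \<open>k - 1\<close>.\<close>
definition labelled ::
    "('p \<Rightarrow> 'a list) \<Rightarrow> ('p \<Rightarrow> 'p \<Rightarrow> nat \<Rightarrow> nat) \<Rightarrow> ('p, 'p \<times> 'p, 'o, 'm) functor_data \<Rightarrow>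
     ('p, 'p \<times> 'p, nat \<times> 'a list \<times> 'o,
       (nat \<times> 'a list \<times> 'o) \<times> (nat \<times> nat \<times> (nat \<Rightarrow> nat)) \<times> 'a list \<times> 'm) functor_data" where
  "labelled L \<phi> G =
     \<lparr>onOb = \<lambda>p. (length (L p) - 1, L p, onOb G p),
      onAr = \<lambda>(p, q). ((length (L p) - 1, L p, onOb G p),
        (length (L q) - 1, length (L p) - 1, restrict (\<phi> p q) {..length (L q) - 1}), L q, onAr G (p, q))\<rparr>"

lemma Src_Gr_cech: "Src (Gr_cech C A D) = fst"
  by (simp add: Gr_cech_def grothendieck_def)

lemma Tgt_Gr_cech: "Tgt (Gr_cech C A D) (s, (m, n, \<phi>), bs, f) = (m, bs, Tgt C f)"
  by (simp add: Gr_cech_def grothendieck_def cech_nerve_def cech_level_def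
      coproduct_category_def inter_subcategory_def opcat_def Delta_def)

lemma Idn_Gr_cech:
  "Idn (Gr_cech C A D) (n, as, x) = ((n, as, x), (n, n, restrict id {..n}), as, Idn C x)"
  by (simp add: Gr_cech_def grothendieck_def cech_nerve_def cech_level_def
      coproduct_category_def inter_subcategory_def opcat_def Delta_def)

lemma Cmp_Gr_cech:
  assumes "(s, (m, n, \<phi>), bs, f) \<in> Ar (Gr_cech C A D)"
    and "(s', (l, m, \<psi>), cs, g) \<in> Ar (Gr_cech C A D)"
  shows "Cmp (Gr_cech C A D) (s', (l, m, \<psi>), cs, g) (s, (m, n, \<phi>), bs, f) =
    (s, (l, n, compose {..l} \<phi> \<psi>), cs, Cmp C g f)"
  using assms
  by (auto simp: Ar_Gr_cech)
     (auto simp: Gr_cech_def grothendieck_def cech_nerve_def cech_level_def act_def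
       coproduct_category_def inter_subcategory_def opcat_def Delta_def)

lemma full_subcategory_Ar:
  assumes "full_subcategory C D" and "x \<in> Ob D" "y \<in> Ob D" and "f \<in> hom C x y"
  shows "f \<in> Ar D"
  using assms unfolding full_subcategory_def by (metis (no_types, lifting) hom_def mem_Collect_eq)

text \<open>Since the \<open>D a\<close> are full, it suffices to check that the objects lie in the right subcategories:
  as \<open>L q\<close> is a reindexing of \<open>L p\<close>, source and target of the morphism over \<open>p \<le> q\<close> lie in \<open>D a\<close> for
  each \<open>a\<close> in \<open>L q\<close>.\<close>
lemma diagram_labelled:
  assumes full: "\<And>a. a \<in> A \<Longrightarrow> full_subcategory C (D a)"
    and L: "label_diagram P L \<phi>" "\<And>p. p \<in> P \<Longrightarrow> set (L p) \<subseteq> A"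
    and G: "diagram C P G" and mem: "\<And>p a. p \<in> P \<Longrightarrow> a \<in> set (L p) \<Longrightarrow> onOb G p \<in> Ob (D a)"
  shows "diagram (Gr_cech C A D) P (labelled L \<phi> G)"
proof -
  interpret label_diagram P L \<phi> by (rule L(1))
  have len: "Suc (length (L p) - Suc 0) = length (L p)" if "p \<in> P" for p
    using nonempty[OF that] by (cases "L p") auto
  have le_len: "k \<le> length (L p) - Suc 0 \<longleftrightarrow> k < length (L p)" if "p \<in> P" for p k
    using len[OF that] by linarith
  have tup: "L p \<in> tuples A (length (L p) - Suc 0)" if "p \<in> P" for p
    using L(2)[OF that] len[OF that] by (simp add: tuples_def)
  have d: "(length (L q) - Suc 0, length (L p) - Suc 0, restrict (\<phi> p q) {..length (L q) - Suc 0}) \<in> Ar Delta"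
    if "p \<in> P" "q \<in> P" "p \<le> q" for p q
    using idx_less[OF that] idx_mono[OF that]
    by (auto simp: Delta_def mono_on_def le_len[OF that(1)] le_len[OF that(2)])
  have re: "L q = reindex (length (L q) - Suc 0) (restrict (\<phi> p q) {..length (L q) - Suc 0}) (L p)"
    if "p \<in> P" "q \<in> P" "p \<le> q" for p q
  proof (rule nth_equalityI)
    show "length (L q) = length (reindex (length (L q) - Suc 0) (restrict (\<phi> p q) {..length (L q) - Suc 0}) (L p))"
      using len[OF that(2)] by (simp add: reindex_def del: upt_Suc)
    show "L q ! k = reindex (length (L q) - Suc 0) (restrict (\<phi> p q) {..length (L q) - Suc 0}) (L p) ! k"
      if "k < length (L q)" for k
      using idx_nth[OF \<open>p \<in> P\<close> \<open>q \<in> P\<close> \<open>p \<le> q\<close> that] that len[OF \<open>q \<in> P\<close>] le_len[OF \<open>q \<in> P\<close>, of k]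
      by (simp add: reindex_def del: upt_Suc)
  qed
  have hom: "onAr G (p, q) \<in> hom C (onOb G p) (onOb G q)" if "p \<in> P" "q \<in> P" "p \<le> q" for p q
    by (rule diagram_hom[OF G that])
  have sub: "set (L q) \<subseteq> set (L p)" if "p \<in> P" "q \<in> P" "p \<le> q" for p q
    using idx_less[OF that] idx_nth[OF that] by (metis in_set_conv_nth subsetI)
  have ar: "onAr G (p, q) \<in> Ar (D a)" if pq: "p \<in> P" "q \<in> P" "p \<le> q" and a: "a \<in> set (L q)" for p q a
  proof (rule full_subcategory_Ar[OF full _ _ hom[OF pq]])
    show "a \<in> A" using a L(2)[OF pq(2)] by auto
    show "onOb G p \<in> Ob (D a)" using a sub[OF pq] pq by (intro mem) auto
    show "onOb G q \<in> Ob (D a)" using a pq by (intro mem) auto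
  qed
  let ?F = "labelled L \<phi> G"
  have Ar: "onAr ?F (p, q) \<in> Ar (Gr_cech C A D)" if "p \<in> P" "q \<in> P" "p \<le> q" for p q
    using tup[OF that(1)] tup[OF that(2)] d[OF that] re[OF that] ar[OF that] mem[OF that(1)] hom[OF that]
    by (simp add: labelled_def Ar_Gr_cech hom_def)
  show ?thesis
    unfolding diagram_def
  proof (intro conjI ballI impI)
    fix p assume p: "p \<in> P"
    show "onOb ?F p \<in> Ob (Gr_cech C A D)"
      using tup[OF p] mem[OF p] by (simp add: labelled_def Ob_Gr_cech)
    have "restrict (\<phi> p p) {..length (L p) - Suc 0} = restrict id {..length (L p) - Suc 0}"
      using idx_refl[OF p] by (auto simp: fun_eq_iff le_len[OF p])
    then show "onAr ?F (p, p) = Idn (Gr_cech C A D) (onOb ?F p)"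
      by (simp add: labelled_def Idn_Gr_cech diagram_Idn[OF G p])
  next
    fix p q assume pq: "p \<in> P" "q \<in> P" "p \<le> q"
    then show "onAr ?F (p, q) \<in> hom (Gr_cech C A D) (onOb ?F p) (onOb ?F q)"
      using Ar[OF pq] hom[OF pq] by (simp add: hom_def Src_Gr_cech) (simp add: labelled_def Tgt_Gr_cech)
  next
    fix p q r assume pqr: "p \<in> P" "q \<in> P" "r \<in> P" "p \<le> q" "q \<le> r"
    have "restrict (\<phi> p r) {..length (L r) - Suc 0} = compose {..length (L r) - Suc 0}
        (restrict (\<phi> p q) {..length (L q) - Suc 0}) (restrict (\<phi> q r) {..length (L r) - Suc 0})"
      using idx_trans[OF pqr] idx_less[OF pqr(2,3,5)]
      by (auto simp: fun_eq_iff compose_def le_len[OF pqr(2)] le_len[OF pqr(3)])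
    then show "onAr ?F (p, r) = Cmp (Gr_cech C A D) (onAr ?F (q, r)) (onAr ?F (p, q))"
      using Cmp_Gr_cech[OF Ar[OF pqr(1,2,4), unfolded labelled_def, simplified]
          Ar[OF pqr(2,3,5), unfolded labelled_def, simplified]] diagram_Cmp[OF G pqr]
      by (simp add: labelled_def)
  qed
qed

definition simplex_label :: "(nat, nat \<times> nat, nat \<times> 'a list \<times> 'o, 'e) functor_data \<Rightarrow> nat \<Rightarrow> 'a list" where
  "simplex_label \<sigma> i = fst (snd (onOb \<sigma> i))"

definition simplex_reindex ::
    "(nat, nat \<times> nat, 'v, 's \<times> (nat \<times> nat \<times> (nat \<Rightarrow> nat)) \<times> 'e) functor_data \<Rightarrow>
     nat \<Rightarrow> nat \<Rightarrow> nat \<Rightarrow> nat" where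
  "simplex_reindex \<sigma> i j = snd (snd (fst (snd (onAr \<sigma> (i, j)))))"

text \<open>Conversely, a simplex of the nerve of the Grothendieck construction splits into its tuples and its
  underlying simplex.\<close>
lemma Gr_cech_simplex:
  assumes C: "category C" and D: "\<And>a. a \<in> A \<Longrightarrow> subcategory C (D a)"
    and s: "\<sigma> \<in> onOb (nerve (Gr_cech C A D)) n"
  defines "L \<equiv> simplex_label \<sigma>" and "\<phi> \<equiv> simplex_reindex \<sigma>"
    and "\<tau> \<equiv> nerve_map (rho C A D) n \<sigma>"
  shows "\<tau> \<in> onOb (nerve C) n" and "label_diagram {..n} L \<phi>"
    and "\<And>i. i \<le> n \<Longrightarrow> onOb \<sigma> i = onOb (labelled L \<phi> \<tau>) i"
    and "\<And>i j. i \<le> j \<Longrightarrow> j \<le> n \<Longrightarrow> onAr \<sigma> (i, j) = onAr (labelled L \<phi> \<tau>) (i, j)"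
    and "\<And>i. i \<le> n \<Longrightarrow> set (L i) \<subseteq> A"
    and "\<And>i a. i \<le> n \<Longrightarrow> a \<in> set (L i) \<Longrightarrow> onOb \<tau> i \<in> Ob (D a)"
proof -
  let ?G = "Gr_cech C A D"
  note dg = diagram_nerve[OF s]
  show \<tau>: "\<tau> \<in> onOb (nerve C) n"
  proof -
    have "simplicial_map (nerve ?G) (nerve C) (nerve_map (rho C A D))"
      by (rule simplicial_map_nerve_map[OF category_Gr_cech[OF C] is_functor_rho[OF C]]) (erule D)+
    then have "nerve_map (rho C A D) n \<in> onOb (nerve ?G) n \<rightarrow> onOb (nerve C) n"
      unfolding simplicial_map_def by blast
    then show ?thesis unfolding \<tau>_def using s by (rule funcset_mem)
  qed
  have Ob: "onOb \<sigma> i \<in> Ob ?G" if "i \<le> n" for i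
    using diagram_Ob[OF dg] that by simp
  have Ar: "onAr \<sigma> (i, j) \<in> hom ?G (onOb \<sigma> i) (onOb \<sigma> j)" if "i \<le> j" "j \<le> n" for i j
    using diagram_hom[OF dg, of i j] that by simp
  have ob: "onOb \<sigma> i = (length (L i) - 1, L i, onOb \<tau> i) \<and> L i \<in> tuples A (length (L i) - 1) \<and>
      (\<forall>a\<in>set (L i). onOb \<tau> i \<in> Ob (D a))" if i: "i \<le> n" for i
  proof -
    obtain k as x where o: "onOb \<sigma> i = (k, as, x)" by (cases "onOb \<sigma> i")
    have k: "as \<in> tuples A k" "\<forall>a\<in>set as. x \<in> Ob (D a)" using Ob[OF i] by (auto simp: o Ob_Gr_cech)
    have "onOb \<tau> i = onOb (rho C A D) (onOb \<sigma> i)"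
      using i by (simp add: \<tau>_def nerve_map_def comp_functor_def compose_def ordinal_def)
    also have "\<dots> = x" using Ob[OF i] by (simp add: o rho_def)
    finally show ?thesis using k by (simp add: o L_def simplex_label_def tuples_def)
  qed
  have ne: "L i \<noteq> []" if "i \<le> n" for i using ob[OF that] by (auto simp: tuples_def)
  have len: "length (L i) = Suc (length (L i) - 1)" if "i \<le> n" for i
    using ne[OF that] by (cases "L i") auto
  have ar: "onAr \<sigma> (i, j) = ((length (L i) - 1, L i, onOb \<tau> i),
      (length (L j) - 1, length (L i) - 1, \<phi> i j), L j, onAr \<tau> (i, j)) \<and>
      (length (L j) - 1, length (L i) - 1, \<phi> i j) \<in> Ar Delta \<and>
      L j = reindex (length (L j) - 1) (\<phi> i j) (L i)" if ij: "i \<le> j" "j \<le> n" for i j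
  proof -
    obtain s m k \<psi> bs f where o: "onAr \<sigma> (i, j) = (s, (m, k, \<psi>), bs, f)"
      by (metis prod.exhaust)
    have "onAr \<tau> (i, j) = onAr (rho C A D) (onAr \<sigma> (i, j))"
      using ij by (simp add: \<tau>_def nerve_map_def comp_functor_def compose_def ordinal_def)
    also have "\<dots> = f" using Ar[OF ij] by (simp add: o rho_def hom_def)
    finally have f: "onAr \<tau> (i, j) = f" .
    have a: "(s, (m, k, \<psi>), bs, f) \<in> Ar ?G" and "s = onOb \<sigma> i" "(m, bs, Tgt C f) = onOb \<sigma> j"
      using Ar[OF ij] by (auto simp: hom_def o Src_Gr_cech Tgt_Gr_cech)
    then have s: "s = (length (L i) - 1, L i, onOb \<tau> i)" and m: "m = length (L j) - 1" "bs = L j"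
      using ob[of i] ob[of j] ij by auto
    have "k = length (L i) - 1" "(m, k, \<psi>) \<in> Ar Delta" "bs = reindex m \<psi> (L i)"
      using a by (auto simp: Ar_Gr_cech s)
    moreover have "\<phi> i j = \<psi>" by (simp add: \<phi>_def simplex_reindex_def o)
    ultimately show ?thesis by (simp add: o s m f)
  qed
  show "onOb \<sigma> i = onOb (labelled L \<phi> \<tau>) i" if "i \<le> n" for i
    using ob[OF that] by (simp add: labelled_def)
  show "onAr \<sigma> (i, j) = onAr (labelled L \<phi> \<tau>) (i, j)" if "i \<le> j" "j \<le> n" for i j
  proof -
    have "restrict (\<phi> i j) {..length (L j) - 1} = \<phi> i j"
      using ar[OF that] by (intro extensional_restrict) (auto simp: Delta_def PiE_iff)
    then show ?thesis using ar[OF that] by (simp add: labelled_def)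
  qed
  show "set (L i) \<subseteq> A" if "i \<le> n" for i
    using ob[OF that] by (simp add: tuples_def)
  show "onOb \<tau> i \<in> Ob (D a)" if "i \<le> n" "a \<in> set (L i)" for i a
    using ob[OF that(1)] that(2) by simp
  show "label_diagram {..n} L \<phi>"
  proof (unfold_locales, goal_cases)
    case (1 p)
    then show ?case by (simp add: ne)
  next
    case (2 p k)
    then have "(length (L p) - 1, length (L p) - 1, \<phi> p p) = (length (L p) - 1, length (L p) - 1, restrict id {..length (L p) - 1})"
      using ar[of p p] ob[of p] diagram_Idn[OF dg, of p] by (simp add: Idn_Gr_cech)
    then show ?case using 2 len[of p] by simp
  next
    case (3 p q k)
    then show ?case using ar[of p q] Delta_le[of _ _ "\<phi> p q" k] len[of p] len[of q] by fastforce
  next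
    case (4 p q k)
    then have "L q ! k = reindex (length (L q) - 1) (\<phi> p q) (L p) ! k" using ar[of p q] by simp
    also have "\<dots> = L p ! \<phi> p q k"
      using 4 len[of q] by (simp add: reindex_def del: upt_Suc)
    finally show ?case ..
  next
    case (5 p q k l)
    then show ?case using ar[of p q] len[of q] by (simp add: Delta_def mono_on_def)
  next
    case (6 p q r k)
    have A1: "onAr \<sigma> (p, q) \<in> Ar ?G" and A2: "onAr \<sigma> (q, r) \<in> Ar ?G"
      using Ar[of p q] Ar[of q r] 6 by (auto simp: hom_def)
    have le: "p \<le> n" "q \<le> n" "r \<le> n" "p \<le> q" "q \<le> r" "p \<le> r" using 6 by auto
    note e = ar[OF le(4,2), THEN conjunct1] ar[OF le(5,3), THEN conjunct1] ar[OF le(6,3), THEN conjunct1]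
    have "onAr \<sigma> (p, r) = Cmp ?G (onAr \<sigma> (q, r)) (onAr \<sigma> (p, q))"
      using le by (intro diagram_Cmp[OF dg]) simp_all
    also have "\<dots> = ((length (L p) - 1, L p, onOb \<tau> p), (length (L r) - 1, length (L p) - 1,
        compose {..length (L r) - 1} (\<phi> p q) (\<phi> q r)), L r, Cmp C (onAr \<tau> (q, r)) (onAr \<tau> (p, q)))"
      unfolding e by (rule Cmp_Gr_cech[OF A1[unfolded e] A2[unfolded e]])
    finally have "\<phi> p r = compose {..length (L r) - 1} (\<phi> p q) (\<phi> q r)"
      unfolding e prod.inject by blast
    then show ?case using 6 len[of r] by (simp add: compose_def)
  qed
qed

section \<open>Homotopies of maps of classifying spaces\<close>

lemma topspace_classifying_space:
  assumes "c \<in> topspace (classifying_space E)"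
  obtains n \<sigma> t where "\<sigma> \<in> onOb (nerve E) n" "t \<in> standard_simplex n"
    "c = glue_class (nerve E) (n, \<sigma>, t)"
  using assms
  by (auto simp: classifying_space_def realization_def topspace_quotient_topology topspace_presentation)

lemma continuous_map_slice:
  assumes H: "continuous_map (prod_topology (top_of_set {0..1::real}) X) Y H" and s: "s \<in> {0..1}"
  shows "continuous_map X Y (\<lambda>c. H (s, c))"
proof -
  have "continuous_map X (prod_topology (top_of_set {0..1::real}) X) (\<lambda>c. (s, c))"
    using s by (intro continuous_map_pairedI) auto
  from continuous_map_compose[OF this H] show ?thesis by (simp add: o_def)
qed

lemma homotopic_slices:
  assumes H: "continuous_map (prod_topology (top_of_set {0..1::real}) X) Y H"
    and "\<And>c. c \<in> topspace X \<Longrightarrow> H (0, c) = p c" and "\<And>c. c \<in> topspace X \<Longrightarrow> H (1, c) = q c"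
  shows "homotopic_with (\<lambda>_. True) X Y p q"
  using assms by (subst homotopic_with) auto

lemma monoD_simplex:
  assumes "(m, n, \<phi>) \<in> Ar Delta"
  shows "i \<le> m \<Longrightarrow> \<phi> i \<le> n" and "i \<le> j \<Longrightarrow> j \<le> m \<Longrightarrow> \<phi> i \<le> \<phi> j"
  using assms by (auto simp: Delta_def mono_on_def)

lemma simplex_index_reparam:
  assumes t: "t \<in> standard_simplex n" and e: "0 \<le> e" "e \<le> 1" and s: "s \<in> {0..1}"
  shows "mono_on {0..<1} (\<lambda>u. simplex_index t (reparam e s u))"
    and "\<And>u. 0 \<le> u \<Longrightarrow> u < 1 \<Longrightarrow> simplex_index t (reparam e s u) \<le> n"
  using s reparam_range[OF e]
  by (auto intro!: mono_onI simplex_index_mono[OF t] simplex_index_le[OF t] reparam_mono)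

lemma ae_stable_reparam_index:
  assumes e: "0 \<le> e" "e \<le> 1" and S: "continuous_on (standard_simplex n \<times> {0..1}) S"
    "\<And>z. z \<in> standard_simplex n \<times> {0..1::real} \<Longrightarrow> S z \<in> {0..1}"
  shows "ae_stable (standard_simplex n \<times> {0..1::real}) (\<lambda>z u. simplex_index (fst z) (reparam e (S z) u))"
proof (rule ae_stable_simplex_index[OF _ _ S e])
  show "continuous_on (standard_simplex n \<times> {0..1::real}) (\<lambda>z. fst z i)" for i
    by (rule continuous_on_product_then_coordinatewise) (intro continuous_on_fst continuous_on_id)
  show "fst z \<in> standard_simplex n" if "z \<in> standard_simplex n \<times> {0..1::real}" for z
    using that by auto
qed

text \<open>A change of speed is homotopic to the identity, which is the end \<open>s = 1\<close> of this homotopy.\<close>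
lemma reparam_homotopy:
  assumes e: "0 \<le> e" "e \<le> 1"
  obtains H where
    "continuous_map (prod_topology (top_of_set {0..1::real}) (classifying_space E)) (classifying_space E) H"
    "\<And>n \<sigma> t s. \<lbrakk>\<sigma> \<in> onOb (nerve E) n; t \<in> standard_simplex n; s \<in> {0..1}\<rbrakk> \<Longrightarrow>
      H (s, glue_class (nerve E) (n, \<sigma>, t)) = realize E \<sigma> (\<lambda>u. simplex_index t (reparam e s u))"
proof (rule classifying_space_homotopy[where C = E and E = E and P = "\<lambda>n \<sigma>. {..n}" and F = "\<lambda>n \<sigma>. \<sigma>"
      and f = "\<lambda>n \<sigma> (t, s) u. simplex_index t (reparam e s u)"])
  show "diagram E {..n} \<sigma>" if "\<sigma> \<in> onOb (nerve E) n" for n \<sigma>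
    by (rule diagram_nerve[OF that])
  show "mono_on {0..<1} (case z of (t, s) \<Rightarrow> \<lambda>u. simplex_index t (reparam e s u)) \<and>
      (case z of (t, s) \<Rightarrow> \<lambda>u. simplex_index t (reparam e s u)) ` {0..<1} \<subseteq> {..n}"
    if "z \<in> standard_simplex n \<times> {0..1}" for n z
    using that simplex_index_reparam[OF _ e] by (cases z) auto
  show "ae_stable (standard_simplex n \<times> {0..1}) (\<lambda>(t, s) u. simplex_index t (reparam e s u))" for n
    unfolding case_prod_beta' by (rule ae_stable_reparam_index[OF e]) (auto intro: continuous_intros)
  fix m n \<phi> \<sigma> t and s :: real
  assume d: "(m, n, \<phi>) \<in> Ar Delta" and \<sigma>: "\<sigma> \<in> onOb (nerve E) n"
    and t: "t \<in> standard_simplex m" and s: "s \<in> {0..1}"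
  let ?\<sigma> = "act (nerve E) (m, n, \<phi>) \<sigma>"
  let ?f = "\<lambda>u. simplex_index t (reparam e s u)"
  have eq: "simplex_index (simplex_push m \<phi> t) (reparam e s u) = \<phi> (?f u)" if "0 \<le> u" "u < 1" for u
    using reparam_range[OF e] s that by (intro simplex_index_push[OF d t]) auto
  note f = simplex_index_reparam[OF t e s]
  have "realize E ?\<sigma> ?f = realize E \<sigma> (\<lambda>u. \<phi> (?f u))"
  proof (rule realize_map[symmetric, where P = "{..m}" and Q = "{..n}" and h = \<phi>])
    show "mono_on {0..<1} (\<lambda>u. \<phi> (?f u))"
      by (rule mono_onI) (use mono_onD[OF f(1)] f(2) in \<open>simp add: monoD_simplex(2)[OF d]\<close>)
    show "mono_on {0..<1} ?f" by (rule f(1))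
    show "?f ` {0..<1} \<subseteq> {..m}" using f(2) by auto
    show "\<phi> (?f u) \<in> {..n}" if "0 \<le> u" "u < 1" for u
      using f(2)[OF that] monoD_simplex(1)[OF d] by simp
    show "diagram E {..n} \<sigma>" by (rule diagram_nerve[OF \<sigma>])
    show "onOb ?\<sigma> p = onOb \<sigma> (\<phi> p)" if "p \<in> {..m}" for p
      using act_nerve_onOb[OF d \<sigma>] that by simp
    show "onAr ?\<sigma> (p, q) = onAr \<sigma> (\<phi> p, \<phi> q)" if "p \<in> {..m}" "q \<in> {..m}" "p \<le> q" for p q
      using act_nerve_onAr[OF d \<sigma>] that by simp
  qed simp
  also have "\<dots> = realize E \<sigma> (\<lambda>u. simplex_index (simplex_push m \<phi> t) (reparam e s u))"
    by (rule realize_cong) (simp add: eq)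
  finally show "realize E ?\<sigma> ((\<lambda>(t, s) u. simplex_index t (reparam e s u)) (t, s)) =
      realize E \<sigma> ((\<lambda>(t, s) u. simplex_index t (reparam e s u)) (simplex_push m \<phi> t, s))"
    by simp
qed (auto intro: that)

lemma classifying_map_glue_class:
  assumes "category E" and "is_functor E E' K"
  shows "classifying_map E' K (glue_class (nerve E) (n, \<sigma>, t)) = glue_class (nerve E') (n, nerve_map K n \<sigma>, t)"
  unfolding classifying_map_def by (rule realization_map_class[OF simplicial_map_nerve_map[OF assms]])

text \<open>A continuous map is obtained as a slice of a constant homotopy.\<close>
lemma continuous_map_classifying_map:
  assumes E: "category E" and K: "is_functor E E' K"
  shows "continuous_map (classifying_space E) (classifying_space E') (classifying_map E' K)"
proof -
  have sm: "nerve_map K n \<sigma> \<in> onOb (nerve E') n" if "\<sigma> \<in> onOb (nerve E) n" for n \<sigma>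
    using simplicial_map_nerve_map[OF E K] that unfolding simplicial_map_def by blast
  have sa: "nerve_map K m (act (nerve E) (m, n, \<phi>) \<sigma>) = act (nerve E') (m, n, \<phi>) (nerve_map K n \<sigma>)"
    if "(m, n, \<phi>) \<in> Ar Delta" "\<sigma> \<in> onOb (nerve E) n" for m n \<phi> \<sigma>
    using simplicial_map_nerve_map[OF E K] that unfolding simplicial_map_def by blast
  obtain H where H: "continuous_map (prod_topology (top_of_set {0..1::real}) (classifying_space E)) (classifying_space E') H"
    and eq: "\<And>n \<sigma> t s. \<lbrakk>\<sigma> \<in> onOb (nerve E) n; t \<in> standard_simplex n; s \<in> {0..1}\<rbrakk> \<Longrightarrow>
      H (s, glue_class (nerve E) (n, \<sigma>, t)) = realize E' (nerve_map K n \<sigma>) (simplex_index t)"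
  proof (rule classifying_space_homotopy[where C = E and E = E' and P = "\<lambda>n \<sigma>. {..n}"
        and F = "\<lambda>n \<sigma>. nerve_map K n \<sigma>" and f = "\<lambda>n \<sigma> z. simplex_index (fst z)"])
    show "diagram E' {..n} (nerve_map K n \<sigma>)" if "\<sigma> \<in> onOb (nerve E) n" for n \<sigma>
      by (rule diagram_nerve[OF sm[OF that]])
    show "mono_on {0..<1} (simplex_index (fst z)) \<and> simplex_index (fst z) ` {0..<1} \<subseteq> {..n}"
      if "z \<in> standard_simplex n \<times> {0..1}" for n and z :: "(nat \<Rightarrow> real) \<times> real"
      using that mono_simplex_index[of "fst z" n] by (cases z) simp
    have "ae_stable (standard_simplex n \<times> {0..1::real}) (\<lambda>z u. simplex_index (fst z) (reparam 0 1 u))" for n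
      by (rule ae_stable_reparam_index) auto
    then show "ae_stable (standard_simplex n \<times> {0..1::real}) (\<lambda>z. simplex_index (fst z))" for n
      by (simp add: reparam_1)
    show "realize E' (nerve_map K m (act (nerve E) (m, n, \<phi>) \<sigma>)) (simplex_index (fst (t, s))) =
        realize E' (nerve_map K n \<sigma>) (simplex_index (fst (simplex_push m \<phi> t, s)))"
      if "(m, n, \<phi>) \<in> Ar Delta" "\<sigma> \<in> onOb (nerve E) n" "t \<in> standard_simplex m"
      for m n \<phi> \<sigma> t and s :: real
      using that realize_simplex_index[OF act_nerve_closed[OF that(1) sm[OF that(2)]] that(3)]
        realize_simplex_index[OF sm[OF that(2)] simplex_push_standard_simplex[OF that(1,3)]]
        glue_class_eqI[OF glue.intros[OF that(1) sm[OF that(2)] that(3)]]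
      by (simp add: sa)
  qed (auto intro: that)
  have "continuous_map (classifying_space E) (classifying_space E') (\<lambda>c. H (0, c))"
    by (rule continuous_map_slice[OF H]) simp
  then show ?thesis
  proof (rule continuous_map_eq)
    show "H (0, c) = classifying_map E' K c" if "c \<in> topspace (classifying_space E)" for c
      using that
    proof (rule topspace_classifying_space)
      fix n \<sigma> t assume "\<sigma> \<in> onOb (nerve E) n" "t \<in> standard_simplex n" "c = glue_class (nerve E) (n, \<sigma>, t)"
      then show ?thesis
        using eq[of \<sigma> n t 0] classifying_map_glue_class[OF E K] realize_simplex_index[OF sm] by simp
    qed
  qed
qed

section \<open>The homotopy inverse of the forgetful functor\<close>

text \<open>The proportion of the half of the motion complementary to the half played by \<open>track\<close> that is spent
  at objects with chosen index \<open>a\<close>. The half is rescaled to the unit interval.\<close>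
definition share :: "('o \<Rightarrow> 'a) \<Rightarrow> real \<Rightarrow> (nat, nat \<times> nat, 'o, 'm) functor_data \<Rightarrow> (nat \<Rightarrow> real) \<Rightarrow> 'a \<Rightarrow> real" where
  "share ac e \<tau> t = weight (\<lambda>v. ac (onOb \<tau> (simplex_index t (reparam (1 - e) 0 v))))"

text \<open>The step function that defines the homotopy inverse: the occupied vertex and the dropped indices.\<close>
definition track ::
    "('o \<Rightarrow> 'a) \<Rightarrow> real \<Rightarrow> (nat, nat \<times> nat, 'o, 'm) functor_data \<Rightarrow> (nat \<Rightarrow> real) \<Rightarrow> real \<Rightarrow> nat \<times> 'a set" where
  "track ac e \<tau> t u = (simplex_index t (reparam e 0 u), dropped (share ac e \<tau> t) u)"

text \<open>The assumption \<open>key\<close> is the only place where the two kinds of covers enter: a position in the half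
  of the motion that is played lies in \<open>D a\<close> for each index \<open>a\<close> collected in the other half.
  The relation \<open>R\<close> serves to list finite sets of indices.\<close>
locale cech_choice =
  fixes C :: "('o, 'm) category" and A :: "'a set" and D :: "'a \<Rightarrow> ('o, 'm) category"
    and ac :: "'o \<Rightarrow> 'a" and e :: real and R :: "'a \<Rightarrow> 'a \<Rightarrow> bool"
  assumes C: "category C"
    and full: "a \<in> A \<Longrightarrow> full_subcategory C (D a)"
    and ac: "x \<in> Ob C \<Longrightarrow> ac x \<in> A"
    and e: "0 \<le> e" "e \<le> 1"
    and key: "\<lbrakk>\<tau> \<in> onOb (nerve C) n; t \<in> standard_simplex n; 0 \<le> u; u < 1; 0 \<le> v; v < 1\<rbrakk> \<Longrightarrow>
      onOb \<tau> (simplex_index t (reparam e 0 u)) \<in>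
        Ob (D (ac (onOb \<tau> (simplex_index t (reparam (1 - e) 0 v)))))"
    and R: "\<not> R a a" "R a b \<Longrightarrow> R b c \<Longrightarrow> R a c" "a \<noteq> b \<Longrightarrow> R a b \<or> R b a"
begin

lemma e': "0 \<le> 1 - e" "1 - e \<le> 1"
  using e by auto

lemma sub: "a \<in> A \<Longrightarrow> subcategory C (D a)"
  using full by (simp add: full_subcategory_def)

abbreviation "Gr \<equiv> Gr_cech C A D"
abbreviation "\<rho> \<equiv> rho C A D"

lemma Gr: "category Gr" and rho: "is_functor Gr C \<rho>"
proof -
  show "category Gr" by (rule category_Gr_cech[OF C]) (erule sub)
  show "is_functor Gr C \<rho>" by (rule is_functor_rho[OF C]) (erule sub)
qed

definition labels :: "nat \<Rightarrow> (nat, nat \<times> nat, 'o, 'm) functor_data \<Rightarrow> 'a set" where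
  "labels n \<tau> = (\<lambda>i. ac (onOb \<tau> i)) ` {..n}"

text \<open>The poset in which \<open>track\<close> moves: pairs of a vertex and a set of dropped indices for which the
  remaining indices form a tuple of the Cech nerve at that vertex.\<close>
definition tracks :: "nat \<Rightarrow> (nat, nat \<times> nat, 'o, 'm) functor_data \<Rightarrow> (nat \<times> 'a set) set" where
  "tracks n \<tau> = {(i, B). i \<le> n \<and> - B \<noteq> {} \<and> - B \<subseteq> labels n \<tau> \<and> (\<forall>a\<in>- B. onOb \<tau> i \<in> Ob (D a))}"

lemma finite_labels: "finite (labels n \<tau>)"
  by (simp add: labels_def)

lemma labels_A: "\<tau> \<in> onOb (nerve C) n \<Longrightarrow> labels n \<tau> \<subseteq> A"
  using diagram_Ob[OF diagram_nerve[of \<tau> C n]] ac by (auto simp: labels_def)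

lemma finite_tracks: "finite (tracks n \<tau>)"
proof (rule finite_subset)
  show "tracks n \<tau> \<subseteq> {..n} \<times> uminus ` Pow (labels n \<tau>)"
  proof
    fix p assume "p \<in> tracks n \<tau>"
    moreover have "snd p = - (- snd p)" by simp
    ultimately show "p \<in> {..n} \<times> uminus ` Pow (labels n \<tau>)"
      by (cases p) (auto simp: tracks_def intro!: image_eqI[of _ uminus "- snd p"])
  qed
qed (simp add: finite_labels)

context
  fixes \<tau> n t
  assumes \<tau>: "\<tau> \<in> onOb (nerve C) n" and t: "t \<in> standard_simplex n"
begin

lemma share_step: "step_function (\<lambda>v. ac (onOb \<tau> (simplex_index t (reparam (1 - e) 0 v))))"
proof -
  note f = simplex_index_reparam[OF t e', of 0]
  have "finite ((\<lambda>v. simplex_index t (reparam (1 - e) 0 v)) ` {0..<1})"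
  proof (rule finite_subset)
    show "(\<lambda>v. simplex_index t (reparam (1 - e) 0 v)) ` {0..<1} \<subseteq> {..n}"
      using f(2) by (simp add: image_subset_iff)
  qed simp
  then have "step_function (\<lambda>v. simplex_index t (reparam (1 - e) 0 v))"
    using f(1) by (intro step_function_mono) auto
  from step_function_comp[OF this, of "\<lambda>i. ac (onOb \<tau> i)"] show ?thesis .
qed

lemma share_range: "(\<lambda>v. ac (onOb \<tau> (simplex_index t (reparam (1 - e) 0 v)))) ` {0..<1} \<subseteq> labels n \<tau>"
  using simplex_index_reparam(2)[OF t e', of 0] by (auto simp: labels_def)

lemma share_nonneg: "0 \<le> share ac e \<tau> t a"
  by (simp add: share_def weight_nonneg)

lemma share_outside: "a \<notin> labels n \<tau> \<Longrightarrow> share ac e \<tau> t a = 0"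
  unfolding share_def using share_range by (intro weight_eq_0) blast

lemma share_pos_ex: "\<exists>a. 0 < share ac e \<tau> t a"
proof (rule ccontr)
  assume "\<nexists>a. 0 < share ac e \<tau> t a"
  note none = this
  have "share ac e \<tau> t a = 0" for a
  proof -
    have "\<not> 0 < share ac e \<tau> t a" using none by blast
    with share_nonneg[of a] show ?thesis by linarith
  qed
  then have "(\<Sum>a\<in>labels n \<tau>. share ac e \<tau> t a) = 0" by simp
  moreover have "(\<Sum>a\<in>labels n \<tau>. share ac e \<tau> t a) = 1"
    unfolding share_def by (rule sum_weight_eq_1[OF share_step finite_labels share_range])
  ultimately show False by simp
qed

text \<open>Indices of maximal share are never dropped, and an index that has not been dropped has positive
  share, hence is the chosen index of a position in the complementary half.\<close>
lemma track_tracks: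
  assumes u: "0 \<le> u" "u < 1"
  shows "track ac e \<tau> t u \<in> tracks n \<tau>"
proof -
  let ?r = "share ac e \<tau> t" and ?i = "simplex_index t (reparam e 0 u)"
  have "?i \<le> n" using simplex_index_reparam(2)[OF t e, of 0] u by simp
  moreover have "- dropped ?r u \<noteq> {}"
  proof -
    obtain c where "0 < ?r c" using share_pos_ex by blast
    then obtain m where "\<And>b. ?r b \<le> ?r m" "0 < ?r m"
      using exists_max_weight[of "labels n \<tau>" ?r c, OF finite_labels share_nonneg share_outside] by blast
    from max_not_dropped[of ?r m, OF this u] show ?thesis by auto
  qed
  moreover have "a \<in> labels n \<tau> \<and> onOb \<tau> ?i \<in> Ob (D a)" if "a \<notin> dropped ?r u" for a
  proof -
    have p: "0 < ?r a" using that not_dropped_pos[of ?r a u] share_nonneg by simp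
    then have "a \<in> (\<lambda>v. ac (onOb \<tau> (simplex_index t (reparam (1 - e) 0 v)))) ` {0..<1}"
      using weight_eq_0[of a] unfolding share_def by force
    then obtain v where v: "0 \<le> v" "v < 1" "a = ac (onOb \<tau> (simplex_index t (reparam (1 - e) 0 v)))"
      by auto
    have "a \<in> labels n \<tau>" using p share_outside[of a] by force
    moreover have "onOb \<tau> ?i \<in> Ob (D a)" unfolding v(3) by (rule key[OF \<tau> t u v(1,2)])
    ultimately show ?thesis by simp
  qed
  ultimately show ?thesis by (auto simp: tracks_def track_def)
qed

lemma track_mono: "mono_on {0..<1} (track ac e \<tau> t)"
  using mono_onD[OF simplex_index_reparam(1)[OF t e, of 0]] dropped_mono[of "share ac e \<tau> t"] share_nonneg
  by (intro mono_onI) (simp add: track_def)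

end

lemma share_push:
  assumes d: "(m, n, \<phi>) \<in> Ar Delta" and \<tau>: "\<tau> \<in> onOb (nerve C) n" and t: "t \<in> standard_simplex m"
  shows "share ac e (act (nerve C) (m, n, \<phi>) \<tau>) t = share ac e \<tau> (simplex_push m \<phi> t)"
  unfolding share_def
proof (rule ext, rule weight_cong)
  fix v :: real assume v: "0 \<le> v" "v < 1"
  have r: "0 \<le> reparam (1 - e) 0 v" "reparam (1 - e) 0 v < 1" using reparam_range[OF e', of 0 v] v by auto
  show "ac (onOb (act (nerve C) (m, n, \<phi>) \<tau>) (simplex_index t (reparam (1 - e) 0 v))) =
      ac (onOb \<tau> (simplex_index (simplex_push m \<phi> t) (reparam (1 - e) 0 v)))"
    using act_nerve_onOb[OF d \<tau>] simplex_index_push[OF d t r] simplex_index_le[OF t r(2)] by simp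
qed

lemma track_push:
  assumes d: "(m, n, \<phi>) \<in> Ar Delta" and \<tau>: "\<tau> \<in> onOb (nerve C) n" and t: "t \<in> standard_simplex m"
    and u: "0 \<le> u" "u < 1"
  shows "track ac e \<tau> (simplex_push m \<phi> t) u = map_prod \<phi> id (track ac e (act (nerve C) (m, n, \<phi>) \<tau>) t u)"
proof -
  have r: "0 \<le> reparam e 0 u" "reparam e 0 u < 1" using reparam_range[OF e, of 0 u] u by auto
  show ?thesis
    by (simp add: track_def share_push[OF d \<tau> t] simplex_index_push[OF d t r])
qed

lemma ae_stable_track:
  assumes \<tau>: "\<tau> \<in> onOb (nerve C) n"
  shows "ae_stable (standard_simplex n \<times> {0..1::real}) (\<lambda>z. track ac e \<tau> (fst z))"
proof -
  let ?Z = "standard_simplex n \<times> {0..1::real}"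
  have idx: "ae_stable ?Z (\<lambda>z u. simplex_index (fst z) (reparam e' 0 u))" if "0 \<le> e'" "e' \<le> 1" for e'
    by (rule ae_stable_reparam_index[OF that]) auto
  have "continuous_on ?Z (\<lambda>z. share ac e \<tau> (fst z) a)" for a
    unfolding share_def using share_step[OF \<tau>]
    by (intro continuous_on_weight ae_stable_comp[OF idx[OF e'], of "\<lambda>i. ac (onOb \<tau> i)"]) auto
  then have "ae_stable ?Z (\<lambda>z u. dropped (share ac e \<tau> (fst z)) u)"
    using share_nonneg[OF \<tau>] share_outside[OF \<tau>] share_pos_ex[OF \<tau>]
    by (intro ae_stable_dropped[OF finite_labels[of n \<tau>]]) auto
  from ae_stable_pair[OF idx[OF e] this] show ?thesis
    by (simp add: track_def[abs_def])
qed

definition track_label :: "nat \<times> 'a set \<Rightarrow> 'a list" where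
  "track_label p = enumeration R (- snd p)"

definition track_reindex :: "nat \<times> 'a set \<Rightarrow> nat \<times> 'a set \<Rightarrow> nat \<Rightarrow> nat" where
  "track_reindex p q k = position (track_label p) (track_label q ! k)"

lemma label_diagram_track: "label_diagram (tracks n \<tau>) track_label track_reindex"
  and set_track_label: "p \<in> tracks n \<tau> \<Longrightarrow> set (track_label p) = - snd p"
proof -
  have fin: "finite (- snd p)" if "p \<in> tracks n \<tau>" for p
    using that finite_subset[OF _ finite_labels[of n \<tau>], of "- snd p"] by (auto simp: tracks_def)
  show "label_diagram (tracks n \<tau>) track_label track_reindex"
    unfolding track_label_def track_reindex_def
  proof (rule label_diagram_enumeration)
    show "- snd p \<noteq> {}" if "p \<in> tracks n \<tau>" for p
      using that by (auto simp: tracks_def)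
    show "- snd q \<subseteq> - snd p" if "p \<le> q" for p q :: "nat \<times> 'a set"
      using that by (simp add: less_eq_prod_def)
  qed (rule fin R; assumption)+
  show "set (track_label p) = - snd p" if "p \<in> tracks n \<tau>"
    unfolding track_label_def using enumeration(2)[OF fin[OF that], of R] R by blast
qed

lemma diagram_tracks_pullback:
  assumes \<tau>: "\<tau> \<in> onOb (nerve C) n"
  shows "diagram C (tracks n \<tau>) (pullback fst \<tau>)"
  by (rule diagram_pullback[OF diagram_nerve[OF \<tau>]]) (auto simp: tracks_def less_eq_prod_def)

abbreviation section_diagram where
  "section_diagram \<tau> \<equiv> labelled track_label track_reindex (pullback fst \<tau>)"

lemma diagram_section:
  assumes \<tau>: "\<tau> \<in> onOb (nerve C) n"
  shows "diagram Gr (tracks n \<tau>) (section_diagram \<tau>)"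
proof (rule diagram_labelled)
  show "full_subcategory C (D a)" if "a \<in> A" for a by (rule full[OF that])
  show "label_diagram (tracks n \<tau>) track_label track_reindex" by (rule label_diagram_track)
  show "diagram C (tracks n \<tau>) (pullback fst \<tau>)" by (rule diagram_tracks_pullback[OF \<tau>])
  show "set (track_label p) \<subseteq> A" if "p \<in> tracks n \<tau>" for p
    using labels_A[OF \<tau>] that by (simp add: set_track_label[OF that]) (auto simp: tracks_def)
  show "onOb (pullback fst \<tau>) p \<in> Ob (D a)" if "p \<in> tracks n \<tau>" "a \<in> set (track_label p)" for p a
    using that(2) set_track_label[OF that(1)] that(1) by (auto simp: tracks_def pullback_def)
qed

text \<open>The homotopy inverse, stated as a constant homotopy. Compatibility with faces and degeneracies
  holds because the shares, and so the tuples, depend on the motion only.\<close>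
lemma section_exists:
  obtains H where
    "continuous_map (prod_topology (top_of_set {0..1::real}) (classifying_space C)) (classifying_space Gr) H"
    "\<And>n \<tau> t s. \<lbrakk>\<tau> \<in> onOb (nerve C) n; t \<in> standard_simplex n; s \<in> {0..1}\<rbrakk> \<Longrightarrow>
      H (s, glue_class (nerve C) (n, \<tau>, t)) = realize Gr (section_diagram \<tau>) (track ac e \<tau> t)"
proof (rule classifying_space_homotopy[where C = C and E = Gr and P = tracks
      and F = "\<lambda>n. section_diagram" and f = "\<lambda>n \<tau> z. track ac e \<tau> (fst z)"])
  show "finite (tracks n \<tau>)" for n \<tau> by (rule finite_tracks)
  show "diagram Gr (tracks n \<tau>) (section_diagram \<tau>)" if "\<tau> \<in> onOb (nerve C) n" for n \<tau>
    by (rule diagram_section[OF that])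
  show "mono_on {0..<1} (track ac e \<tau> (fst z)) \<and> track ac e \<tau> (fst z) ` {0..<1} \<subseteq> tracks n \<tau>"
    if "\<tau> \<in> onOb (nerve C) n" "z \<in> standard_simplex n \<times> {0..1}" for n \<tau> and z :: "(nat \<Rightarrow> real) \<times> real"
    using that track_mono[OF that(1), of "fst z"] track_tracks[OF that(1), of "fst z"] by auto
  show "ae_stable (standard_simplex n \<times> {0..1::real}) (\<lambda>z. track ac e \<tau> (fst z))"
    if "\<tau> \<in> onOb (nerve C) n" for n \<tau>
    by (rule ae_stable_track[OF that])
  fix m n \<phi> \<tau> t and s :: real
  assume d: "(m, n, \<phi>) \<in> Ar Delta" and \<tau>: "\<tau> \<in> onOb (nerve C) n" and t: "t \<in> standard_simplex m"
  let ?\<tau> = "act (nerve C) (m, n, \<phi>) \<tau>" and ?t = "simplex_push m \<phi> t"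
  note \<tau>' = act_nerve_closed[OF d \<tau>] and t' = simplex_push_standard_simplex[OF d t]
  have "realize Gr (section_diagram \<tau>) (track ac e \<tau> ?t) =
      realize Gr (section_diagram \<tau>) (\<lambda>u. map_prod \<phi> id (track ac e ?\<tau> t u))"
    by (rule realize_cong) (simp add: track_push[OF d \<tau> t])
  also have "\<dots> = realize Gr (section_diagram ?\<tau>) (track ac e ?\<tau> t)"
  proof (rule realize_map[where P = "tracks m ?\<tau>" and Q = "tracks n \<tau>"])
    show "mono_on {0..<1} (track ac e ?\<tau> t)" by (rule track_mono[OF \<tau>' t])
    show "track ac e ?\<tau> t ` {0..<1} \<subseteq> tracks m ?\<tau>" using track_tracks[OF \<tau>' t] by auto
    show "finite (tracks m ?\<tau>)" by (rule finite_tracks)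
    show "mono_on {0..<1} (\<lambda>u. map_prod \<phi> id (track ac e ?\<tau> t u))"
      using track_mono[OF \<tau> t'] track_push[OF d \<tau> t] by (simp add: mono_on_def)
    show "map_prod \<phi> id (track ac e ?\<tau> t u) \<in> tracks n \<tau>" if "0 \<le> u" "u < 1" for u
      using track_tracks[OF \<tau> t' that] track_push[OF d \<tau> t that] by simp
    show "diagram Gr (tracks n \<tau>) (section_diagram \<tau>)" by (rule diagram_section[OF \<tau>])
    show "onOb (section_diagram ?\<tau>) p = onOb (section_diagram \<tau>) (map_prod \<phi> id p)"
      if "p \<in> tracks m ?\<tau>" for p
      using that act_nerve_onOb[OF d \<tau>]
      by (auto simp: labelled_def track_label_def pullback_def tracks_def)
    show "onAr (section_diagram ?\<tau>) (p, q) = onAr (section_diagram \<tau>) (map_prod \<phi> id p, map_prod \<phi> id q)"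
      if "p \<in> tracks m ?\<tau>" "q \<in> tracks m ?\<tau>" "p \<le> q" for p q
      using that act_nerve_onOb[OF d \<tau>] act_nerve_onAr[OF d \<tau>]
      by (auto simp: labelled_def track_label_def track_reindex_def pullback_def tracks_def less_eq_prod_def)
  qed
  finally show "realize Gr (section_diagram ?\<tau>) (track ac e ?\<tau> (fst (t, s))) =
      realize Gr (section_diagram \<tau>) (track ac e \<tau> (fst (?t, s)))" by simp
qed (auto intro: that)

text \<open>Forgetting the tuples leaves the motion at half speed.\<close>
lemma rho_section:
  assumes \<tau>: "\<tau> \<in> onOb (nerve C) n" and t: "t \<in> standard_simplex n"
  shows "classifying_map C \<rho> (realize Gr (section_diagram \<tau>) (track ac e \<tau> t)) =
    realize C \<tau> (\<lambda>u. simplex_index t (reparam e 0 u))"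
proof -
  let ?S = "section_diagram \<tau>"
  let ?F = "\<lparr>onOb = \<lambda>p. onOb \<rho> (onOb ?S p), onAr = \<lambda>a. onAr \<rho> (onAr ?S a)\<rparr>"
  note S = diagram_section[OF \<tau>]
  have img: "track ac e \<tau> t ` {0..<1} \<subseteq> tracks n \<tau>" using track_tracks[OF \<tau> t] by auto
  have "classifying_map C \<rho> (realize Gr ?S (track ac e \<tau> t)) = realize C ?F (track ac e \<tau> t)"
    by (rule classifying_map_realize[OF Gr rho S track_mono[OF \<tau> t] img finite_tracks])
  also have "\<dots> = realize C \<tau> (\<lambda>u. fst (track ac e \<tau> t u))"
  proof (rule realize_map[symmetric, OF track_mono[OF \<tau> t] img finite_tracks _ _ diagram_nerve[OF \<tau>]])
    show "mono_on {0..<1} (\<lambda>u. fst (track ac e \<tau> t u))"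
      using simplex_index_reparam(1)[OF t e, of 0] by (simp add: track_def)
    show "fst (track ac e \<tau> t u) \<in> {..n}" if "0 \<le> u" "u < 1" for u
      using track_tracks[OF \<tau> t that] by (auto simp: tracks_def)
    show "onOb ?F p = onOb \<tau> (fst p)" if "p \<in> tracks n \<tau>" for p
      using diagram_Ob[OF S that] by (simp add: rho_def labelled_def pullback_def)
    show "onAr ?F (p, q) = onAr \<tau> (fst p, fst q)" if "p \<in> tracks n \<tau>" "q \<in> tracks n \<tau>" "p \<le> q" for p q
      using diagram_hom[OF S that] by (simp add: rho_def labelled_def pullback_def hom_def)
  qed
  finally show ?thesis by (simp add: track_def)
qed

text \<open>The natural morphisms that omit one part of the tuple \<open>as T\<close>, as a diagram on
  \<open>tracks n \<tau> \<times> {0, 1}\<close>: level \<open>0\<close> has the tuple \<open>as T\<close>, where \<open>as\<close> comes from the simplex \<open>\<sigma>\<close> and \<open>T\<close>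
  from the track, and level \<open>1\<close> has \<open>as\<close> or \<open>T\<close>.\<close>
definition joined :: "bool \<Rightarrow> (nat, nat \<times> nat, nat \<times> 'a list \<times> 'o,
    (nat \<times> 'a list \<times> 'o) \<times> (nat \<times> nat \<times> (nat \<Rightarrow> nat)) \<times> 'a list \<times> 'm) functor_data \<Rightarrow>
    (nat, nat \<times> nat, 'o, 'm) functor_data \<Rightarrow> _" where
  "joined b \<sigma> \<tau> = labelled (join_label b (\<lambda>p. simplex_label \<sigma> (fst p)) track_label)
     (join_reindex b (\<lambda>p. simplex_label \<sigma> (fst p)) (\<lambda>p q. simplex_reindex \<sigma> (fst p) (fst q)) track_reindex)
     (pullback (\<lambda>p. fst (fst p)) \<tau>)"

lemma Gr_simplex:
  assumes \<sigma>: "\<sigma> \<in> onOb (nerve Gr) n"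
  shows "nerve_map \<rho> n \<sigma> \<in> onOb (nerve C) n"
    and "label_diagram {..n} (simplex_label \<sigma>) (simplex_reindex \<sigma>)"
    and "i \<le> n \<Longrightarrow> onOb \<sigma> i = onOb (labelled (simplex_label \<sigma>) (simplex_reindex \<sigma>) (nerve_map \<rho> n \<sigma>)) i"
    and "i \<le> j \<Longrightarrow> j \<le> n \<Longrightarrow>
      onAr \<sigma> (i, j) = onAr (labelled (simplex_label \<sigma>) (simplex_reindex \<sigma>) (nerve_map \<rho> n \<sigma>)) (i, j)"
    and "i \<le> n \<Longrightarrow> set (simplex_label \<sigma> i) \<subseteq> A"
    and "i \<le> n \<Longrightarrow> a \<in> set (simplex_label \<sigma> i) \<Longrightarrow> onOb (nerve_map \<rho> n \<sigma>) i \<in> Ob (D a)"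
  using Gr_cech_simplex[where D = D, OF C sub \<sigma>] by simp_all

lemma diagram_joined:
  assumes \<sigma>: "\<sigma> \<in> onOb (nerve Gr) n"
  defines "\<tau> \<equiv> nerve_map \<rho> n \<sigma>"
  shows "diagram Gr (tracks n \<tau> \<times> {..1}) (joined b \<sigma> \<tau>)"
  unfolding joined_def
proof (rule diagram_labelled)
  note \<tau> = Gr_simplex(1)[OF \<sigma>, folded \<tau>_def]
  have T: "fst p \<le> n" "set (track_label p) \<subseteq> A" "\<And>a. a \<in> set (track_label p) \<Longrightarrow> onOb \<tau> (fst p) \<in> Ob (D a)"
    if "p \<in> tracks n \<tau>" for p
    using that labels_A[OF \<tau>] unfolding set_track_label[OF that] by (auto simp: tracks_def)
  have S: "set (simplex_label \<sigma> i) \<subseteq> A" "\<And>a. a \<in> set (simplex_label \<sigma> i) \<Longrightarrow> onOb \<tau> i \<in> Ob (D a)" if "i \<le> n" for i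
    using Gr_simplex(5,6)[OF \<sigma> that] by (auto simp: \<tau>_def)
  show "full_subcategory C (D a)" if "a \<in> A" for a by (rule full[OF that])
  show "label_diagram (tracks n \<tau> \<times> {..1}) (join_label b (\<lambda>p. simplex_label \<sigma> (fst p)) track_label)
      (join_reindex b (\<lambda>p. simplex_label \<sigma> (fst p)) (\<lambda>p q. simplex_reindex \<sigma> (fst p) (fst q)) track_reindex)"
  proof (rule label_diagram_join[OF _ label_diagram_track])
    show "label_diagram (tracks n \<tau>) (\<lambda>p. simplex_label \<sigma> (fst p)) (\<lambda>p q. simplex_reindex \<sigma> (fst p) (fst q))"
      by (rule label_diagram_pullback[OF Gr_simplex(2)[OF \<sigma>]]) (auto simp: tracks_def less_eq_prod_def)
  qed
  show "diagram C (tracks n \<tau> \<times> {..1::nat}) (pullback (\<lambda>p. fst (fst p)) \<tau>)"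
    by (rule diagram_pullback[OF diagram_nerve[OF \<tau>]]) (auto simp: tracks_def less_eq_prod_def)
  show "set (join_label b (\<lambda>p. simplex_label \<sigma> (fst p)) track_label p) \<subseteq> A" if "p \<in> tracks n \<tau> \<times> {..1}" for p
    using that T[of "fst p"] S[of "fst (fst p)"] by (cases p) (auto simp: join_label_def split: if_splits)
  show "onOb (pullback (\<lambda>p. fst (fst p)) \<tau>) p \<in> Ob (D a)" if "p \<in> tracks n \<tau> \<times> {..1::nat}"
    "a \<in> set (join_label b (\<lambda>p. simplex_label \<sigma> (fst p)) track_label p)" for p a
    using that T[of "fst p"] S(2)[of "fst (fst p)" a]
    by (cases p) (auto simp: join_label_def pullback_def split: if_splits)
qed

lemma simplex_act:
  assumes "(m, n, \<phi>) \<in> Ar Delta" and "\<sigma> \<in> onOb (nerve E) n"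
  shows "i \<le> m \<Longrightarrow> simplex_label (act (nerve E) (m, n, \<phi>) \<sigma>) i = simplex_label \<sigma> (\<phi> i)"
    and "i \<le> j \<Longrightarrow> j \<le> m \<Longrightarrow>
      simplex_reindex (act (nerve E) (m, n, \<phi>) \<sigma>) i j = simplex_reindex \<sigma> (\<phi> i) (\<phi> j)"
  using act_nerve_onOb[OF assms] act_nerve_onAr[OF assms]
  by (simp_all add: simplex_label_def simplex_reindex_def)

text \<open>The change of level at time \<open>s\<close> is what realizes a natural transformation as a homotopy: it moves
  through the prism over the simplex. At \<open>s = 0\<close> only level \<open>1\<close> is visited, at \<open>s = 1\<close> only level \<open>0\<close>.\<close>
definition cut_track ::
    "(nat, nat \<times> nat, 'o, 'm) functor_data \<Rightarrow> (nat \<Rightarrow> real) \<Rightarrow> real \<Rightarrow> real \<Rightarrow> (nat \<times> 'a set) \<times> nat" where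
  "cut_track \<tau> t s u = (track ac e \<tau> t u, if u < s then 0 else 1)"

lemma cut_track:
  assumes "\<tau> \<in> onOb (nerve C) n" and "t \<in> standard_simplex n"
  shows "mono_on {0..<1} (cut_track \<tau> t s)"
    and "0 \<le> u \<Longrightarrow> u < 1 \<Longrightarrow> cut_track \<tau> t s u \<in> tracks n \<tau> \<times> {..1}"
proof -
  show "mono_on {0..<1} (cut_track \<tau> t s)"
    using mono_onD[OF track_mono[OF assms]] by (intro mono_onI) (simp add: cut_track_def)
  show "0 \<le> u \<Longrightarrow> u < 1 \<Longrightarrow> cut_track \<tau> t s u \<in> tracks n \<tau> \<times> {..1}"
    using track_tracks[OF assms] by (simp add: cut_track_def)
qed

lemma join_homotopy:
  obtains H where
    "continuous_map (prod_topology (top_of_set {0..1::real}) (classifying_space Gr)) (classifying_space Gr) H"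
    "\<And>n \<sigma> t s. \<lbrakk>\<sigma> \<in> onOb (nerve Gr) n; t \<in> standard_simplex n; s \<in> {0..1}\<rbrakk> \<Longrightarrow>
      H (s, glue_class (nerve Gr) (n, \<sigma>, t)) =
        realize Gr (joined b \<sigma> (nerve_map \<rho> n \<sigma>)) (cut_track (nerve_map \<rho> n \<sigma>) t s)"
proof (rule classifying_space_homotopy[where C = Gr and E = Gr
      and P = "\<lambda>n \<sigma>. tracks n (nerve_map \<rho> n \<sigma>) \<times> {..1::nat}"
      and F = "\<lambda>n \<sigma>. joined b \<sigma> (nerve_map \<rho> n \<sigma>)"
      and f = "\<lambda>n \<sigma> z. cut_track (nerve_map \<rho> n \<sigma>) (fst z) (snd z)"])
  show "finite (tracks n (nerve_map \<rho> n \<sigma>) \<times> {..1::nat})" for n \<sigma> by (simp add: finite_tracks)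
  fix n \<sigma> assume \<sigma>: "\<sigma> \<in> onOb (nerve Gr) n"
  let ?\<tau> = "nerve_map \<rho> n \<sigma>"
  note \<tau> = Gr_simplex(1)[OF \<sigma>]
  show "diagram Gr (tracks n ?\<tau> \<times> {..1}) (joined b \<sigma> ?\<tau>)" by (rule diagram_joined[OF \<sigma>])
  show "mono_on {0..<1} (cut_track ?\<tau> (fst z) (snd z)) \<and>
      cut_track ?\<tau> (fst z) (snd z) ` {0..<1} \<subseteq> tracks n ?\<tau> \<times> {..1}"
    if "z \<in> standard_simplex n \<times> {0..1}" for z
  proof
    have z: "fst z \<in> standard_simplex n" using that by auto
    show "mono_on {0..<1} (cut_track ?\<tau> (fst z) (snd z))" by (rule cut_track(1)[OF \<tau> z])
    show "cut_track ?\<tau> (fst z) (snd z) ` {0..<1} \<subseteq> tracks n ?\<tau> \<times> {..1}"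
      by (intro image_subsetI cut_track(2)[OF \<tau> z]) simp_all
  qed
  have "ae_stable (standard_simplex n \<times> {0..1}) (\<lambda>(z :: (nat \<Rightarrow> real) \<times> real) u. if u < snd z then 0 else 1 :: nat)"
    by (rule ae_stable_cut) (intro continuous_on_snd continuous_on_id)
  from ae_stable_pair[OF ae_stable_track[OF \<tau>] this]
  show "ae_stable (standard_simplex n \<times> {0..1}) (\<lambda>z. cut_track ?\<tau> (fst z) (snd z))"
    by (simp add: cut_track_def[abs_def])
next
  fix m n \<phi> \<sigma> t and s :: real
  assume d: "(m, n, \<phi>) \<in> Ar Delta" and \<sigma>: "\<sigma> \<in> onOb (nerve Gr) n" and t: "t \<in> standard_simplex m"
  let ?\<sigma> = "act (nerve Gr) (m, n, \<phi>) \<sigma>" and ?\<tau> = "nerve_map \<rho> n \<sigma>" and ?t = "simplex_push m \<phi> t"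
  let ?\<tau>' = "nerve_map \<rho> m ?\<sigma>" and ?h = "map_prod (map_prod \<phi> id) id"
  note \<tau> = Gr_simplex(1)[OF \<sigma>] and \<sigma>' = act_nerve_closed[OF d \<sigma>]
  note \<tau>' = Gr_simplex(1)[OF \<sigma>'] and t' = simplex_push_standard_simplex[OF d t]
  have eq: "?\<tau>' = act (nerve C) (m, n, \<phi>) ?\<tau>"
    using simplicial_map_nerve_map[OF Gr rho] d \<sigma> unfolding simplicial_map_def by blast
  have push: "cut_track ?\<tau> ?t s u = ?h (cut_track ?\<tau>' t s u)" if "0 \<le> u" "u < 1" for u
    using track_push[OF d \<tau> t that] by (simp add: cut_track_def eq)
  have "realize Gr (joined b \<sigma> ?\<tau>) (cut_track ?\<tau> ?t s) =
      realize Gr (joined b \<sigma> ?\<tau>) (\<lambda>u. ?h (cut_track ?\<tau>' t s u))"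
    by (rule realize_cong) (rule push)
  also have "\<dots> = realize Gr (joined b ?\<sigma> ?\<tau>') (cut_track ?\<tau>' t s)"
  proof (rule realize_map[where P = "tracks m ?\<tau>' \<times> {..1}" and Q = "tracks n ?\<tau> \<times> {..1}"])
    show "mono_on {0..<1} (cut_track ?\<tau>' t s)" by (rule cut_track(1)[OF \<tau>' t])
    show "cut_track ?\<tau>' t s ` {0..<1} \<subseteq> tracks m ?\<tau>' \<times> {..1}"
      by (intro image_subsetI cut_track(2)[OF \<tau>' t]) simp_all
    show "finite (tracks m ?\<tau>' \<times> {..1::nat})" by (simp add: finite_tracks)
    show "mono_on {0..<1} (\<lambda>u. ?h (cut_track ?\<tau>' t s u))"
    proof (rule mono_onI)
      fix u v :: real assume uv: "u \<in> {0..<1}" "v \<in> {0..<1}" "u \<le> v"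
      show "?h (cut_track ?\<tau>' t s u) \<le> ?h (cut_track ?\<tau>' t s v)"
        using mono_onD[OF cut_track(1)[OF \<tau> t', of s] uv] push[of u] push[of v] uv by simp
    qed
    show "?h (cut_track ?\<tau>' t s u) \<in> tracks n ?\<tau> \<times> {..1}" if "0 \<le> u" "u < 1" for u
      using cut_track(2)[OF \<tau> t' that, of s] by (simp only: push[OF that])
    show "diagram Gr (tracks n ?\<tau> \<times> {..1}) (joined b \<sigma> ?\<tau>)" by (rule diagram_joined[OF \<sigma>])
    have le: "fst (fst p) \<le> m" if "p \<in> tracks m ?\<tau>' \<times> {..1::nat}" for p
      using that by (auto simp: tracks_def)
    have lab: "join_label b (\<lambda>p. simplex_label ?\<sigma> (fst p)) track_label p =
        join_label b (\<lambda>p. simplex_label \<sigma> (fst p)) track_label (?h p)"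
      if "p \<in> tracks m ?\<tau>' \<times> {..1}" for p
      using simplex_act(1)[OF d \<sigma> le[OF that]] by (cases p) (simp add: join_label_def track_label_def)
    have ob: "onOb (pullback (\<lambda>p. fst (fst p)) ?\<tau>') p = onOb (pullback (\<lambda>p. fst (fst p)) ?\<tau>) (?h p)"
      if "p \<in> tracks m ?\<tau>' \<times> {..1::nat}" for p
      using act_nerve_onOb[OF d \<tau> le[OF that]] by (simp add: pullback_def eq)
    show "onOb (joined b ?\<sigma> ?\<tau>') p = onOb (joined b \<sigma> ?\<tau>) (?h p)" if "p \<in> tracks m ?\<tau>' \<times> {..1}" for p
      using lab[OF that] ob[OF that] by (simp add: joined_def labelled_def)
    fix p q assume p: "p \<in> tracks m ?\<tau>' \<times> {..1::nat}" and q: "q \<in> tracks m ?\<tau>' \<times> {..1::nat}" and pq: "p \<le> q"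
    have le': "fst (fst p) \<le> fst (fst q)" using pq by (simp add: less_eq_prod_def)
    have "join_reindex b (\<lambda>p. simplex_label ?\<sigma> (fst p)) (\<lambda>p q. simplex_reindex ?\<sigma> (fst p) (fst q)) track_reindex p q =
        join_reindex b (\<lambda>p. simplex_label \<sigma> (fst p)) (\<lambda>p q. simplex_reindex \<sigma> (fst p) (fst q)) track_reindex (?h p) (?h q)"
      using simplex_act(1)[OF d \<sigma> le[OF p]] simplex_act(1)[OF d \<sigma> le[OF q]]
        simplex_act(2)[OF d \<sigma> le' le[OF q]]
      by (cases p; cases q) (auto simp: join_reindex_def track_reindex_def track_label_def fun_eq_iff split: prod.splits)
    moreover have "onAr (pullback (\<lambda>p. fst (fst p)) ?\<tau>') (p, q) = onAr (pullback (\<lambda>p. fst (fst p)) ?\<tau>) (?h p, ?h q)"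
      using act_nerve_onAr[OF d \<tau> le' le[OF q]] by (simp add: pullback_def eq)
    ultimately show "onAr (joined b ?\<sigma> ?\<tau>') (p, q) = onAr (joined b \<sigma> ?\<tau>) (?h p, ?h q)"
      using lab[OF p] lab[OF q] ob[OF p] by (simp add: joined_def labelled_def)
  qed
  finally show "realize Gr (joined b ?\<sigma> ?\<tau>') (cut_track ?\<tau>' (fst (t, s)) (snd (t, s))) =
      realize Gr (joined b \<sigma> ?\<tau>) (cut_track ?\<tau> (fst (?t, s)) (snd (?t, s)))" by simp
qed (auto intro: that)

context
  fixes \<sigma> n t \<tau>
  assumes \<sigma>: "\<sigma> \<in> onOb (nerve Gr) n" and t: "t \<in> standard_simplex n"
  defines \<tau>_def: "\<tau> \<equiv> nerve_map \<rho> n \<sigma>"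
begin

lemma projection: "\<tau> \<in> onOb (nerve C) n"
  unfolding \<tau>_def by (rule Gr_simplex(1)[OF \<sigma>])

lemma join_left_end:
  "realize Gr (joined True \<sigma> \<tau>) (cut_track \<tau> t 0) = realize Gr \<sigma> (\<lambda>u. simplex_index t (reparam e 0 u))"
proof -
  interpret label_diagram "{..n}" "simplex_label \<sigma>" "simplex_reindex \<sigma>" by (rule Gr_simplex(2)[OF \<sigma>])
  have "realize Gr \<sigma> (\<lambda>u. fst (fst (cut_track \<tau> t 0 u))) = realize Gr (joined True \<sigma> \<tau>) (cut_track \<tau> t 0)"
  proof (rule realize_map[where P = "tracks n \<tau> \<times> {1}" and Q = "{..n}"])
    show "mono_on {0..<1} (cut_track \<tau> t 0)" by (rule cut_track(1)[OF projection t])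
    show "cut_track \<tau> t 0 ` {0..<1} \<subseteq> tracks n \<tau> \<times> {1}"
      using track_tracks[OF projection t] by (auto simp: cut_track_def)
    show "finite (tracks n \<tau> \<times> {1::nat})" by (simp add: finite_tracks)
    show "mono_on {0..<1} (\<lambda>u. fst (fst (cut_track \<tau> t 0 u)))"
      using mono_onD[OF cut_track(1)[OF projection t, of 0]] by (intro mono_onI) (simp add: less_eq_prod_def)
    show "fst (fst (cut_track \<tau> t 0 u)) \<in> {..n}" if "0 \<le> u" "u < 1" for u
      using cut_track(2)[OF projection t that, of 0] by (auto simp: tracks_def)
    show "diagram Gr {..n} \<sigma>" by (rule diagram_nerve[OF \<sigma>])
    show "onOb (joined True \<sigma> \<tau>) p = onOb \<sigma> (fst (fst p))" if "p \<in> tracks n \<tau> \<times> {1}" for p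
    proof -
      have "fst (fst p) \<le> n" "snd p = 1" using that by (auto simp: tracks_def)
      with Gr_simplex(3)[OF \<sigma>, of "fst (fst p)"] show ?thesis
        by (simp add: joined_def labelled_def join_label_def pullback_def \<tau>_def case_prod_beta')
    qed
    show "onAr (joined True \<sigma> \<tau>) (p, q) = onAr \<sigma> (fst (fst p), fst (fst q))"
      if "p \<in> tracks n \<tau> \<times> {1}" "q \<in> tracks n \<tau> \<times> {1}" "p \<le> q" for p q
    proof -
      let ?i = "fst (fst p)" and ?j = "fst (fst q)"
      have p: "?i \<le> n" "snd p = 1" and q: "?j \<le> n" "snd q = 1" and ij: "?i \<le> ?j"
        using that by (auto simp: tracks_def less_eq_prod_def)
      have "k < length (simplex_label \<sigma> ?j)" if "k \<le> length (simplex_label \<sigma> ?j) - Suc 0" for k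
        using that nonempty[of ?j] q by (cases "simplex_label \<sigma> ?j") auto
      then have "restrict (join_reindex True (\<lambda>p. simplex_label \<sigma> (fst p))
          (\<lambda>p q. simplex_reindex \<sigma> (fst p) (fst q)) track_reindex p q) {..length (simplex_label \<sigma> ?j) - Suc 0} =
          restrict (simplex_reindex \<sigma> ?i ?j) {..length (simplex_label \<sigma> ?j) - Suc 0}"
        by (intro restrict_ext) (simp add: join_reindex_def case_prod_beta')
      with Gr_simplex(4)[OF \<sigma> ij q(1)] p q show ?thesis
        by (simp add: joined_def labelled_def join_label_def pullback_def \<tau>_def case_prod_beta')
    qed
  qed
  then show ?thesis by (simp add: cut_track_def track_def)
qed

lemma join_middle:
  "realize Gr (joined True \<sigma> \<tau>) (cut_track \<tau> t 1) = realize Gr (joined False \<sigma> \<tau>) (cut_track \<tau> t 1)"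
proof (rule realize_map[where P = "tracks n \<tau> \<times> {0}" and Q = "tracks n \<tau> \<times> {..1}" and h = "\<lambda>p. p"])
  show "cut_track \<tau> t 1 ` {0..<1} \<subseteq> tracks n \<tau> \<times> {0}"
    using track_tracks[OF projection t] by (auto simp: cut_track_def)
  show "finite (tracks n \<tau> \<times> {0::nat})" by (simp add: finite_tracks)
  show "diagram Gr (tracks n \<tau> \<times> {..1}) (joined True \<sigma> \<tau>)"
    unfolding \<tau>_def by (rule diagram_joined[OF \<sigma>])
  show "cut_track \<tau> t 1 u \<in> tracks n \<tau> \<times> {..1}" if "0 \<le> u" "u < 1" for u
    by (rule cut_track(2)[OF projection t that])
qed (auto simp: cut_track(1)[OF projection t] joined_def labelled_def join_label_def join_reindex_def pullback_def)

lemma join_right_end: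
  "realize Gr (joined False \<sigma> \<tau>) (cut_track \<tau> t 0) = realize Gr (section_diagram \<tau>) (track ac e \<tau> t)"
proof -
  have "realize Gr (joined False \<sigma> \<tau>) (\<lambda>u. (track ac e \<tau> t u, 1)) =
      realize Gr (section_diagram \<tau>) (track ac e \<tau> t)"
  proof (rule realize_map[where P = "tracks n \<tau>" and Q = "tracks n \<tau> \<times> {..1}" and h = "\<lambda>p. (p, 1)"])
    show "mono_on {0..<1} (track ac e \<tau> t)" by (rule track_mono[OF projection t])
    then show "mono_on {0..<1} (\<lambda>u. (track ac e \<tau> t u, 1::nat))" by (simp add: mono_on_def)
    show "track ac e \<tau> t ` {0..<1} \<subseteq> tracks n \<tau>" using track_tracks[OF projection t] by auto
    show "finite (tracks n \<tau>)" by (rule finite_tracks)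
    show "(track ac e \<tau> t u, 1::nat) \<in> tracks n \<tau> \<times> {..1}" if "0 \<le> u" "u < 1" for u
      using track_tracks[OF projection t that] by simp
    show "diagram Gr (tracks n \<tau> \<times> {..1}) (joined False \<sigma> \<tau>)"
      unfolding \<tau>_def by (rule diagram_joined[OF \<sigma>])
  qed (simp_all add: joined_def labelled_def join_label_def join_reindex_def pullback_def)
  moreover have "realize Gr (joined False \<sigma> \<tau>) (cut_track \<tau> t 0) =
      realize Gr (joined False \<sigma> \<tau>) (\<lambda>u. (track ac e \<tau> t u, 1))"
    by (rule realize_cong) (simp add: cut_track_def)
  ultimately show ?thesis by simp
qed

end

text \<open>The composite \<open>g \<circ> B \<rho>\<close> is the end \<open>s = 0\<close> of the homotopy through \<open>as T \<rightarrow> T\<close>. Its other end is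
  shared with the homotopy through \<open>as T \<rightarrow> as\<close>, whose end \<open>s = 0\<close> is the change of speed.\<close>
theorem homotopy_equivalence_rho:
  "homotopy_equivalence (classifying_space Gr) (classifying_space C) (classifying_map C \<rho>)"
proof -
  let ?X = "classifying_space Gr" and ?Y = "classifying_space C" and ?f = "classifying_map C \<rho>"
  obtain G where G: "continuous_map (prod_topology (top_of_set {0..1::real}) ?Y) ?X G"
    and G_eq: "\<And>n \<tau> t s. \<lbrakk>\<tau> \<in> onOb (nerve C) n; t \<in> standard_simplex n; s \<in> {0..1}\<rbrakk> \<Longrightarrow>
      G (s, glue_class (nerve C) (n, \<tau>, t)) = realize Gr (section_diagram \<tau>) (track ac e \<tau> t)"
    by (rule section_exists) (rule that; assumption)
  define g where "g = (\<lambda>c. G (0, c))"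
  have g: "continuous_map ?Y ?X g" unfolding g_def by (rule continuous_map_slice[OF G]) simp
  have g_eq: "g (glue_class (nerve C) (n, \<tau>, t)) = realize Gr (section_diagram \<tau>) (track ac e \<tau> t)"
    if "\<tau> \<in> onOb (nerve C) n" "t \<in> standard_simplex n" for n \<tau> t
    using G_eq[OF that] by (simp add: g_def)
  have f: "continuous_map ?X ?Y ?f" by (rule continuous_map_classifying_map[OF Gr rho])
  have f_eq: "?f (glue_class (nerve Gr) (n, \<sigma>, t)) = glue_class (nerve C) (n, nerve_map \<rho> n \<sigma>, t)" for n \<sigma> t
    by (rule classifying_map_glue_class[OF Gr rho])
  have "homotopic_with (\<lambda>_. True) ?Y ?Y (?f \<circ> g) id"
  proof -
    obtain H where H: "continuous_map (prod_topology (top_of_set {0..1::real}) ?Y) ?Y H"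
      and H_eq: "\<And>n \<sigma> t s. \<lbrakk>\<sigma> \<in> onOb (nerve C) n; t \<in> standard_simplex n; s \<in> {0..1}\<rbrakk> \<Longrightarrow>
        H (s, glue_class (nerve C) (n, \<sigma>, t)) = realize C \<sigma> (\<lambda>u. simplex_index t (reparam e s u))"
      by (rule reparam_homotopy[OF e]) (rule that; assumption)
    show ?thesis
    proof (rule homotopic_slices[OF H])
      fix c assume "c \<in> topspace ?Y"
      then obtain n \<tau> t where c: "\<tau> \<in> onOb (nerve C) n" "t \<in> standard_simplex n" "c = glue_class (nerve C) (n, \<tau>, t)"
        by (rule topspace_classifying_space)
      show "H (0, c) = (?f \<circ> g) c"
        using H_eq[OF c(1,2), of 0] g_eq[OF c(1,2)] rho_section[OF c(1,2)] by (simp add: c(3))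
      show "H (1, c) = id c"
        using H_eq[OF c(1,2), of 1] realize_simplex_index[OF c(1,2)] by (simp add: c(3) reparam_1)
    qed
  qed
  moreover have "homotopic_with (\<lambda>_. True) ?X ?X (g \<circ> ?f) id"
  proof -
    obtain R0 where R0: "continuous_map (prod_topology (top_of_set {0..1::real}) ?X) ?X R0"
      and R0_eq: "\<And>n \<sigma> t s. \<lbrakk>\<sigma> \<in> onOb (nerve Gr) n; t \<in> standard_simplex n; s \<in> {0..1}\<rbrakk> \<Longrightarrow>
        R0 (s, glue_class (nerve Gr) (n, \<sigma>, t)) = realize Gr \<sigma> (\<lambda>u. simplex_index t (reparam e s u))"
      by (rule reparam_homotopy[OF e]) (rule that; assumption)
    have "\<exists>J. continuous_map (prod_topology (top_of_set {0..1::real}) ?X) ?X J \<and>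
        (\<forall>n \<sigma> t s. \<sigma> \<in> onOb (nerve Gr) n \<and> t \<in> standard_simplex n \<and> s \<in> {0..1} \<longrightarrow>
        J (s, glue_class (nerve Gr) (n, \<sigma>, t)) =
          realize Gr (joined b \<sigma> (nerve_map \<rho> n \<sigma>)) (cut_track (nerve_map \<rho> n \<sigma>) t s))" for b
      by (rule join_homotopy[of b]) (intro exI conjI allI impI, assumption, elim conjE, blast)
    then obtain J where J: "\<And>b. continuous_map (prod_topology (top_of_set {0..1::real}) ?X) ?X (J b)"
      and J_eq: "\<And>b n \<sigma> t s. \<lbrakk>\<sigma> \<in> onOb (nerve Gr) n; t \<in> standard_simplex n; s \<in> {0..1}\<rbrakk> \<Longrightarrow>
        J b (s, glue_class (nerve Gr) (n, \<sigma>, t)) =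
          realize Gr (joined b \<sigma> (nerve_map \<rho> n \<sigma>)) (cut_track (nerve_map \<rho> n \<sigma>) t s)"
      by metis
    have "R0 (0, c) = J True (0, c) \<and> R0 (1, c) = c \<and> J True (1, c) = J False (1, c) \<and> J False (0, c) = g (?f c)"
      if "c \<in> topspace ?X" for c
    proof -
      obtain n \<sigma> t where c: "\<sigma> \<in> onOb (nerve Gr) n" "t \<in> standard_simplex n" "c = glue_class (nerve Gr) (n, \<sigma>, t)"
        using \<open>c \<in> topspace ?X\<close> by (rule topspace_classifying_space)
      note J_eq = J_eq[OF c(1,2)] and R0_eq = R0_eq[OF c(1,2)]
      show ?thesis
        using J_eq[of 0 True] J_eq[of 1 True] J_eq[of 0 False] J_eq[of 1 False] R0_eq[of 0] R0_eq[of 1]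
          join_left_end[OF c(1,2)] join_middle[OF c(1,2)] join_right_end[OF c(1,2)]
          g_eq[OF Gr_simplex(1)[OF c(1)] c(2)] realize_simplex_index[OF c(1,2)]
        by (simp add: c(3) f_eq reparam_1)
    qed
    note ends = this
    have "homotopic_with (\<lambda>_. True) ?X ?X (g \<circ> ?f) (\<lambda>c. J False (1, c))"
      by (rule homotopic_slices[OF J[of False]]) (simp_all add: ends)
    moreover have "homotopic_with (\<lambda>_. True) ?X ?X (\<lambda>c. R0 (0, c)) (\<lambda>c. J False (1, c))"
      by (rule homotopic_slices[OF J[of True]]) (simp_all add: ends)
    moreover have "homotopic_with (\<lambda>_. True) ?X ?X (\<lambda>c. R0 (0, c)) id"
      by (rule homotopic_slices[OF R0]) (simp_all add: ends)
    ultimately show ?thesis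
      by (meson homotopic_with_sym homotopic_with_trans)
  qed
  ultimately show ?thesis
    unfolding homotopy_equivalence_def using f g by blast
qed

end

section \<open>Ideal and filter covers\<close>

lemma exists_strict_total_order:
  obtains R :: "'a \<Rightarrow> 'a \<Rightarrow> bool" where "\<And>x. \<not> R x x" "\<And>x y z. R x y \<Longrightarrow> R y z \<Longrightarrow> R x z"
    "\<And>x y. x \<noteq> y \<Longrightarrow> R x y \<or> R y x"
proof -
  obtain r :: "('a \<times> 'a) set" where r: "well_order_on UNIV r" using well_order_on by blast
  then have "trans r" "antisym r" "total_on UNIV r"
    by (auto simp: well_order_on_def linear_order_on_def partial_order_on_def preorder_on_def)
  then show thesis
    by (intro that[of "\<lambda>x y. (x, y) \<in> r \<and> x \<noteq> y"])
      (auto simp: total_on_def antisym_def dest: transD)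
qed

text \<open>For an ideal cover the first half of the motion is played, so that played positions precede the
  positions at which indices are collected; for a filter cover it is the second half.\<close>
theorem theorem1p1:
  fixes C :: "('o, 'm) category"
    and A :: "'a set"
    and D :: "'a \<Rightarrow> ('o, 'm) category"
  assumes "category C"
    and "ideal_cover C A D \<or> filter_cover C A D"
  shows "homotopy_equivalence (classifying_space (Gr_cech C A D)) (classifying_space C)
           (classifying_map C (rho C A D))"
proof -
  have cov: "cover C A D" and full: "\<And>a. a \<in> A \<Longrightarrow> full_subcategory C (D a)"
    using assms(2)
    by (auto simp: ideal_cover_def filter_cover_def category_ideal_def category_filter_def)
  have "Ob C = (\<Union>a\<in>A. Ob (D a))"
  proof -
    have "Ob C = Ob (union_subcategory C A D)" using cov unfolding cover_def by metis
    then show ?thesis by (simp add: union_subcategory_def)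
  qed
  then have "\<forall>x\<in>Ob C. \<exists>a. a \<in> A \<and> x \<in> Ob (D a)" by auto
  then obtain ac where ac: "\<And>x. x \<in> Ob C \<Longrightarrow> ac x \<in> A" "\<And>x. x \<in> Ob C \<Longrightarrow> x \<in> Ob (D (ac x))"
    by metis
  obtain R :: "'a \<Rightarrow> 'a \<Rightarrow> bool" where R: "\<And>x. \<not> R x x" "\<And>x y z. R x y \<Longrightarrow> R y z \<Longrightarrow> R x z"
    "\<And>x y. x \<noteq> y \<Longrightarrow> R x y \<or> R y x"
    using exists_strict_total_order by metis
  define e :: real where "e = (if ideal_cover C A D then 0 else 1)"
  have e: "0 \<le> e" "e \<le> 1" by (auto simp: e_def)
  have "onOb \<tau> (simplex_index t (reparam e 0 u)) \<in>
      Ob (D (ac (onOb \<tau> (simplex_index t (reparam (1 - e) 0 v)))))"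
    if \<tau>: "\<tau> \<in> onOb (nerve C) n" and t: "t \<in> standard_simplex n" and u: "0 \<le> u" "u < 1" and v: "0 \<le> v" "v < 1"
    for \<tau> n t u v
  proof -
    let ?i = "simplex_index t (reparam e 0 u)" and ?j = "simplex_index t (reparam (1 - e) 0 v)"
    have r: "reparam e 0 u < 1" "reparam (1 - e) 0 v < 1"
      using e u v by (auto intro!: reparam_range(2))
    have n: "?i \<le> n" "?j \<le> n" using r by (auto intro: simplex_index_le[OF t])
    note dg = diagram_nerve[OF \<tau>]
    have O: "onOb \<tau> i \<in> Ob C" if "i \<le> n" for i using diagram_Ob[OF dg] that by simp
    have hom: "hom C (onOb \<tau> i) (onOb \<tau> j) \<noteq> {}" if "i \<le> j" "j \<le> n" for i j
      using diagram_hom[OF dg, of i j] that by auto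
    show ?thesis
    proof (cases "ideal_cover C A D")
      case True
      then have "reparam e 0 u \<le> reparam (1 - e) 0 v" using u v by (simp add: e_def reparam_def)
      then have "?i \<le> ?j" by (rule simplex_index_mono[OF t _ r(2)])
      moreover have "category_ideal C (D (ac (onOb \<tau> ?j)))"
        using True ac(1)[OF O[OF n(2)]] by (simp add: ideal_cover_def)
      ultimately show ?thesis
        using O[OF n(1)] ac(2)[OF O[OF n(2)]] hom[OF _ n(2)] unfolding category_ideal_def by blast
    next
      case False
      then have "reparam (1 - e) 0 v \<le> reparam e 0 u" using u v by (simp add: e_def reparam_def)
      then have "?j \<le> ?i" by (rule simplex_index_mono[OF t _ r(1)])
      moreover have "category_filter C (D (ac (onOb \<tau> ?j)))"
        using False assms(2) ac(1)[OF O[OF n(2)]] by (simp add: filter_cover_def)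
      ultimately show ?thesis
        using O[OF n(1)] ac(2)[OF O[OF n(2)]] hom[OF _ n(1)] unfolding category_filter_def by blast
    qed
  qed
  note key = this
  have "cech_choice C A D ac e R"
  proof (rule cech_choice.intro)
    show "category C" by (rule assms(1))
    show "full_subcategory C (D a)" if "a \<in> A" for a by (rule full[OF that])
    show "ac x \<in> A" if "x \<in> Ob C" for x by (rule ac(1)[OF that])
    show "0 \<le> e" "e \<le> 1" by (rule e)+
  qed (rule key R; assumption)+
  then show ?thesis by (rule cech_choice.homotopy_equivalence_rho)
qed

end
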